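(* Let $B=\{(x,y)\in\mathbb{R}^2 : x^2+y^2<1\}$ be the Euclidean unit disk and let $H\in C^1(B)$ be a real-valued function with $\sup_B|H|<\infty$ and $\sup_B|\nabla H|<\infty$. There exists a small constant $\varepsilon>0$ such that for any smooth solution $\psi$ on $B$ of $$\partial\!\!\!/\,\psi=[U(\psi)\Gamma_++V(\psi)\Gamma_-]\psi,$$ with $U,V$ given by one of the following three choices: (i) $U=\overline{V}=-(H-i)|\psi|^2$; (ii) $U=V=-H|\psi|^2-\frac{i}{2}(|\psi_1|^2-|\psi_2|^2)$; (iii) $U=-H|\psi|^2-i\big(\frac32|\psi_2|^2-|\psi_1|^2\big)$ and $V=-H|\psi|^2-i\big(|\psi_2|^2-\frac32|\psi_1|^2\big)$; and satisfying $$E(\psi;B):=\int_B|\psi|^4<\varepsilon,$$ we have $$\|\psi\|_{B',k,p}\le C\,\|\psi\|_{B,0,4}$$ for all $B'\subset\subset B$, all $p>1$ and all positive integers $k$, where $C=C(B',k,p)>0$ is a constant.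
   Context: $\Sigma$ denotes the spinor bundle of $B$ for its (unique) spin structure; it is trivial with fibre $\mathbb{C}^2$, and a spinor field is $\psi=(\psi_1,\psi_2)^T:B\to\mathbb{C}^2$ with $|\psi|^2=|\psi_1|^2+|\psi_2|^2$. Clifford multiplication by the standard frame $e_1,e_2$ is represented by $\sigma_1=\begin{pmatrix}0&1\\-1&0\end{pmatrix}$, $\sigma_2=\begin{pmatrix}0&i\\ i&0\end{pmatrix}$, and the Dirac operator is $\partial\!\!\!/\,\psi=\sigma_1\partial_x\psi+\sigma_2\partial_y\psi$. The chirality operator is $\Gamma:=i\,e_1\cdot e_2\cdot$ (Clifford multiplication), and $\Gamma_+:=\frac12(\mathrm{Id}+\Gamma)$, $\Gamma_-:=\frac12(\mathrm{Id}-\Gamma)$. The three choices of $(U,V)$ are those arising for surfaces immersed in the Lie groups $SU(2)$, $Nil$ and $\widetilde{SL_2}$ respectively. $\|\cdot\|_{B,k,p}$ denotes the norm in the Sobolev space $W^{k,p}(B,\Sigma)$; in particular $\|\cdot\|_{B,0,p}$ is the $L^p$ norm. *)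

theory Defs
  imports "HOL-Analysis.Analysis"
begin

type_synonym plane = "real \<times> real"
type_synonym spinor = "complex ^ 2"

abbreviation unit_disk :: "plane set" where
  "unit_disk \<equiv> ball 0 1"


definition partial_deriv :: "plane \<Rightarrow> (plane \<Rightarrow> 'b::real_normed_vector) \<Rightarrow> plane \<Rightarrow> 'b" where
  "partial_deriv v f = (\<lambda>z. frechet_derivative f (at z) v)"

abbreviation deriv_x :: "(plane \<Rightarrow> 'b::real_normed_vector) \<Rightarrow> plane \<Rightarrow> 'b" where
  "deriv_x \<equiv> partial_deriv (1, 0)"

abbreviation deriv_y :: "(plane \<Rightarrow> 'b::real_normed_vector) \<Rightarrow> plane \<Rightarrow> 'b" where
  "deriv_y \<equiv> partial_deriv (0, 1)"

text \<open>The class \<open>C\<^sup>k\<close> on an open set. Only the values of the function on the open set matter.\<close>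

primrec Ck_on :: "nat \<Rightarrow> plane set \<Rightarrow> (plane \<Rightarrow> 'b::real_normed_vector) \<Rightarrow> bool" where
  "Ck_on 0 \<Omega> f \<longleftrightarrow> continuous_on \<Omega> f"
| "Ck_on (Suc k) \<Omega> f \<longleftrightarrow>
     (\<forall>z\<in>\<Omega>. f differentiable (at z)) \<and> (\<forall>v. Ck_on k \<Omega> (partial_deriv v f))"

definition smooth_on :: "plane set \<Rightarrow> (plane \<Rightarrow> 'b::real_normed_vector) \<Rightarrow> bool" where
  "smooth_on \<Omega> f \<longleftrightarrow> (\<forall>k. Ck_on k \<Omega> f)"

definition gradient :: "(plane \<Rightarrow> real) \<Rightarrow> plane \<Rightarrow> plane" where
  "gradient f z = (deriv_x f z, deriv_y f z)"


text \<open>Multi-indices are pairs \<open>(a, b)\<close>, standing for \<open>a\<close> derivatives in \<open>x\<close> and \<open>b\<close> in \<open>y\<close>.\<close>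

type_synonym multi_index = "nat \<times> nat"

definition mi_order :: "multi_index \<Rightarrow> nat" where
  "mi_order \<alpha> = fst \<alpha> + snd \<alpha>"

definition mi_deriv :: "multi_index \<Rightarrow> (plane \<Rightarrow> 'b::real_normed_vector) \<Rightarrow> plane \<Rightarrow> 'b" where
  "mi_deriv \<alpha> f = (deriv_x ^^ fst \<alpha>) ((deriv_y ^^ snd \<alpha>) f)"

definition test_function :: "plane set \<Rightarrow> (plane \<Rightarrow> real) \<Rightarrow> bool" where
  "test_function \<Omega> \<phi> \<longleftrightarrow>
     smooth_on UNIV \<phi> \<and> compact (closure {z. \<phi> z \<noteq> 0}) \<and> closure {z. \<phi> z \<noteq> 0} \<subseteq> \<Omega>"

definition locally_integrable_on :: "plane set \<Rightarrow> (plane \<Rightarrow> spinor) \<Rightarrow> bool" where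
  "locally_integrable_on \<Omega> f \<longleftrightarrow> (\<forall>K. compact K \<and> K \<subseteq> \<Omega> \<longrightarrow> set_integrable lborel K f)"

definition is_weak_deriv ::
    "plane set \<Rightarrow> multi_index \<Rightarrow> (plane \<Rightarrow> spinor) \<Rightarrow> (plane \<Rightarrow> spinor) \<Rightarrow> bool" where
  "is_weak_deriv \<Omega> \<alpha> f g \<longleftrightarrow>
     locally_integrable_on \<Omega> f \<and> locally_integrable_on \<Omega> g \<and>
     (\<forall>\<phi>. test_function \<Omega> \<phi> \<longrightarrow>
        (LINT z:\<Omega>|lborel. mi_deriv \<alpha> \<phi> z *\<^sub>R f z) =
        (- 1) ^ mi_order \<alpha> *\<^sub>R (LINT z:\<Omega>|lborel. \<phi> z *\<^sub>R g z))"

text \<open>On an open set the weak derivative is unique up to a null set, so the representative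
  chosen here does not affect any of the integrals below.\<close>

definition weak_deriv :: "plane set \<Rightarrow> multi_index \<Rightarrow> (plane \<Rightarrow> spinor) \<Rightarrow> plane \<Rightarrow> spinor" where
  "weak_deriv \<Omega> \<alpha> f = (SOME g. is_weak_deriv \<Omega> \<alpha> f g)"

definition Lp_on :: "plane set \<Rightarrow> real \<Rightarrow> (plane \<Rightarrow> spinor) set" where
  "Lp_on \<Omega> p = {f. set_borel_measurable lborel \<Omega> f \<and>
                   set_integrable lborel \<Omega> (\<lambda>z. norm (f z) powr p)}"

definition sobolev_space :: "plane set \<Rightarrow> nat \<Rightarrow> real \<Rightarrow> (plane \<Rightarrow> spinor) set" where
  "sobolev_space \<Omega> k p =
     {f \<in> Lp_on \<Omega> p. \<forall>\<alpha>. mi_order \<alpha> \<le> k \<longrightarrow> (\<exists>g \<in> Lp_on \<Omega> p. is_weak_deriv \<Omega> \<alpha> f g)}"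

text \<open>Meaningful only for functions in the space \<open>sobolev_space \<Omega> k p\<close>. For \<open>k = 0\<close> this is the
  \<open>L\<^sup>p\<close> norm, because the weak derivative of order \<open>0\<close> of \<open>f\<close> equals \<open>f\<close> almost everywhere.\<close>

definition sobolev_norm :: "plane set \<Rightarrow> nat \<Rightarrow> real \<Rightarrow> (plane \<Rightarrow> spinor) \<Rightarrow> real" where
  "sobolev_norm \<Omega> k p f =
     (\<Sum>\<alpha> | mi_order \<alpha> \<le> k. LINT z:\<Omega>|lborel. norm (weak_deriv \<Omega> \<alpha> f z) powr p) powr (1 / p)"


definition \<sigma>1 :: "complex ^ 2 ^ 2" where
  "\<sigma>1 = vector [vector [0, 1], vector [- 1, 0]]"

definition \<sigma>2 :: "complex ^ 2 ^ 2" where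
  "\<sigma>2 = vector [vector [0, \<i>], vector [\<i>, 0]]"

definition dirac :: "(plane \<Rightarrow> spinor) \<Rightarrow> plane \<Rightarrow> spinor" where
  "dirac \<psi> z = \<sigma>1 *v deriv_x \<psi> z + \<sigma>2 *v deriv_y \<psi> z"

text \<open>As \<open>mat c\<close> is \<open>c\<close> times the identity matrix, \<open>mat c ** A\<close> is the complex multiple \<open>c A\<close>.\<close>

definition \<Gamma> :: "complex ^ 2 ^ 2" where
  "\<Gamma> = mat \<i> ** (\<sigma>1 ** \<sigma>2)"

definition \<Gamma>_plus :: "complex ^ 2 ^ 2" where
  "\<Gamma>_plus = mat (1 / 2) ** (mat 1 + \<Gamma>)"

definition \<Gamma>_minus :: "complex ^ 2 ^ 2" where
  "\<Gamma>_minus = mat (1 / 2) ** (mat 1 - \<Gamma>)"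


text \<open>The ambient Lie groups \<open>SU(2)\<close>, \<open>Nil\<close> and the universal cover of \<open>SL\<^sub>2\<close>. In the potentials,
  \<open>h\<close> is the value of \<open>H\<close> and \<open>s\<close> the value of the spinor at the point considered; the norm of
  \<open>s\<close> is the Hermitian one on \<open>\<complex>\<^sup>2\<close>.\<close>

datatype ambient_group = SU2 | Nil3 | SL2_tilde

fun potential_U :: "ambient_group \<Rightarrow> real \<Rightarrow> spinor \<Rightarrow> complex" where
  "potential_U SU2 h s = - (of_real h - \<i>) * of_real ((norm s)\<^sup>2)"
| "potential_U Nil3 h s =
     - of_real (h * (norm s)\<^sup>2) - \<i> / 2 * of_real ((norm (s $ 1))\<^sup>2 - (norm (s $ 2))\<^sup>2)"
| "potential_U SL2_tilde h s =
     - of_real (h * (norm s)\<^sup>2) - \<i> * of_real (3 / 2 * (norm (s $ 2))\<^sup>2 - (norm (s $ 1))\<^sup>2)"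

fun potential_V :: "ambient_group \<Rightarrow> real \<Rightarrow> spinor \<Rightarrow> complex" where
  "potential_V SU2 h s = cnj (potential_U SU2 h s)"
| "potential_V Nil3 h s = potential_U Nil3 h s"
| "potential_V SL2_tilde h s =
     - of_real (h * (norm s)\<^sup>2) - \<i> * of_real ((norm (s $ 2))\<^sup>2 - 3 / 2 * (norm (s $ 1))\<^sup>2)"

definition solves_dirac_eq ::
    "ambient_group \<Rightarrow> (plane \<Rightarrow> real) \<Rightarrow> plane set \<Rightarrow> (plane \<Rightarrow> spinor) \<Rightarrow> bool" where
  "solves_dirac_eq G H \<Omega> \<psi> \<longleftrightarrow>
     (\<forall>z\<in>\<Omega>. dirac \<psi> z =
        (mat (potential_U G (H z) (\<psi> z)) ** \<Gamma>_plus
          + mat (potential_V G (H z) (\<psi> z)) ** \<Gamma>_minus) *v \<psi> z)"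

definition energy :: "(plane \<Rightarrow> spinor) \<Rightarrow> plane set \<Rightarrow> ennreal" where
  "energy \<psi> \<Omega> = (\<integral>\<^sup>+ z \<in> \<Omega>. ennreal (norm (\<psi> z) ^ 4) \<partial>lborel)"

end

theory Submission
  imports Defs
begin

text \<open>
  With \<open>f = \<psi>\<^sub>2\<close> and \<open>g = cnj \<psi>\<^sub>1\<close> the equation is a system \<open>dbar f = P\<close>, \<open>dbar g = Q\<close> with right-hand sides that are
  cubic in \<open>f, g\<close> and affine in the bounded function \<open>H\<close>. A mean value inequality for \<open>dbar\<close> and a scaling argument at a
  maximum point of \<open>(\<rho> - |z|) |\<psi>|\<^sup>2\<close> bound \<open>|\<psi>|\<close> on compact sets by the fourth root of the energy, if the energy is small.

  Since \<open>H\<close> is only of class \<open>C\<^sup>1\<close>, the higher derivatives cannot be estimated by bootstrapping alone. However, the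
  existence of a smooth solution constrains \<open>H\<close>. If every solution vanishes to infinite order at \<open>p\<close>, then, by unique
  continuation, every solution vanishes near \<open>p\<close>. If some solution has a zero of finite order \<open>m\<close> at \<open>p\<close>, its leading part
  is a multiple of \<open>(z - p)\<^sup>m\<close>, and the equation exhibits \<open>H\<close> near \<open>p\<close> as a smooth function away from \<open>p\<close> whose derivatives of
  order \<open>k\<close> are \<open>O(|z - p|\<^sup>-\<^sup>k)\<close>. For another solution with cubic term \<open>P\<close>, the Taylor remainder of \<open>P\<close> at \<open>p\<close> compensates this
  singularity, and the Taylor polynomial lies in a finite-dimensional space of polynomials \<open>t\<close> for which the derivatives of
  \<open>H t\<close> are bounded. Hence \<open>H P\<close> is estimated as if \<open>H\<close> were smooth, with constants that depend on \<open>H\<close> and \<open>p\<close> only.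
\<close>

subsection \<open>Partial derivatives and smooth functions\<close>

text \<open>The obstacle is one of quantifiers: the constant may depend on \<open>H\<close>,
  \<open>B'\<close>, \<open>k\<close> and \<open>p\<close>, but not on the solution, while high
  derivatives of \<open>H\<close> are accessible only through solutions. The case distinction at a
  point is therefore made over all solutions at once, and for all three groups together, since
  \<open>spin_system\<close> hides their coefficients under an existential. One solution with a zero
  of finite order serves as a witness that fixes the singular structure of \<open>H\<close> there;
  the estimate is then proved for every other solution. Compactness of \<open>closure B'\<close>
  leaves finitely many points. All interior estimates are pointwise and come from one averaging
  inequality for \<open>dbar\<close> with an explicit kernel. The orders of differentiation match
  because \<open>dbar\<close> of a derivative of order \<open>k\<close> is a derivative of order
  \<open>k\<close> of the cubic right-hand side, where the top order enters linearly and is absorbed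
  on small balls. Sobolev norms appear only at the end, once the classical derivatives are
  bounded.\<close>

declare split_paired_All [simp del] split_paired_Ex [simp del]

lemma partial_deriv_at: "(f has_derivative f') (at z) \<Longrightarrow> partial_deriv v f z = f' v"
  unfolding partial_deriv_def by (metis frechet_derivative_at)

lemma has_derivative_partial_deriv:
  "f differentiable (at z) \<Longrightarrow> (f has_derivative (\<lambda>v. partial_deriv v f z)) (at z)"
  unfolding partial_deriv_def frechet_derivative_works .

lemma partial_deriv_eq_coords:
  assumes "f differentiable (at z)"
  shows "partial_deriv v f z = fst v *\<^sub>R deriv_x f z + snd v *\<^sub>R deriv_y f z"
proof -
  have "linear (\<lambda>v. partial_deriv v f z)"
    using has_derivative_partial_deriv[OF assms] by (rule has_derivative_linear)
  then interpret linear "\<lambda>v. partial_deriv v f z" .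
  have "v = fst v *\<^sub>R (1, 0) + snd v *\<^sub>R (0, 1)" by (cases v) simp
  then show ?thesis by (metis add scaleR)
qed

lemma has_derivative_cong_open:
  assumes "open \<Omega>" "z \<in> \<Omega>" "\<And>x. x \<in> \<Omega> \<Longrightarrow> f x = g x"
  shows "(f has_derivative f') (at z) \<longleftrightarrow> (g has_derivative f') (at z)"
proof
  show "(g has_derivative f') (at z)" if "(f has_derivative f') (at z)"
    by (rule has_derivative_transform_within_open[OF that assms(1,2)]) (fact assms(3))
  show "(f has_derivative f') (at z)" if "(g has_derivative f') (at z)"
    by (rule has_derivative_transform_within_open[OF that assms(1,2)]) (rule assms(3)[symmetric])
qed

lemma partial_deriv_cong:
  assumes "open \<Omega>" "z \<in> \<Omega>" "\<And>x. x \<in> \<Omega> \<Longrightarrow> f x = g x"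
  shows "partial_deriv v f z = partial_deriv v g z"
proof -
  have "(\<lambda>f'. (f has_derivative f') (at z)) = (\<lambda>f'. (g has_derivative f') (at z))"
    using has_derivative_cong_open[OF assms] by (intro ext)
  then show ?thesis by (simp add: partial_deriv_def frechet_derivative_def)
qed

lemma Ck_on_cong:
  assumes "open \<Omega>" "\<And>x. x \<in> \<Omega> \<Longrightarrow> f x = g x"
  shows "Ck_on k \<Omega> f \<longleftrightarrow> Ck_on k \<Omega> g"
  using assms(2)
proof (induction k arbitrary: f g)
  case 0 then show ?case by (simp cong: continuous_on_cong)
next
  case (Suc k)
  have "f differentiable (at z) \<longleftrightarrow> g differentiable (at z)" if "z \<in> \<Omega>" for z
    unfolding differentiable_def using has_derivative_cong_open[of \<Omega> z f g, OF assms(1) that Suc.prems] by simp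
  moreover have "Ck_on k \<Omega> (partial_deriv v f) \<longleftrightarrow> Ck_on k \<Omega> (partial_deriv v g)" for v
    using partial_deriv_cong[OF assms(1)] Suc.prems by (intro Suc.IH) blast
  ultimately show ?case by simp
qed

lemma Ck_on_eqI:
  "open \<Omega> \<Longrightarrow> (\<And>x. x \<in> \<Omega> \<Longrightarrow> f x = g x) \<Longrightarrow> Ck_on k \<Omega> g \<Longrightarrow> Ck_on k \<Omega> f"
  using Ck_on_cong by blast

lemma Ck_on_SucD: "Ck_on (Suc k) \<Omega> f \<Longrightarrow> Ck_on k \<Omega> f"
proof (induction k arbitrary: f)
  case 0 then show ?case
    by (simp add: continuous_at_imp_continuous_on differentiable_imp_continuous_within)
next
  case (Suc k) then show ?case by (metis Ck_on.simps(2))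
qed

lemma Ck_on_mono: "Ck_on k \<Omega> f \<Longrightarrow> j \<le> k \<Longrightarrow> Ck_on j \<Omega> f"
proof (induction k)
  case (Suc k) then show ?case using Ck_on_SucD[of k \<Omega> f] by (cases "j = Suc k") (auto simp del: Ck_on.simps)
qed simp

lemma Ck_on_subset: "Ck_on k \<Omega> f \<Longrightarrow> \<Omega>' \<subseteq> \<Omega> \<Longrightarrow> Ck_on k \<Omega>' f"
  by (induction k arbitrary: f) (auto intro: continuous_on_subset)

lemma smooth_on_subset: "smooth_on \<Omega> f \<Longrightarrow> \<Omega>' \<subseteq> \<Omega> \<Longrightarrow> smooth_on \<Omega>' f"
  unfolding smooth_on_def by (blast intro: Ck_on_subset)

lemma smooth_on_cong:
  "open \<Omega> \<Longrightarrow> (\<And>x. x \<in> \<Omega> \<Longrightarrow> f x = g x) \<Longrightarrow> smooth_on \<Omega> f \<longleftrightarrow> smooth_on \<Omega> g"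
  unfolding smooth_on_def using Ck_on_cong by metis

lemma smooth_on_partial_deriv: "smooth_on \<Omega> f \<Longrightarrow> smooth_on \<Omega> (partial_deriv v f)"
  unfolding smooth_on_def by (metis Ck_on.simps(2))

lemma smooth_on_differentiable: "smooth_on \<Omega> f \<Longrightarrow> z \<in> \<Omega> \<Longrightarrow> f differentiable (at z)"
  unfolding smooth_on_def by (metis Ck_on.simps(2))

lemma smooth_on_continuous: "smooth_on \<Omega> f \<Longrightarrow> continuous_on \<Omega> f"
  unfolding smooth_on_def by (metis Ck_on.simps(1))

lemma partial_deriv_const [simp]: "partial_deriv v (\<lambda>z. c) = (\<lambda>z. 0)"
  by (rule ext) (auto intro!: partial_deriv_at derivative_eq_intros)

lemma Ck_on_const [simp]: "Ck_on k \<Omega> (\<lambda>z. c)"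
  by (induction k arbitrary: c) auto

lemma smooth_on_const [simp]: "smooth_on \<Omega> (\<lambda>z. c)"
  by (simp add: smooth_on_def)

lemma partial_deriv_bounded_linear:
  assumes "bounded_linear L" "f differentiable (at z)"
  shows "partial_deriv v (\<lambda>z. L (f z)) z = L (partial_deriv v f z)"
  using bounded_linear.has_derivative[OF assms(1) has_derivative_partial_deriv[OF assms(2)]]
  by (rule partial_deriv_at)

lemma Ck_on_bounded_linear:
  assumes L: "bounded_linear L" and \<Omega>: "open \<Omega>"
  shows "Ck_on k \<Omega> f \<Longrightarrow> Ck_on k \<Omega> (\<lambda>z. L (f z))"
proof (induction k arbitrary: f)
  case 0 then show ?case using L by (auto intro: bounded_linear.continuous_on)
next
  case (Suc k)
  have "Ck_on k \<Omega> (partial_deriv v (\<lambda>z. L (f z)))" for v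
  proof (rule Ck_on_eqI[OF \<Omega>])
    show "Ck_on k \<Omega> (\<lambda>z. L (partial_deriv v f z))" using Suc by simp
    show "partial_deriv v (\<lambda>z. L (f z)) x = L (partial_deriv v f x)" if "x \<in> \<Omega>" for x
      using Suc.prems that by (intro partial_deriv_bounded_linear[OF L]) simp
  qed
  moreover have "(\<lambda>z. L (f z)) differentiable at z" if "z \<in> \<Omega>" for z
    using Suc.prems that bounded_linear.has_derivative[OF L] unfolding differentiable_def
    by (metis Ck_on.simps(2) differentiable_def)
  ultimately show ?case by simp
qed

lemma partial_deriv_add:
  assumes "f differentiable (at z)" "g differentiable (at z)"
  shows "partial_deriv v (\<lambda>z. f z + g z) z = partial_deriv v f z + partial_deriv v g z"
  using has_derivative_add[OF has_derivative_partial_deriv[OF assms(1)] has_derivative_partial_deriv[OF assms(2)]] by (rule partial_deriv_at)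

lemma Ck_on_add:
  assumes \<Omega>: "open \<Omega>"
  shows "Ck_on k \<Omega> f \<Longrightarrow> Ck_on k \<Omega> g \<Longrightarrow> Ck_on k \<Omega> (\<lambda>z. f z + g z)"
proof (induction k arbitrary: f g)
  case 0 then show ?case by (auto intro: continuous_intros)
next
  case (Suc k)
  have "Ck_on k \<Omega> (partial_deriv v (\<lambda>z. f z + g z))" for v
  proof (rule Ck_on_eqI[OF \<Omega>])
    show "Ck_on k \<Omega> (\<lambda>z. partial_deriv v f z + partial_deriv v g z)" using Suc by simp
    show "partial_deriv v (\<lambda>z. f z + g z) x = partial_deriv v f x + partial_deriv v g x" if "x \<in> \<Omega>" for x
      using Suc.prems that by (intro partial_deriv_add) simp_all
  qed
  then show ?case using Suc.prems by simp
qed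

lemma has_derivative_bilinear_partial:
  assumes "bounded_bilinear B" "f differentiable (at z)" "g differentiable (at z)"
  shows "((\<lambda>z. B (f z) (g z)) has_derivative
    (\<lambda>v. B (f z) (partial_deriv v g z) + B (partial_deriv v f z) (g z))) (at z)"
  by (rule bounded_bilinear.FDERIV[OF assms(1)]) (intro has_derivative_partial_deriv assms)+

lemma partial_deriv_bilinear:
  assumes "bounded_bilinear B" "f differentiable (at z)" "g differentiable (at z)"
  shows "partial_deriv v (\<lambda>z. B (f z) (g z)) z = B (partial_deriv v f z) (g z) + B (f z) (partial_deriv v g z)"
  using partial_deriv_at[OF has_derivative_bilinear_partial[OF assms]] by (simp add: add.commute)

lemma differentiable_bilinear:
  fixes z :: plane
  assumes "bounded_bilinear B" "f differentiable (at z)" "g differentiable (at z)"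
  shows "(\<lambda>z. B (f z) (g z)) differentiable (at z)"
  using has_derivative_bilinear_partial[OF assms] unfolding differentiable_def by blast

lemma Ck_on_bilinear:
  assumes B: "bounded_bilinear B" and \<Omega>: "open \<Omega>"
  shows "Ck_on k \<Omega> f \<Longrightarrow> Ck_on k \<Omega> g \<Longrightarrow> Ck_on k \<Omega> (\<lambda>z. B (f z) (g z))"
proof (induction k arbitrary: f g)
  case 0 then show ?case by (auto intro: bounded_bilinear.continuous_on[OF B])
next
  case (Suc k)
  have fg: "Ck_on k \<Omega> f" "Ck_on k \<Omega> g" using Suc.prems Ck_on_SucD by blast+
  have "Ck_on k \<Omega> (partial_deriv v (\<lambda>z. B (f z) (g z)))" for v
  proof (rule Ck_on_eqI[OF \<Omega>])
    show "Ck_on k \<Omega> (\<lambda>z. B (partial_deriv v f z) (g z) + B (f z) (partial_deriv v g z))"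
      using Suc.prems fg by (intro Ck_on_add[OF \<Omega>] Suc.IH) simp_all
    show "partial_deriv v (\<lambda>z. B (f z) (g z)) x = B (partial_deriv v f x) (g x) + B (f x) (partial_deriv v g x)" if "x \<in> \<Omega>" for x
      using Suc.prems that by (intro partial_deriv_bilinear[OF B]) simp_all
  qed
  then show ?case using Suc.prems by (auto intro: differentiable_bilinear[OF B])
qed

lemma smooth_on_bounded_linear:
  "bounded_linear L \<Longrightarrow> open \<Omega> \<Longrightarrow> smooth_on \<Omega> f \<Longrightarrow> smooth_on \<Omega> (\<lambda>z. L (f z))"
  by (simp add: smooth_on_def Ck_on_bounded_linear)

lemma smooth_on_add:
  "open \<Omega> \<Longrightarrow> smooth_on \<Omega> f \<Longrightarrow> smooth_on \<Omega> g \<Longrightarrow> smooth_on \<Omega> (\<lambda>z. f z + g z)"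
  by (simp add: smooth_on_def Ck_on_add)

lemma smooth_on_bilinear:
  "bounded_bilinear B \<Longrightarrow> open \<Omega> \<Longrightarrow> smooth_on \<Omega> f \<Longrightarrow> smooth_on \<Omega> g \<Longrightarrow> smooth_on \<Omega> (\<lambda>z. B (f z) (g z))"
  by (simp add: smooth_on_def Ck_on_bilinear)

lemmas smooth_on_mult = smooth_on_bilinear[OF bounded_bilinear_mult]
lemmas smooth_on_scaleR = smooth_on_bilinear[OF bounded_bilinear_scaleR]
lemmas smooth_on_cnj = smooth_on_bounded_linear[OF bounded_linear_cnj]
lemmas smooth_on_of_real = smooth_on_bounded_linear[OF bounded_linear_of_real]
lemmas smooth_on_minus = smooth_on_bounded_linear[OF bounded_linear_minus[OF bounded_linear_ident]]

lemma smooth_on_diff: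
  "open \<Omega> \<Longrightarrow> smooth_on \<Omega> f \<Longrightarrow> smooth_on \<Omega> g \<Longrightarrow> smooth_on \<Omega> (\<lambda>z. f z - g z)"
  using smooth_on_add[of \<Omega> f "\<lambda>z. - g z"] smooth_on_minus[of \<Omega> g] by simp

lemma smooth_on_sum:
  assumes "open \<Omega>" "\<And>i. i \<in> I \<Longrightarrow> smooth_on \<Omega> (f i)"
  shows "smooth_on \<Omega> (\<lambda>z. \<Sum>i\<in>I. f i z)"
  using assms(2) by (induction I rule: infinite_finite_induct) (auto intro!: smooth_on_add[OF assms(1)])

text \<open>The derivative of \<open>inverse f\<close> contains \<open>inverse f\<close> itself only
  undifferentiated, so the induction on \<open>k\<close> closes.\<close>

lemma Ck_on_inverse:
  fixes f :: "plane \<Rightarrow> 'a::real_normed_field"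
  assumes \<Omega>: "open \<Omega>" and nz: "\<And>z. z \<in> \<Omega> \<Longrightarrow> f z \<noteq> 0"
  shows "Ck_on k \<Omega> f \<Longrightarrow> Ck_on k \<Omega> (\<lambda>z. inverse (f z))"
proof (induction k)
  case 0 then show ?case using nz by (auto intro: continuous_intros)
next
  case (Suc k)
  have fk: "Ck_on k \<Omega> f" using Suc.prems by (rule Ck_on_SucD)
  note IH = Suc.IH[OF fk]
  have d: "((\<lambda>z. inverse (f z)) has_derivative (\<lambda>v. - (inverse (f z) * partial_deriv v f z * inverse (f z)))) (at z)"
    if "z \<in> \<Omega>" for z
  proof (rule Deriv.has_derivative_inverse)
    show "f z \<noteq> 0" by (rule nz[OF that])
    show "(f has_derivative (\<lambda>v. partial_deriv v f z)) (at z)"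
      using Suc.prems that by (intro has_derivative_partial_deriv) simp
  qed
  have "Ck_on k \<Omega> (partial_deriv v (\<lambda>z. inverse (f z)))" for v
  proof (rule Ck_on_eqI[OF \<Omega>])
    show "partial_deriv v (\<lambda>z. inverse (f z)) x = - (inverse (f x) * partial_deriv v f x * inverse (f x))" if "x \<in> \<Omega>" for x
      using partial_deriv_at[OF d[OF that]] .
    show "Ck_on k \<Omega> (\<lambda>z. - (inverse (f z) * partial_deriv v f z * inverse (f z)))"
      using IH Suc.prems
      by (intro Ck_on_bounded_linear[OF bounded_linear_minus[OF bounded_linear_ident] \<Omega>] Ck_on_bilinear[OF bounded_bilinear_mult \<Omega>]) simp_all
  qed
  then show ?case using d differentiable_def by (metis Ck_on.simps(2))
qed

lemma smooth_on_inverse: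
  fixes f :: "plane \<Rightarrow> 'a::real_normed_field"
  shows "open \<Omega> \<Longrightarrow> (\<And>z. z \<in> \<Omega> \<Longrightarrow> f z \<noteq> 0) \<Longrightarrow> smooth_on \<Omega> f \<Longrightarrow> smooth_on \<Omega> (\<lambda>z. inverse (f z))"
  by (simp add: smooth_on_def Ck_on_inverse)

subsection \<open>Symmetry of second derivatives\<close>

lemma partial_deriv_line:
  assumes "f differentiable (at (p + t *\<^sub>R v))"
  shows "((\<lambda>t. f (p + t *\<^sub>R v)) has_vector_derivative partial_deriv v f (p + t *\<^sub>R v)) (at t)"
proof -
  have "((\<lambda>t. p + t *\<^sub>R v) has_derivative (\<lambda>h. h *\<^sub>R v)) (at t)"
    by (auto intro!: derivative_eq_intros)
  from diff_chain_at[OF this has_derivative_partial_deriv[OF assms]]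
  have "((\<lambda>t. f (p + t *\<^sub>R v)) has_derivative (\<lambda>h. partial_deriv (h *\<^sub>R v) f (p + t *\<^sub>R v))) (at t)"
    by (simp add: o_def)
  moreover have "partial_deriv (h *\<^sub>R v) f (p + t *\<^sub>R v) = h *\<^sub>R partial_deriv v f (p + t *\<^sub>R v)" for h
    using linear_scale[OF has_derivative_linear[OF has_derivative_partial_deriv[OF assms]]] .
  ultimately show ?thesis by (simp add: has_vector_derivative_def)
qed

text \<open>Both mixed derivatives are the limit of the same second difference quotient.\<close>

lemma second_difference:
  assumes \<Omega>: "open \<Omega>" "z \<in> \<Omega>" and f: "\<And>x. x \<in> \<Omega> \<Longrightarrow> f differentiable (at x)"
    and g: "partial_deriv v f differentiable (at z)" and e: "e > 0"
  shows "\<exists>d>0. \<forall>s. 0 < s \<and> s < d \<longrightarrow>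
    norm (f (z + s *\<^sub>R u + s *\<^sub>R v) - f (z + s *\<^sub>R u) - f (z + s *\<^sub>R v) + f z
      - (s * s) *\<^sub>R partial_deriv u (partial_deriv v f) z) \<le> e * (s * s)"
proof -
  define K where "K = norm u + norm v + 1"
  have K: "K > 0" "norm u \<le> K" "norm v \<le> K" unfolding K_def by (auto simp: add_nonneg_pos)
  let ?g = "partial_deriv v f" and ?L = "\<lambda>w. partial_deriv w (partial_deriv v f) z"
  have L: "(?g has_derivative ?L) (at z)" by (rule has_derivative_partial_deriv[OF g])
  \<comment> \<open>Two remainders, each at most \<open>e' * (2 * s * K)\<close>, have to add up to
    \<open>e * s\<close>.\<close>
  define e' where "e' = e / (4 * K)"
  have e': "e' > 0" using e K unfolding e'_def by simp
  obtain d1 where d1: "d1 > 0" "\<And>y. norm (y - z) < d1 \<Longrightarrow> norm (?g y - ?g z - ?L (y - z)) \<le> e' * norm (y - z)"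
    using L e' unfolding has_derivative_at_alt by blast
  obtain d2 where d2: "d2 > 0" "ball z d2 \<subseteq> \<Omega>" using \<Omega> by (meson open_contains_ball)
  interpret L: linear ?L using L by (rule has_derivative_linear)
  define d where "d = min d1 d2 / (2 * K)"
  have "d > 0" using d1(1) d2(1) K by (simp add: d_def)
  moreover have "norm (f (z + s *\<^sub>R u + s *\<^sub>R v) - f (z + s *\<^sub>R u) - f (z + s *\<^sub>R v) + f z
      - (s * s) *\<^sub>R ?L u) \<le> e * (s * s)" if s: "0 < s" "s < d" for s
  proof -
    have s2: "2 * s * K < min d1 d2" using s K by (simp add: d_def field_simps)
    have nrm: "norm (s *\<^sub>R u + t *\<^sub>R v) \<le> 2 * s * K" "norm (t *\<^sub>R v) \<le> 2 * s * K" if "0 \<le> t" "t \<le> s" for t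
    proof -
      have a: "norm (t *\<^sub>R v) \<le> s * K" "norm (s *\<^sub>R u) \<le> s * K" using that K s by (auto intro!: mult_mono)
      show "norm (t *\<^sub>R v) \<le> 2 * s * K" using a(1) mult_pos_pos[OF s(1) K(1)] by linarith
      show "norm (s *\<^sub>R u + t *\<^sub>R v) \<le> 2 * s * K" using a norm_triangle_ineq[of "s *\<^sub>R u" "t *\<^sub>R v"] by linarith
    qed
    have inO: "z + s *\<^sub>R u + t *\<^sub>R v \<in> \<Omega>" "z + t *\<^sub>R v \<in> \<Omega>" if "0 \<le> t" "t \<le> s" for t
    proof -
      have "z + w \<in> \<Omega>" if "norm w \<le> 2 * s * K" for w
        using that s2 d2(2) by (intro subsetD[OF d2(2)]) (simp add: dist_norm)
      from this[OF nrm(1)[OF that]] this[OF nrm(2)[OF that]]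
      show "z + s *\<^sub>R u + t *\<^sub>R v \<in> \<Omega>" "z + t *\<^sub>R v \<in> \<Omega>"
        by (simp_all add: add.assoc)
    qed
    \<comment> \<open>The increment of \<open>h\<close> over \<open>[0, s]\<close> is the second
      difference minus its expected value; the mean value inequality then needs a bound of
      \<open>h'\<close> by \<open>e * s\<close> only.\<close>
    define h where "h t = f (z + s *\<^sub>R u + t *\<^sub>R v) - f (z + t *\<^sub>R v) - t *\<^sub>R (s *\<^sub>R ?L u)" for t
    have h': "(h has_vector_derivative (?g (z + s *\<^sub>R u + t *\<^sub>R v) - ?g (z + t *\<^sub>R v) - s *\<^sub>R ?L u)) (at t)"
      if "0 \<le> t" "t \<le> s" for t
      unfolding h_def using inO[OF that]
      by (auto intro!: derivative_eq_intros partial_deriv_line f)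
    have hb: "norm (?g (z + s *\<^sub>R u + t *\<^sub>R v) - ?g (z + t *\<^sub>R v) - s *\<^sub>R ?L u) \<le> e * s"
      if t: "0 \<le> t" "t \<le> s" for t
    proof -
      have 1: "norm (?g (z + s *\<^sub>R u + t *\<^sub>R v) - ?g z - ?L (s *\<^sub>R u + t *\<^sub>R v)) \<le> e' * (2 * s * K)"
        using d1(2)[of "z + s *\<^sub>R u + t *\<^sub>R v"] nrm(1)[OF t] s2 mult_left_mono[OF nrm(1)[OF t] less_imp_le[OF e']]
        by (simp add: add.assoc)
      have 2: "norm (?g (z + t *\<^sub>R v) - ?g z - ?L (t *\<^sub>R v)) \<le> e' * (2 * s * K)"
        using d1(2)[of "z + t *\<^sub>R v"] nrm(2)[OF t] s2 mult_left_mono[OF nrm(2)[OF t] less_imp_le[OF e']]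
        by simp
      have "?g (z + s *\<^sub>R u + t *\<^sub>R v) - ?g (z + t *\<^sub>R v) - s *\<^sub>R ?L u
         = (?g (z + s *\<^sub>R u + t *\<^sub>R v) - ?g z - ?L (s *\<^sub>R u + t *\<^sub>R v)) - (?g (z + t *\<^sub>R v) - ?g z - ?L (t *\<^sub>R v))"
        by (simp add: L.add L.scaleR)
      also have "norm \<dots> \<le> e' * (2 * s * K) + e' * (2 * s * K)" using 1 2 by (intro order_trans[OF norm_triangle_ineq4]) linarith
      also have "\<dots> = e * s" using K by (simp add: e'_def field_simps)
      finally show ?thesis .
    qed
    have "norm (h s - h 0) \<le> (e * s) * norm (s - 0)"
    proof (rule differentiable_bound[of "{0..s}"])
      show "(h has_derivative (\<lambda>k. k *\<^sub>R (?g (z + s *\<^sub>R u + t *\<^sub>R v) - ?g (z + t *\<^sub>R v) - s *\<^sub>R ?L u))) (at t within {0..s})"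
        if "t \<in> {0..s}" for t
        using h'[of t] that unfolding has_vector_derivative_def by (auto intro: has_derivative_at_withinI)
      show "onorm (\<lambda>k. k *\<^sub>R (?g (z + s *\<^sub>R u + t *\<^sub>R v) - ?g (z + t *\<^sub>R v) - s *\<^sub>R ?L u)) \<le> e * s"
        if "t \<in> {0..s}" for t
        using hb[of t] that by (intro onorm_le) (auto simp: mult.commute[of "e * s"] intro!: mult_left_mono)
    qed (use s in auto)
    then show ?thesis using s by (simp add: h_def algebra_simps)
  qed
  ultimately show ?thesis by blast
qed

text \<open>The second difference is symmetric in \<open>u\<close> and \<open>v\<close>, so both
  mixed derivatives, multiplied by \<open>s * s\<close>, approximate it up to
  \<open>e * (s * s)\<close>, with \<open>e\<close> arbitrary.\<close>

lemma partial_deriv_commute: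
  assumes \<Omega>: "open \<Omega>" "z \<in> \<Omega>" and f: "Ck_on 2 \<Omega> f"
  shows "partial_deriv u (partial_deriv v f) z = partial_deriv v (partial_deriv u f) z" (is "?a = ?b")
proof -
  have d1: "\<And>x. x \<in> \<Omega> \<Longrightarrow> f differentiable (at x)" and d2: "\<And>v. partial_deriv v f differentiable (at z)"
    using f \<Omega> by (auto simp: numeral_2_eq_2)
  have "norm (?a - ?b) \<le> 2 * e" if e: "e > 0" for e
  proof -
    from second_difference[OF \<Omega> d1 d2 e, of u v] obtain x where x: "x > 0" "\<And>s. 0 < s \<Longrightarrow> s < x \<Longrightarrow>
        norm (f (z + s *\<^sub>R u + s *\<^sub>R v) - f (z + s *\<^sub>R u) - f (z + s *\<^sub>R v) + f z - (s * s) *\<^sub>R ?a) \<le> e * (s * s)"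
      by blast
    from second_difference[OF \<Omega> d1 d2 e, of v u] obtain y where y: "y > 0" "\<And>s. 0 < s \<Longrightarrow> s < y \<Longrightarrow>
        norm (f (z + s *\<^sub>R v + s *\<^sub>R u) - f (z + s *\<^sub>R v) - f (z + s *\<^sub>R u) + f z - (s * s) *\<^sub>R ?b) \<le> e * (s * s)"
      by blast
    define s where "s = min x y / 2"
    have s: "0 < s" "s < x" "s < y" using x(1) y(1) by (auto simp: s_def)
    define D where "D = f (z + s *\<^sub>R u + s *\<^sub>R v) - f (z + s *\<^sub>R u) - f (z + s *\<^sub>R v) + f z"
    have D2: "D = f (z + s *\<^sub>R v + s *\<^sub>R u) - f (z + s *\<^sub>R v) - f (z + s *\<^sub>R u) + f z"
      by (simp add: D_def algebra_simps)
    have 1: "norm (D - (s * s) *\<^sub>R ?a) \<le> e * (s * s)" using x(2)[of s] s unfolding D_def by auto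
    have 2: "norm (D - (s * s) *\<^sub>R ?b) \<le> e * (s * s)" using y(2)[of s] s unfolding D2 by auto
    have eq: "(s * s) *\<^sub>R (?a - ?b) = (D - (s * s) *\<^sub>R ?b) - (D - (s * s) *\<^sub>R ?a)" by (simp add: scaleR_diff_right)
    have "norm ((s * s) *\<^sub>R (?a - ?b)) \<le> e * (s * s) + e * (s * s)"
      unfolding eq using norm_triangle_ineq4[of "D - (s * s) *\<^sub>R ?b" "D - (s * s) *\<^sub>R ?a"] 1 2 by linarith
    then have "(s * s) * norm (?a - ?b) \<le> (s * s) * (2 * e)" unfolding norm_scaleR by (simp add: algebra_simps)
    then show ?thesis using s by (simp add: mult_le_cancel_left_pos)
  qed
  then have "norm (?a - ?b) \<le> e" if "e > 0" for e using that by (metis half_gt_zero field_sum_of_halves mult_2)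
  then have "norm (?a - ?b) \<le> 0" by (meson dense not_less linorder_not_le)
  then show ?thesis by simp
qed

subsection \<open>Norms of iterated derivatives\<close>

definition dir :: "bool \<Rightarrow> plane" where
  "dir c = (if c then (1, 0) else (0, 1))"

lemma dir_simps [simp]: "dir True = (1, 0)" "dir False = (0, 1)" by (simp_all add: dir_def)

text \<open>A word lists the coordinate directions in the order of differentiation, head first.
  Words make the order an induction parameter; \<open>wderiv_eq_mi_deriv\<close> translates them
  into multi-indices.\<close>

primrec wderiv :: "bool list \<Rightarrow> (plane \<Rightarrow> 'b::real_normed_vector) \<Rightarrow> plane \<Rightarrow> 'b" where
  "wderiv [] u = u"
| "wderiv (c # w) u = wderiv w (partial_deriv (dir c) u)"

text \<open>Unfolds to the sum of the norms of the derivatives along all \<open>2 ^ k\<close> words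
  of length \<open>k\<close>. The recursive form turns the Leibniz estimates into inductions on
  \<open>k\<close>.\<close>

primrec Dnorm :: "nat \<Rightarrow> (plane \<Rightarrow> 'b::real_normed_vector) \<Rightarrow> plane \<Rightarrow> real" where
  "Dnorm 0 u z = norm (u z)"
| "Dnorm (Suc k) u z = Dnorm k (deriv_x u) z + Dnorm k (deriv_y u) z"

lemma wderiv_append: "wderiv (w @ w') u = wderiv w' (wderiv w u)"
  by (induction w arbitrary: u) auto

lemma smooth_on_wderiv: "smooth_on \<Omega> u \<Longrightarrow> smooth_on \<Omega> (wderiv w u)"
  by (induction w arbitrary: u) (auto intro: smooth_on_partial_deriv)

lemma wderiv_cong:
  assumes "open \<Omega>" "\<And>x. x \<in> \<Omega> \<Longrightarrow> u x = v x" "z \<in> \<Omega>"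
  shows "wderiv w u z = wderiv w v z"
  using assms(2)
proof (induction w arbitrary: u v)
  case (Cons c w)
  show ?case unfolding wderiv.simps
    using partial_deriv_cong[OF assms(1) _ Cons.prems] by (intro Cons.IH)
qed (use assms in auto)

lemma Dnorm_cong:
  assumes "open \<Omega>" "\<And>x. x \<in> \<Omega> \<Longrightarrow> u x = v x" "z \<in> \<Omega>"
  shows "Dnorm k u z = Dnorm k v z"
  using assms(2)
proof (induction k arbitrary: u v)
  case (Suc k)
  have "Dnorm k (partial_deriv e u) z = Dnorm k (partial_deriv e v) z" for e
    using partial_deriv_cong[OF assms(1) _ Suc.prems] by (intro Suc.IH)
  then show ?case by simp
qed (use assms in auto)

lemma Dnorm_nonneg [simp]: "0 \<le> Dnorm k u z"
  by (induction k arbitrary: u) auto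

lemma Dnorm_partial_le: "Dnorm k (partial_deriv (dir c) u) z \<le> Dnorm (Suc k) u z"
  by (cases c) auto

lemma norm_wderiv_le_Dnorm: "norm (wderiv w u z) \<le> Dnorm (length w) u z"
proof (induction w arbitrary: u)
  case (Cons c w)
  then show ?case using Dnorm_partial_le[of "length w" c u z] order_trans by (fastforce simp del: Dnorm.simps)
qed simp

text \<open>\<open>2 ^ k\<close> counts the words of length \<open>k\<close>.\<close>

lemma Dnorm_le:
  assumes "\<And>w. length w = k \<Longrightarrow> norm (wderiv w u z) \<le> B"
  shows "Dnorm k u z \<le> 2 ^ k * B"
  using assms
proof (induction k arbitrary: u)
  case (Suc k)
  have "Dnorm k (partial_deriv (dir c) u) z \<le> 2 ^ k * B" for c
    using Suc.prems[of "c # _"] by (intro Suc.IH) auto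
  from this[of True] this[of False] show ?case by simp
qed (use assms in fastforce)

lemma continuous_on_Dnorm: "smooth_on \<Omega> u \<Longrightarrow> continuous_on \<Omega> (Dnorm k u)"
proof (induction k arbitrary: u)
  case 0 then show ?case by (auto intro: continuous_on_norm smooth_on_continuous)
next
  case (Suc k)
  then have "continuous_on \<Omega> (\<lambda>z. Dnorm k (deriv_x u) z + Dnorm k (deriv_y u) z)"
    by (intro continuous_on_add Suc.IH smooth_on_partial_deriv)
  then show ?case by simp
qed

lemma wderiv_partial_commute:
  assumes "open \<Omega>" "smooth_on \<Omega> u" "z \<in> \<Omega>"
  shows "wderiv w (partial_deriv v u) z = partial_deriv v (wderiv w u) z"
  using assms(2)
proof (induction w arbitrary: u)
  case (Cons c w)
  have "wderiv (c # w) (partial_deriv v u) z = wderiv w (partial_deriv v (partial_deriv (dir c) u)) z"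
  proof (simp, rule wderiv_cong[OF assms(1) _ assms(3)])
    show "partial_deriv (dir c) (partial_deriv v u) x = partial_deriv v (partial_deriv (dir c) u) x" if "x \<in> \<Omega>" for x
      using Cons.prems that by (intro partial_deriv_commute[OF assms(1)]) (auto simp: smooth_on_def)
  qed
  also have "\<dots> = partial_deriv v (wderiv (c # w) u) z"
    using Cons.IH[OF smooth_on_partial_deriv[OF Cons.prems]] by simp
  finally show ?case .
qed simp

lemma wderiv_add:
  assumes "open \<Omega>" "smooth_on \<Omega> u" "smooth_on \<Omega> v" "z \<in> \<Omega>"
  shows "wderiv w (\<lambda>z. u z + v z) z = wderiv w u z + wderiv w v z"
  using assms(2,3)
proof (induction w arbitrary: u v)
  case (Cons c w)
  have "wderiv (c # w) (\<lambda>z. u z + v z) z = wderiv w (\<lambda>z. partial_deriv (dir c) u z + partial_deriv (dir c) v z) z"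
  proof (simp, rule wderiv_cong[OF assms(1) _ assms(4)])
    show "partial_deriv (dir c) (\<lambda>z. u z + v z) x = partial_deriv (dir c) u x + partial_deriv (dir c) v x" if "x \<in> \<Omega>" for x
      using Cons.prems that by (intro partial_deriv_add smooth_on_differentiable)
  qed
  also have "\<dots> = wderiv (c # w) u z + wderiv (c # w) v z"
    using Cons.IH Cons.prems by (simp add: smooth_on_partial_deriv)
  finally show ?case .
qed simp

lemma wderiv_bounded_linear:
  assumes "bounded_linear L" "open \<Omega>" "smooth_on \<Omega> u" "z \<in> \<Omega>"
  shows "wderiv w (\<lambda>z. L (u z)) z = L (wderiv w u z)"
  using assms(3)
proof (induction w arbitrary: u)
  case (Cons c w)
  have "wderiv (c # w) (\<lambda>z. L (u z)) z = wderiv w (\<lambda>z. L (partial_deriv (dir c) u z)) z"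
  proof (simp, rule wderiv_cong[OF assms(2) _ assms(4)])
    show "partial_deriv (dir c) (\<lambda>z. L (u z)) x = L (partial_deriv (dir c) u x)" if "x \<in> \<Omega>" for x
      using Cons.prems that by (intro partial_deriv_bounded_linear[OF assms(1)] smooth_on_differentiable)
  qed
  also have "\<dots> = L (wderiv (c # w) u z)"
    using Cons by (simp add: smooth_on_partial_deriv)
  finally show ?case .
qed simp

lemma Dnorm_add:
  assumes "open \<Omega>" "smooth_on \<Omega> u" "smooth_on \<Omega> v" "z \<in> \<Omega>"
  shows "Dnorm k (\<lambda>z. u z + v z) z \<le> Dnorm k u z + Dnorm k v z"
  using assms(2,3)
proof (induction k arbitrary: u v)
  case 0 then show ?case by (simp add: norm_triangle_ineq)
next
  case (Suc k)
  have "Dnorm k (partial_deriv e (\<lambda>z. u z + v z)) z \<le> Dnorm k (partial_deriv e u) z + Dnorm k (partial_deriv e v) z" for e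
  proof -
    have "Dnorm k (partial_deriv e (\<lambda>z. u z + v z)) z = Dnorm k (\<lambda>z. partial_deriv e u z + partial_deriv e v z) z"
    proof (rule Dnorm_cong[OF assms(1) _ assms(4)])
      show "partial_deriv e (\<lambda>z. u z + v z) x = partial_deriv e u x + partial_deriv e v x" if "x \<in> \<Omega>" for x
        using Suc.prems that by (intro partial_deriv_add smooth_on_differentiable)
    qed
    then show ?thesis using Suc.IH Suc.prems by (simp add: smooth_on_partial_deriv)
  qed
  from this[of "(1,0)"] this[of "(0,1)"] show ?case by simp
qed

lemma Dnorm_bounded_linear:
  assumes "bounded_linear L" "open \<Omega>" "smooth_on \<Omega> u" "z \<in> \<Omega>" and c: "\<And>x. norm (L x) = c * norm x"
  shows "Dnorm k (\<lambda>z. L (u z)) z = c * Dnorm k u z"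
  using assms(3)
proof (induction k arbitrary: u)
  case 0 then show ?case by (simp add: c)
next
  case (Suc k)
  have "Dnorm k (partial_deriv e (\<lambda>z. L (u z))) z = c * Dnorm k (partial_deriv e u) z" for e
  proof -
    have "Dnorm k (partial_deriv e (\<lambda>z. L (u z))) z = Dnorm k (\<lambda>z. L (partial_deriv e u z)) z"
    proof (rule Dnorm_cong[OF assms(2) _ assms(4)])
      show "partial_deriv e (\<lambda>z. L (u z)) x = L (partial_deriv e u x)" if "x \<in> \<Omega>" for x
        using Suc.prems that by (intro partial_deriv_bounded_linear[OF assms(1)] smooth_on_differentiable)
    qed
    then show ?thesis using Suc.IH Suc.prems by (simp add: smooth_on_partial_deriv)
  qed
  then show ?case by (simp add: distrib_left)
qed

lemma Dnorm_cmult: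
  fixes u :: "plane \<Rightarrow> complex"
  shows "open \<Omega> \<Longrightarrow> smooth_on \<Omega> u \<Longrightarrow> z \<in> \<Omega> \<Longrightarrow> Dnorm k (\<lambda>z. c * u z) z = norm c * Dnorm k u z"
  by (rule Dnorm_bounded_linear[OF bounded_linear_mult_right]) (auto simp: norm_mult)

lemma Dnorm_cnj:
  "open \<Omega> \<Longrightarrow> smooth_on \<Omega> u \<Longrightarrow> z \<in> \<Omega> \<Longrightarrow> Dnorm k (\<lambda>z. cnj (u z)) z = Dnorm k u z"
  using Dnorm_bounded_linear[OF bounded_linear_cnj, of \<Omega> u z 1 k] by simp

lemma Dnorm_minus:
  "open \<Omega> \<Longrightarrow> smooth_on \<Omega> u \<Longrightarrow> z \<in> \<Omega> \<Longrightarrow> Dnorm k (\<lambda>z. - u z) z = Dnorm k u z"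
  using Dnorm_bounded_linear[OF bounded_linear_minus[OF bounded_linear_ident], of \<Omega> u z 1 k] by simp

lemma Dnorm_diff:
  assumes "open \<Omega>" "smooth_on \<Omega> u" "smooth_on \<Omega> v" "z \<in> \<Omega>"
  shows "Dnorm k (\<lambda>z. u z - v z) z \<le> Dnorm k u z + Dnorm k v z"
  using Dnorm_add[OF assms(1,2) smooth_on_minus[OF assms(1,3)] assms(4), of k] Dnorm_minus[OF assms(1,3,4), of k] by simp

lemma Dnorm_const_0 [simp]: "Dnorm k (\<lambda>z. 0) z = 0"
  by (induction k) auto

section \<open>Leibniz estimates\<close>

context
  fixes \<Omega> :: "plane set" and z :: plane
  assumes \<Omega>: "open \<Omega>" and z: "z \<in> \<Omega>"
begin

lemma mult_partial_deriv:
  fixes u v :: "plane \<Rightarrow> complex"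
  assumes "smooth_on \<Omega> u" "smooth_on \<Omega> v" "x \<in> \<Omega>"
  shows "partial_deriv e (\<lambda>z. u z * v z) x = partial_deriv e u x * v x + u x * partial_deriv e v x"
  using assms by (intro partial_deriv_bilinear[OF bounded_bilinear_mult] smooth_on_differentiable)

lemma Dnorm_mult_partial:
  fixes u v :: "plane \<Rightarrow> complex"
  assumes "smooth_on \<Omega> u" "smooth_on \<Omega> v"
  shows "Dnorm k (partial_deriv e (\<lambda>z. u z * v z)) z
    \<le> Dnorm k (\<lambda>z. partial_deriv e u z * v z) z + Dnorm k (\<lambda>z. u z * partial_deriv e v z) z"
proof -
  have "Dnorm k (partial_deriv e (\<lambda>z. u z * v z)) z = Dnorm k (\<lambda>z. partial_deriv e u z * v z + u z * partial_deriv e v z) z"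
    using mult_partial_deriv[OF assms] by (intro Dnorm_cong[OF \<Omega> _ z])
  also have "\<dots> \<le> Dnorm k (\<lambda>z. partial_deriv e u z * v z) z + Dnorm k (\<lambda>z. u z * partial_deriv e v z) z"
    by (intro Dnorm_add[OF \<Omega> _ _ z] smooth_on_mult[OF \<Omega>] smooth_on_partial_deriv assms)
  finally show ?thesis .
qed

text \<open>Every differentiation splits a product in two, so the crude factor \<open>2 ^ k\<close>
  can replace the binomial coefficients.\<close>

lemma Dnorm_mult:
  fixes u v :: "plane \<Rightarrow> complex"
  assumes "smooth_on \<Omega> u" "smooth_on \<Omega> v"
  shows "Dnorm k (\<lambda>z. u z * v z) z \<le> 2 ^ k * (\<Sum>i\<le>k. Dnorm i u z * Dnorm (k - i) v z)"
  using assms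
proof (induction k arbitrary: u v)
  case 0 then show ?case by (simp add: norm_mult)
next
  case (Suc k)
  let ?S = "\<Sum>i\<le>Suc k. Dnorm i u z * Dnorm (Suc k - i) v z"
  let ?x = "(1, 0) :: plane" and ?y = "(0, 1) :: plane"
  have 1: "(\<Sum>i\<le>k. Dnorm i (partial_deriv ?x u) z * Dnorm (k - i) v z)
      + (\<Sum>i\<le>k. Dnorm i (partial_deriv ?y u) z * Dnorm (k - i) v z) \<le> ?S"
  proof -
    have "(\<Sum>i\<le>k. Dnorm i (partial_deriv ?x u) z * Dnorm (k - i) v z)
      + (\<Sum>i\<le>k. Dnorm i (partial_deriv ?y u) z * Dnorm (k - i) v z)
      = (\<Sum>i\<le>k. Dnorm (Suc i) u z * Dnorm (Suc k - Suc i) v z)"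
      by (simp add: sum.distrib[symmetric] distrib_right)
    also have "\<dots> \<le> ?S"
      unfolding sum.atMost_Suc_shift[of _ k] by simp
    finally show ?thesis .
  qed
  have 2: "(\<Sum>i\<le>k. Dnorm i u z * Dnorm (k - i) (partial_deriv ?x v) z)
      + (\<Sum>i\<le>k. Dnorm i u z * Dnorm (k - i) (partial_deriv ?y v) z) \<le> ?S"
  proof -
    have "(\<Sum>i\<le>k. Dnorm i u z * Dnorm (k - i) (partial_deriv ?x v) z)
      + (\<Sum>i\<le>k. Dnorm i u z * Dnorm (k - i) (partial_deriv ?y v) z)
      = (\<Sum>i\<le>k. Dnorm i u z * Dnorm (Suc k - i) v z)"
      unfolding sum.distrib[symmetric] by (intro sum.cong) (auto simp: Suc_diff_le distrib_left)
    also have "\<dots> \<le> ?S" by simp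
    finally show ?thesis .
  qed
  have "Dnorm (Suc k) (\<lambda>z. u z * v z) z \<le>
     (2 ^ k * (\<Sum>i\<le>k. Dnorm i (partial_deriv ?x u) z * Dnorm (k - i) v z) + 2 ^ k * (\<Sum>i\<le>k. Dnorm i u z * Dnorm (k - i) (partial_deriv ?x v) z))
     + (2 ^ k * (\<Sum>i\<le>k. Dnorm i (partial_deriv ?y u) z * Dnorm (k - i) v z) + 2 ^ k * (\<Sum>i\<le>k. Dnorm i u z * Dnorm (k - i) (partial_deriv ?y v) z))"
    unfolding Dnorm.simps
    by (intro add_mono order_trans[OF Dnorm_mult_partial] Suc.IH smooth_on_partial_deriv Suc.prems)
  also have "\<dots> = 2 ^ k * ((\<Sum>i\<le>k. Dnorm i (partial_deriv ?x u) z * Dnorm (k - i) v z)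
      + (\<Sum>i\<le>k. Dnorm i (partial_deriv ?y u) z * Dnorm (k - i) v z)) + 2 ^ k *
      ((\<Sum>i\<le>k. Dnorm i u z * Dnorm (k - i) (partial_deriv ?x v) z)
      + (\<Sum>i\<le>k. Dnorm i u z * Dnorm (k - i) (partial_deriv ?y v) z))"
    by (simp add: algebra_simps)
  also have "\<dots> \<le> 2 ^ k * ?S + 2 ^ k * ?S"
    by (intro add_mono mult_left_mono 1 2) auto
  also have "\<dots> = 2 ^ Suc k * ?S" by simp
  finally show ?case .
qed

text \<open>The Leibniz rule with the top-order term in \<open>u\<close> separated; all remaining
  terms carry fewer derivatives of \<open>u\<close>.\<close>

lemma wderiv_mult_remainder:
  fixes u v :: "plane \<Rightarrow> complex"
  assumes "smooth_on \<Omega> u" "smooth_on \<Omega> v"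
  shows "norm (wderiv w (\<lambda>z. u z * v z) z - wderiv w u z * v z)
    \<le> 2 ^ length w * (\<Sum>i<length w. Dnorm i u z * Dnorm (length w - i) v z)"
  using assms
proof (induction w arbitrary: u v)
  case (Cons c w)
  let ?k = "length w" and ?p = "partial_deriv (dir c)"
  let ?S = "\<Sum>i<Suc ?k. Dnorm i u z * Dnorm (Suc ?k - i) v z"
  note sm = Cons.prems smooth_on_partial_deriv[OF Cons.prems(1), of "dir c"] smooth_on_partial_deriv[OF Cons.prems(2), of "dir c"]
  have eq: "wderiv (c # w) (\<lambda>z. u z * v z) z = wderiv w (\<lambda>z. ?p u z * v z) z + wderiv w (\<lambda>z. u z * ?p v z) z"
  proof -
    have "wderiv (c # w) (\<lambda>z. u z * v z) z = wderiv w (\<lambda>z. ?p u z * v z + u z * ?p v z) z"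
      unfolding wderiv.simps using mult_partial_deriv[OF Cons.prems] by (intro wderiv_cong[OF \<Omega> _ z])
    also have "\<dots> = wderiv w (\<lambda>z. ?p u z * v z) z + wderiv w (\<lambda>z. u z * ?p v z) z"
      by (intro wderiv_add[OF \<Omega> _ _ z] smooth_on_mult[OF \<Omega>] sm)
    finally show ?thesis .
  qed
  have 1: "norm (wderiv w (\<lambda>z. ?p u z * v z) z - wderiv w (?p u) z * v z) \<le> 2 ^ ?k * ?S"
  proof -
    have "norm (wderiv w (\<lambda>z. ?p u z * v z) z - wderiv w (?p u) z * v z)
      \<le> 2 ^ ?k * (\<Sum>i<?k. Dnorm i (?p u) z * Dnorm (?k - i) v z)"
      by (rule Cons.IH) (use sm in auto)
    also have "\<dots> \<le> 2 ^ ?k * (\<Sum>i<?k. Dnorm (Suc i) u z * Dnorm (Suc ?k - Suc i) v z)"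
      by (intro mult_left_mono sum_mono mult_mono Dnorm_partial_le) auto
    also have "\<dots> \<le> 2 ^ ?k * ?S"
      unfolding sum.lessThan_Suc_shift[of _ ?k] by (intro mult_left_mono) auto
    finally show ?thesis .
  qed
  have 2: "norm (wderiv w (\<lambda>z. u z * ?p v z) z) \<le> 2 ^ ?k * ?S"
  proof -
    have "norm (wderiv w (\<lambda>z. u z * ?p v z) z) \<le> Dnorm ?k (\<lambda>z. u z * ?p v z) z"
      by (rule norm_wderiv_le_Dnorm)
    also have "\<dots> \<le> 2 ^ ?k * (\<Sum>i\<le>?k. Dnorm i u z * Dnorm (?k - i) (?p v) z)"
      by (rule Dnorm_mult) (use sm in auto)
    also have "\<dots> \<le> 2 ^ ?k * (\<Sum>i\<le>?k. Dnorm i u z * Dnorm (Suc (?k - i)) v z)"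
      by (intro mult_left_mono sum_mono mult_mono Dnorm_partial_le) auto
    also have "\<dots> = 2 ^ ?k * ?S" by (simp add: lessThan_Suc_atMost Suc_diff_le del: Dnorm.simps)
    finally show ?thesis .
  qed
  have "norm (wderiv (c # w) (\<lambda>z. u z * v z) z - wderiv (c # w) u z * v z)
    = norm ((wderiv w (\<lambda>z. ?p u z * v z) z - wderiv w (?p u) z * v z) + wderiv w (\<lambda>z. u z * ?p v z) z)"
    unfolding eq by (simp add: algebra_simps)
  also have "\<dots> \<le> 2 ^ ?k * ?S + 2 ^ ?k * ?S"
    using 1 2 by (intro order_trans[OF norm_triangle_ineq] add_mono)
  finally show ?case by simp
qed simp

text \<open>Solves the Leibniz rule for the top derivatives of \<open>u\<close>, in terms of those
  of the product and of lower ones of \<open>u\<close>. In this form the derivatives of a quotient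
  are estimated from numerator and denominator by induction on the order.\<close>

lemma Dnorm_factor:
  fixes u v :: "plane \<Rightarrow> complex"
  assumes "smooth_on \<Omega> u" "smooth_on \<Omega> v"
  shows "Dnorm k u z * norm (v z)
    \<le> 2 ^ k * (Dnorm k (\<lambda>z. u z * v z) z + 2 ^ k * (\<Sum>i<k. Dnorm i u z * Dnorm (k - i) v z))"
proof (cases "v z = 0")
  case True
  have "0 \<le> 2 ^ k * (Dnorm k (\<lambda>z. u z * v z) z + 2 ^ k * (\<Sum>i<k. Dnorm i u z * Dnorm (k - i) v z))"
    by (intro mult_nonneg_nonneg add_nonneg_nonneg sum_nonneg) auto
  then show ?thesis using True by simp
next
  case False
  let ?B = "Dnorm k (\<lambda>z. u z * v z) z + 2 ^ k * (\<Sum>i<k. Dnorm i u z * Dnorm (k - i) v z)"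
  have "norm (wderiv w u z) \<le> ?B / norm (v z)" if w: "length w = k" for w
  proof -
    have "norm (wderiv w u z) * norm (v z) = norm (wderiv w (\<lambda>z. u z * v z) z - (wderiv w (\<lambda>z. u z * v z) z - wderiv w u z * v z))"
      by (simp add: norm_mult)
    also have "\<dots> \<le> ?B"
      using wderiv_mult_remainder[OF assms, of w, unfolded w] norm_wderiv_le_Dnorm[of w "\<lambda>z. u z * v z" z, unfolded w]
        norm_triangle_ineq4[of "wderiv w (\<lambda>z. u z * v z) z" "wderiv w (\<lambda>z. u z * v z) z - wderiv w u z * v z"]
      by linarith
    finally show ?thesis using False by (simp add: field_simps)
  qed
  from Dnorm_le[OF this] show ?thesis using False by (simp add: field_simps)
qed

end

section \<open>Words and multi-indices\<close>

lemma wderiv_replicate: "wderiv (replicate n c) u = ((partial_deriv (dir c)) ^^ n) u"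
  by (induction n arbitrary: u) (auto simp: funpow_swap1)

lemma mi_deriv_eq_wderiv: "mi_deriv (a, b) u = wderiv (replicate b False @ replicate a True) u"
  by (simp add: mi_deriv_def wderiv_append wderiv_replicate)

lemma norm_mi_deriv_le: "norm (mi_deriv \<alpha> u z) \<le> Dnorm (mi_order \<alpha>) u z"
  using norm_wderiv_le_Dnorm[of "replicate (snd \<alpha>) False @ replicate (fst \<alpha>) True" u z]
  by (cases \<alpha>) (simp add: mi_deriv_eq_wderiv mi_order_def add.commute)

lemma smooth_on_mi_deriv: "smooth_on \<Omega> u \<Longrightarrow> smooth_on \<Omega> (mi_deriv \<alpha> u)"
  by (cases \<alpha>) (simp add: mi_deriv_eq_wderiv smooth_on_wderiv)

lemma wderiv_move:
  assumes "open \<Omega>" "smooth_on \<Omega> u" "z \<in> \<Omega>"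
  shows "wderiv (c # w @ w') u z = wderiv (w @ c # w') u z"
proof -
  have "wderiv (c # w @ w') u z = wderiv w' (wderiv w (partial_deriv (dir c) u)) z"
    by (simp add: wderiv_append)
  also have "\<dots> = wderiv w' (partial_deriv (dir c) (wderiv w u)) z"
    by (rule wderiv_cong[OF assms(1) _ assms(3)]) (rule wderiv_partial_commute[OF assms(1,2)])
  finally show ?thesis by (simp add: wderiv_append)
qed

text \<open>Symmetry of second derivatives sorts the letters of a word, so that only their numbers
  matter.\<close>

lemma wderiv_eq_mi_deriv:
  assumes "open \<Omega>" "smooth_on \<Omega> u" "z \<in> \<Omega>"
  shows "wderiv w u z = mi_deriv (count_list w True, count_list w False) u z"
  using assms(2)
proof (induction w arbitrary: u)
  case (Cons c w)
  have "wderiv (c # w) u z = wderiv (c # replicate (count_list w False) False @ replicate (count_list w True) True) u z"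
    using Cons.IH[OF smooth_on_partial_deriv[OF Cons.prems]] by (simp add: mi_deriv_eq_wderiv)
  also have "\<dots> = mi_deriv (count_list (c # w) True, count_list (c # w) False) u z"
  proof (cases c)
    case True
    then show ?thesis
      using wderiv_move[OF assms(1) Cons.prems assms(3), of True "replicate (count_list w False) False" "replicate (count_list w True) True"]
      by (simp add: mi_deriv_eq_wderiv del: wderiv.simps)
  next
    case False then show ?thesis by (simp add: mi_deriv_eq_wderiv)
  qed
  finally show ?case .
qed (simp add: mi_deriv_def)

subsection \<open>The mean value inequality for dbar\<close>

abbreviation unit_square :: "plane set" where
  "unit_square \<equiv> cbox (-1, -1) (1, 1)"

text \<open>Fubini reduces the integral to horizontal segments, on which the fundamental theorem
  leaves the difference of two vanishing boundary values.\<close>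

lemma integral_deriv_x_zero:
  fixes g :: "plane \<Rightarrow> 'b::euclidean_space"
  assumes ab: "a \<le> b" and d: "\<And>z. z \<in> cbox (a, c) (b, e) \<Longrightarrow> g differentiable (at z)"
    and cont: "continuous_on (cbox (a, c) (b, e)) (deriv_x g)"
    and zero: "\<And>y. y \<in> {c..e} \<Longrightarrow> g (a, y) = 0" "\<And>y. y \<in> {c..e} \<Longrightarrow> g (b, y) = 0"
  shows "integral (cbox (a, c) (b, e)) (deriv_x g) = 0"
proof -
  have "integral (cbox (a, c) (b, e)) (deriv_x g) = integral (cbox a b) (\<lambda>x. integral (cbox c e) (\<lambda>y. deriv_x g (x, y)))"
    by (rule integral_prod_continuous[OF cont])
  also have "\<dots> = integral (cbox c e) (\<lambda>y. integral (cbox a b) (\<lambda>x. deriv_x g (x, y)))"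
    by (rule integral_swap_continuous) (use cont in simp)
  also have "\<dots> = integral (cbox c e) (\<lambda>y. 0)"
  proof (rule integral_cong)
    fix y assume y: "y \<in> cbox c e"
    have "((\<lambda>x. deriv_x g (x, y)) has_integral (g (b, y) - g (a, y))) {a..b}"
    proof (rule fundamental_theorem_of_calculus[OF ab])
      fix x assume "x \<in> {a..b}"
      then have "g differentiable (at ((0, y) + x *\<^sub>R (1, 0)))" using y by (intro d) auto
      from partial_deriv_line[OF this]
      show "((\<lambda>x. g (x, y)) has_vector_derivative deriv_x g (x, y)) (at x within {a..b})"
        by (simp add: has_vector_derivative_at_within)
    qed
    then show "integral (cbox a b) (\<lambda>x. deriv_x g (x, y)) = 0"
      using zero y by (simp add: integral_unique)
  qed
  finally show ?thesis by simp
qed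

lemma integral_deriv_y_zero:
  fixes g :: "plane \<Rightarrow> 'b::euclidean_space"
  assumes ce: "c \<le> e" and d: "\<And>z. z \<in> cbox (a, c) (b, e) \<Longrightarrow> g differentiable (at z)"
    and cont: "continuous_on (cbox (a, c) (b, e)) (deriv_y g)"
    and zero: "\<And>x. x \<in> {a..b} \<Longrightarrow> g (x, c) = 0" "\<And>x. x \<in> {a..b} \<Longrightarrow> g (x, e) = 0"
  shows "integral (cbox (a, c) (b, e)) (deriv_y g) = 0"
proof -
  have "integral (cbox (a, c) (b, e)) (deriv_y g) = integral (cbox a b) (\<lambda>x. integral (cbox c e) (\<lambda>y. deriv_y g (x, y)))"
    by (rule integral_prod_continuous[OF cont])
  also have "\<dots> = integral (cbox a b) (\<lambda>x. 0)"
  proof (rule integral_cong)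
    fix x assume x: "x \<in> cbox a b"
    have "((\<lambda>y. deriv_y g (x, y)) has_integral (g (x, e) - g (x, c))) {c..e}"
    proof (rule fundamental_theorem_of_calculus[OF ce])
      fix y assume "y \<in> {c..e}"
      then have "g differentiable (at ((x, 0) + y *\<^sub>R (0, 1)))" using x by (intro d) auto
      from partial_deriv_line[OF this]
      show "((\<lambda>y. g (x, y)) has_vector_derivative deriv_y g (x, y)) (at y within {c..e})"
        by (simp add: has_vector_derivative_at_within)
    qed
    then show "integral (cbox c e) (\<lambda>y. deriv_y g (x, y)) = 0"
      using zero x by (simp add: integral_unique)
  qed
  finally show ?thesis by simp
qed

text \<open>The averaging kernel vanishes near the origin, so that averages do not see the values near the centre;
  this is what the treatment of flat zeros needs.\<close>

definition bump :: "real \<Rightarrow> real" where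
  "bump s = (max 0 ((s - 1/4) * (1 - s)))\<^sup>2"

definition bump' :: "real \<Rightarrow> real" where
  "bump' s = 2 * max 0 ((s - 1/4) * (1 - s)) * (5/4 - 2 * s)"

text \<open>Radial, which is what cancels the angular derivative in
  \<open>averaging_angular_zero\<close>, and of class C^1 because of the square in
  \<open>bump\<close>, as integration by parts requires.\<close>

definition kern :: "plane \<Rightarrow> real" where
  "kern w = bump (w \<bullet> w)"

lemma has_real_derivative_max_0_sq:
  "((\<lambda>x::real. (max 0 x)\<^sup>2) has_real_derivative 2 * max 0 x) (at x)"
proof -
  consider "x > 0" | "x < 0" | "x = 0" by linarith
  then show ?thesis
  proof cases
    case 1
    have "((\<lambda>x::real. x\<^sup>2) has_real_derivative 2 * x) (at x)" by (auto intro!: derivative_eq_intros)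
    then have "((\<lambda>x::real. (max 0 x)\<^sup>2) has_real_derivative 2 * x) (at x)"
      by (rule has_field_derivative_transform_within_open[where S = "{0<..}"]) (use 1 in auto)
    then show ?thesis using 1 by simp
  next
    case 2
    have "((\<lambda>x::real. 0) has_real_derivative 0) (at x)" by simp
    then have "((\<lambda>x::real. (max 0 x)\<^sup>2) has_real_derivative 0) (at x)"
      by (rule has_field_derivative_transform_within_open[where S = "{..<0}"]) (use 2 in auto)
    then show ?thesis using 2 by simp
  next
    case 3
    have "((\<lambda>h. (max 0 h)\<^sup>2 / h) \<longlongrightarrow> 0) (at (0::real))"
    proof (rule Lim_null_comparison)
      show "\<forall>\<^sub>F h in at (0::real). norm ((max 0 h)\<^sup>2 / h) \<le> \<bar>h\<bar>"
        by (rule always_eventually) (auto simp: max_def power2_eq_square)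
      show "((\<lambda>h::real. \<bar>h\<bar>) \<longlongrightarrow> 0) (at 0)" by (rule tendsto_eq_intros refl)+ simp
    qed
    then show ?thesis using 3 by (simp add: DERIV_def)
  qed
qed

lemma has_real_derivative_bump: "(bump has_real_derivative bump' s) (at s)"
proof -
  have "((\<lambda>s::real. (s - 1/4) * (1 - s)) has_real_derivative (5/4 - 2 * s)) (at s)"
    by (auto intro!: derivative_eq_intros simp: field_simps)
  from DERIV_chain2[OF has_real_derivative_max_0_sq this]
  show ?thesis unfolding bump_def[abs_def] bump'_def by simp
qed

lemma has_derivative_kern: "(kern has_derivative (\<lambda>h. bump' (w \<bullet> w) * (2 * (w \<bullet> h)))) (at w)"
proof -
  have "((\<lambda>w::plane. w \<bullet> w) has_derivative (\<lambda>h. w \<bullet> h + h \<bullet> w)) (at w)"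
    by (intro has_derivative_inner has_derivative_ident)
  moreover have "(\<lambda>h. w \<bullet> h + h \<bullet> w) = (\<lambda>h. 2 * (w \<bullet> h))"
    by (rule ext) (metis inner_commute mult_2)
  ultimately have "((\<lambda>w::plane. w \<bullet> w) has_derivative (\<lambda>h. 2 * (w \<bullet> h))) (at w)"
    by metis
  from has_derivative_compose[OF this has_field_derivative_imp_has_derivative[OF has_real_derivative_bump]]
  show ?thesis unfolding kern_def[abs_def] .
qed

lemma partial_deriv_kern: "partial_deriv v kern w = bump' (w \<bullet> w) * (2 * (w \<bullet> v))"
  by (rule partial_deriv_at[OF has_derivative_kern])

lemma kern_differentiable: "kern differentiable (at w)"
  using has_derivative_kern differentiable_def by blast

lemma continuous_on_kern [continuous_intros]: "continuous_on S kern"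
  unfolding kern_def[abs_def] bump_def by (intro continuous_intros)

lemma continuous_on_partial_deriv_kern [continuous_intros]: "continuous_on S (partial_deriv v kern)"
  unfolding partial_deriv_kern[abs_def] bump'_def by (intro continuous_intros)

lemma bump_arg_le: "(s - 1/4) * (1 - s) \<le> (1::real)"
proof -
  have "(s - 1/4) * (1 - s) = 9/64 - (s - 5/8)\<^sup>2" by (simp add: power2_eq_square field_simps)
  also have "\<dots> \<le> 1" using zero_le_power2[of "s - 5/8"] by linarith
  finally show ?thesis .
qed

lemma bump_bounds: "0 \<le> bump s" "bump s \<le> 1"
  using bump_arg_le[of s] by (simp_all add: bump_def power_le_one)

lemma kern_bounds [simp]: "0 \<le> kern w" "kern w \<le> 1"
  by (simp_all add: kern_def bump_bounds)

lemma bump_zero: "s \<ge> 1 \<or> s \<le> 1/4 \<Longrightarrow> bump s = 0" "s \<ge> 1 \<or> s \<le> 1/4 \<Longrightarrow> bump' s = 0"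
proof -
  have "(s - 1/4) * (1 - s) \<le> 0" if "s \<ge> 1 \<or> s \<le> 1/4"
    using that mult_nonneg_nonpos[of "s - 1/4" "1 - s"] mult_nonpos_nonneg[of "s - 1/4" "1 - s"] by auto
  then show "s \<ge> 1 \<or> s \<le> 1/4 \<Longrightarrow> bump s = 0" "s \<ge> 1 \<or> s \<le> 1/4 \<Longrightarrow> bump' s = 0"
    by (simp_all add: bump_def bump'_def)
qed

lemma kern_eq_0: "norm w \<ge> 1 \<or> norm w \<le> 1/2 \<Longrightarrow> kern w = 0"
  and partial_deriv_kern_eq_0: "norm w \<ge> 1 \<or> norm w \<le> 1/2 \<Longrightarrow> partial_deriv v kern w = 0"
proof -
  have "w \<bullet> w \<ge> 1 \<or> w \<bullet> w \<le> 1/4" if "norm w \<ge> 1 \<or> norm w \<le> 1/2"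
    using that power_mono[of 1 "norm w" 2] power_mono[of "norm w" "1/2" 2]
    by (auto simp: dot_square_norm power2_eq_square)
  then show "norm w \<ge> 1 \<or> norm w \<le> 1/2 \<Longrightarrow> kern w = 0" "norm w \<ge> 1 \<or> norm w \<le> 1/2 \<Longrightarrow> partial_deriv v kern w = 0"
    by (simp_all add: kern_def bump_zero partial_deriv_kern)
qed

text \<open>12 is the bound 6 for \<open>bump'\<close> on the unit ball times the factor 2 from the
  derivative of \<open>w \<bullet> w\<close>.\<close>

lemma norm_partial_deriv_kern_le:
  assumes "norm v \<le> 1" shows "\<bar>partial_deriv v kern w\<bar> \<le> 12"
proof (cases "norm w \<ge> 1")
  case True then show ?thesis by (simp add: partial_deriv_kern_eq_0)
next
  case False
  let ?s = "w \<bullet> w"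
  have s: "0 \<le> ?s" "?s \<le> 1" using False by (auto simp: dot_square_norm power_le_one)
  have "max 0 ((?s - 1/4) * (1 - ?s)) \<le> 1" using bump_arg_le[of ?s] by simp
  moreover have "\<bar>5/4 - 2 * ?s\<bar> \<le> 3" using s by linarith
  ultimately have "\<bar>bump' ?s\<bar> \<le> 2 * 1 * 3"
    unfolding bump'_def abs_mult by (intro mult_mono) auto
  moreover have "\<bar>w \<bullet> v\<bar> \<le> 1 * 1"
    using Cauchy_Schwarz_ineq2[of w v] False assms by (intro order_trans[OF Cauchy_Schwarz_ineq2] mult_mono) auto
  ultimately have "\<bar>bump' ?s\<bar> * (2 * \<bar>w \<bullet> v\<bar>) \<le> (2 * 1 * 3) * (2 * 1)"
    by (intro mult_mono) auto
  then show ?thesis by (simp add: partial_deriv_kern abs_mult)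
qed

definition kern_mass :: real where
  "kern_mass = integral unit_square kern"

text \<open>A continuous nonnegative kernel with integral 0 would vanish at \<open>(3/4, 0)\<close>,
  a point inside the annulus.\<close>

lemma kern_mass_pos: "kern_mass > 0"
proof (rule ccontr)
  assume "\<not> kern_mass > 0"
  moreover have "kern_mass \<ge> 0" unfolding kern_mass_def by (intro integral_nonneg integrable_continuous continuous_intros) auto
  ultimately have "kern_mass = 0" by simp
  then have "(kern has_integral 0) unit_square"
    unfolding kern_mass_def using integrable_integral[OF integrable_continuous[OF continuous_on_kern]] by metis
  then have "kern (3/4, 0) = 0"
    using has_integral_0_cbox_imp_0[of "(-1, -1)" "(1, 1)" kern "(3/4, 0)", OF continuous_on_kern] kern_bounds
    by (auto simp: box_eq_empty Basis_prod_def)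
  moreover have "kern (3/4, 0) > 0" by (simp add: kern_def bump_def)
  ultimately show False by simp
qed

lemma norm_integral_unit_square_le:
  fixes f :: "plane \<Rightarrow> 'b::euclidean_space"
  assumes "continuous_on unit_square f" "\<And>w. w \<in> unit_square \<Longrightarrow> norm (f w) \<le> B"
  shows "norm (integral unit_square f) \<le> 4 * B"
proof -
  have "norm (integral unit_square f) \<le> integral unit_square (\<lambda>w. B)"
    by (intro integral_norm_bound_integral integrable_continuous assms) auto
  also have "\<dots> = 4 * B"
  proof -
    have "measure lborel unit_square = 4"
      by (subst measure_lborel_cbox_eq) (simp add: Basis_prod_def prod.union_disjoint)
    then show ?thesis by simp
  qed
  finally show ?thesis .
qed

text \<open>Twice the usual Cauchy-Riemann operator. In this normalisation it is, up to sign and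
  conjugation, what the Dirac operator does to each component.\<close>

definition dbar :: "(plane \<Rightarrow> complex) \<Rightarrow> plane \<Rightarrow> complex" where
  "dbar u z = deriv_x u z + \<i> * deriv_y u z"

lemma unit_square_norm: "w \<in> unit_square \<Longrightarrow> norm w < 2"
proof -
  assume w: "w \<in> unit_square"
  obtain a b where ab: "w = (a, b)" by force
  have "a\<^sup>2 \<le> 1" "b\<^sup>2 \<le> 1" using w ab by (auto simp: abs_square_le_1 abs_le_iff)
  then have "sqrt (a\<^sup>2 + b\<^sup>2) < sqrt (2\<^sup>2)" by (intro real_sqrt_less_mono) simp
  then show ?thesis by (simp add: ab norm_Pair)
qed

section \<open>Averages with the radial kernel\<close>

context
  fixes f :: "plane \<Rightarrow> complex" and z0 :: plane and r :: real
  assumes C1: "Ck_on 1 (ball z0 (2 * r)) f" and r: "0 < r"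
begin

text \<open>The corners of \<open>unit_square\<close> have norm sqrt 2, hence the ball of radius
  \<open>2 * r\<close>. Integrals run over the square for the sake of Fubini; the kernel confines
  them to the unit ball.\<close>

lemma averaging_point: "0 \<le> t \<Longrightarrow> t \<le> r \<Longrightarrow> w \<in> unit_square \<Longrightarrow> z0 + t *\<^sub>R w \<in> ball z0 (2 * r)"
proof -
  assume t: "0 \<le> t" "t \<le> r" and w: "w \<in> unit_square"
  have "t * norm w \<le> r * norm w" using t by (intro mult_right_mono) auto
  also have "\<dots> < r * 2" using unit_square_norm[OF w] r by simp
  finally show ?thesis using t by (simp add: dist_norm)
qed

lemma averaging_diff: "0 \<le> t \<Longrightarrow> t \<le> r \<Longrightarrow> w \<in> unit_square \<Longrightarrow> f differentiable (at (z0 + t *\<^sub>R w))"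
  using C1 averaging_point by simp

lemma averaging_cont_partial: "continuous_on (ball z0 (2 * r)) (partial_deriv v f)"
  using C1 by simp

lemma averaging_cont: "continuous_on (ball z0 (2 * r)) f"
  using Ck_on_mono[OF C1, of 0] by simp

lemma averaging_rescaled:
  assumes t: "0 \<le> t" "t \<le> r" and w: "w \<in> unit_square"
  shows "((\<lambda>w. f (z0 + t *\<^sub>R w)) has_derivative (\<lambda>h. t *\<^sub>R partial_deriv h f (z0 + t *\<^sub>R w))) (at w)"
proof -
  note d = has_derivative_partial_deriv[OF averaging_diff[OF assms]]
  have "((\<lambda>w. z0 + t *\<^sub>R w) has_derivative (\<lambda>h. t *\<^sub>R h)) (at w)"
    by (auto intro!: derivative_eq_intros)
  from has_derivative_compose[OF this d]
  show ?thesis using linear_scale[OF has_derivative_linear[OF d]] by simp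
qed

lemma averaging_cont_comp:
  assumes t: "0 \<le> t" "t \<le> r" and g: "continuous_on (ball z0 (2 * r)) g"
  shows "continuous_on unit_square (\<lambda>w. g (z0 + t *\<^sub>R w))"
  by (rule continuous_on_compose2[OF g]) (use averaging_point[OF t] in \<open>auto intro!: continuous_intros\<close>)

text \<open>The product \<open>G\<close> of \<open>K\<close> with the rescaled \<open>f\<close>
  vanishes on the boundary of the square, where \<open>norm w \<ge> 1\<close>, so its derivative
  integrates to 0. The factor \<open>t\<close> is the chain rule.\<close>

lemma averaging_by_parts:
  assumes t: "0 \<le> t" "t \<le> r" and K: "\<And>w. K differentiable (at w)"
    and cK: "\<And>h. continuous_on unit_square (partial_deriv h K)" and K0: "\<And>w. norm w \<ge> 1 \<Longrightarrow> K w = 0"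
  shows "integral unit_square (\<lambda>w. (t * K w) *\<^sub>R partial_deriv (dir c) f (z0 + t *\<^sub>R w))
    = - integral unit_square (\<lambda>w. partial_deriv (dir c) K w *\<^sub>R f (z0 + t *\<^sub>R w))"
proof -
  define G where "G w = K w *\<^sub>R f (z0 + t *\<^sub>R w)" for w
  have G': "(G has_derivative (\<lambda>h. K w *\<^sub>R (t *\<^sub>R partial_deriv h f (z0 + t *\<^sub>R w))
      + partial_deriv h K w *\<^sub>R f (z0 + t *\<^sub>R w))) (at w)" if "w \<in> unit_square" for w
    unfolding G_def
    by (rule has_derivative_scaleR[OF has_derivative_partial_deriv[OF K] averaging_rescaled[OF t that]])
  have pG: "partial_deriv h G w = (t * K w) *\<^sub>R partial_deriv h f (z0 + t *\<^sub>R w)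
      + partial_deriv h K w *\<^sub>R f (z0 + t *\<^sub>R w)" if "w \<in> unit_square" for w h
    using partial_deriv_at[OF G'[OF that]] by (simp add: mult.commute)
  have contK: "continuous_on unit_square K"
    using K by (intro continuous_at_imp_continuous_on ballI differentiable_imp_continuous_within)
  have c1: "continuous_on unit_square (\<lambda>w. (t * K w) *\<^sub>R partial_deriv h f (z0 + t *\<^sub>R w))" for h
    by (intro continuous_intros contK averaging_cont_comp[OF t] averaging_cont_partial)
  have c2: "continuous_on unit_square (\<lambda>w. partial_deriv h K w *\<^sub>R f (z0 + t *\<^sub>R w))" for h
    by (intro continuous_intros cK averaging_cont_comp[OF t] averaging_cont)
  have cG: "continuous_on unit_square (partial_deriv h G)" for h
    using continuous_on_add[OF c1 c2] by (rule continuous_on_eq) (simp add: pG)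
  have "G w = 0" if "norm w \<ge> 1" for w using that by (simp add: G_def K0)
  moreover have "norm (1::real, y) \<ge> 1" "norm (-1::real, y) \<ge> 1" "norm (y, 1::real) \<ge> 1" "norm (y, -1::real) \<ge> 1"
    for y :: real by (auto simp: norm_Pair)
  ultimately have z: "G (1, y) = 0" "G (-1, y) = 0" "G (y, 1) = 0" "G (y, -1) = 0" for y by auto
  have "integral unit_square (partial_deriv (dir c) G) = 0"
    using z differentiableI[OF G'] cG
    by (cases c) (auto intro!: integral_deriv_x_zero integral_deriv_y_zero)
  then have "integral unit_square (\<lambda>w. (t * K w) *\<^sub>R partial_deriv (dir c) f (z0 + t *\<^sub>R w)
      + partial_deriv (dir c) K w *\<^sub>R f (z0 + t *\<^sub>R w)) = 0"
    by (subst integral_cong[OF pG[symmetric]]) auto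
  then show ?thesis
    by (simp add: integral_add integrable_continuous c1 c2 add_eq_0_iff)
qed

text \<open>Integration by parts moves the angular derivative to the kernel. As the kernel is
  radial, the x-derivative of \<open>snd w * kern w\<close> and the y-derivative of
  \<open>fst w * kern w\<close> coincide, and the two terms cancel.\<close>

lemma averaging_angular_zero:
  assumes t: "0 < t" "t \<le> r"
  shows "integral unit_square (\<lambda>w. kern w *\<^sub>R (fst w *\<^sub>R deriv_y f (z0 + t *\<^sub>R w) - snd w *\<^sub>R deriv_x f (z0 + t *\<^sub>R w))) = 0"
proof -
  have t0: "0 \<le> t" using t by simp
  have d: "((\<lambda>w. fst w * kern w) has_derivative (\<lambda>h. fst w * partial_deriv h kern w + fst h * kern w)) (at w)"
    "((\<lambda>w. snd w * kern w) has_derivative (\<lambda>h. snd w * partial_deriv h kern w + snd h * kern w)) (at w)" for w :: plane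
    by (auto intro!: derivative_eq_intros has_derivative_partial_deriv kern_differentiable)
  have p: "partial_deriv h (\<lambda>w. fst w * kern w) w = fst w * partial_deriv h kern w + fst h * kern w"
    "partial_deriv h (\<lambda>w. snd w * kern w) w = snd w * partial_deriv h kern w + snd h * kern w" for h w
    using partial_deriv_at[OF d(1)] partial_deriv_at[OF d(2)] by auto
  have "integral unit_square (\<lambda>w. (t * (snd w * kern w)) *\<^sub>R partial_deriv (dir True) f (z0 + t *\<^sub>R w))
    = - integral unit_square (\<lambda>w. partial_deriv (dir True) (\<lambda>w. snd w * kern w) w *\<^sub>R f (z0 + t *\<^sub>R w))"
    by (rule averaging_by_parts[OF t0 t(2)])
      (auto simp: kern_eq_0 p[abs_def] intro!: differentiableI[OF d(2)] continuous_intros)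
  moreover have "integral unit_square (\<lambda>w. (t * (fst w * kern w)) *\<^sub>R partial_deriv (dir False) f (z0 + t *\<^sub>R w))
    = - integral unit_square (\<lambda>w. partial_deriv (dir False) (\<lambda>w. fst w * kern w) w *\<^sub>R f (z0 + t *\<^sub>R w))"
    by (rule averaging_by_parts[OF t0 t(2)])
      (auto simp: kern_eq_0 p[abs_def] intro!: differentiableI[OF d(1)] continuous_intros)
  moreover have "partial_deriv (dir True) (\<lambda>w. snd w * kern w) w = partial_deriv (dir False) (\<lambda>w. fst w * kern w) w" for w
    by (cases w) (simp add: p partial_deriv_kern)
  ultimately have eq: "integral unit_square (\<lambda>w. (t * (snd w * kern w)) *\<^sub>R deriv_x f (z0 + t *\<^sub>R w))
     = integral unit_square (\<lambda>w. (t * (fst w * kern w)) *\<^sub>R deriv_y f (z0 + t *\<^sub>R w))" by simp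
  have i: "(\<lambda>w. (t * (snd w * kern w)) *\<^sub>R deriv_x f (z0 + t *\<^sub>R w)) integrable_on unit_square"
    "(\<lambda>w. (t * (fst w * kern w)) *\<^sub>R deriv_y f (z0 + t *\<^sub>R w)) integrable_on unit_square"
    by (intro integrable_continuous continuous_intros averaging_cont_comp[OF t0 t(2)] averaging_cont_partial)+
  have "t *\<^sub>R integral unit_square (\<lambda>w. kern w *\<^sub>R (fst w *\<^sub>R deriv_y f (z0 + t *\<^sub>R w) - snd w *\<^sub>R deriv_x f (z0 + t *\<^sub>R w)))
    = integral unit_square (\<lambda>w. (t * (fst w * kern w)) *\<^sub>R deriv_y f (z0 + t *\<^sub>R w) - (t * (snd w * kern w)) *\<^sub>R deriv_x f (z0 + t *\<^sub>R w))"
    unfolding integral_cmul[symmetric] by (rule integral_cong) (simp add: scaleR_diff_right mult_ac)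
  also have "\<dots> = 0" using eq integral_diff[OF i(2) i(1)] by simp
  finally show ?thesis using t by simp
qed

text \<open>The average at scale \<open>t\<close> runs from \<open>kern_mass *\<^sub>R f z0\<close>
  at \<open>t = 0\<close> to the average in the statement at \<open>t = r\<close>. Its derivative in
  \<open>t\<close> is the average of the radial derivative. The conjugate of \<open>w\<close> times
  \<open>dbar f\<close> is the radial derivative plus \<open>\<i>\<close> times the angular one, and
  the latter averages to 0, so only \<open>dbar f\<close> remains.\<close>

lemma averaging_bound:
  assumes S: "\<And>z. z \<in> cball z0 r \<Longrightarrow> norm (dbar f z) \<le> S"
  shows "norm (integral unit_square (\<lambda>w. kern w *\<^sub>R f (z0 + r *\<^sub>R w)) - kern_mass *\<^sub>R f z0) \<le> 4 * S * r"
proof -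
  have S0: "0 \<le> S" using S[of z0] r by (auto intro: order_trans[OF norm_ge_zero])
  define g where "g t = integral unit_square (\<lambda>w. kern w *\<^sub>R f (z0 + t *\<^sub>R w))" for t
  define g' where "g' t = integral unit_square (\<lambda>w. kern w *\<^sub>R partial_deriv w f (z0 + t *\<^sub>R w))" for t
  have ctr: "continuous_on ({0..r} \<times> unit_square) (\<lambda>x. h (z0 + fst x *\<^sub>R snd x))"
    if "continuous_on (ball z0 (2 * r)) h" for h :: "plane \<Rightarrow> complex"
    by (rule continuous_on_compose2[OF that]) (use averaging_point in \<open>auto intro!: continuous_intros\<close>)
  have pw: "partial_deriv w f (z0 + t *\<^sub>R w) = fst w *\<^sub>R deriv_x f (z0 + t *\<^sub>R w) + snd w *\<^sub>R deriv_y f (z0 + t *\<^sub>R w)"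
    if "t \<in> {0..r}" "w \<in> unit_square" for t w
    using that by (intro partial_deriv_eq_coords averaging_diff) auto
  have dg: "(g has_vector_derivative g' t) (at t within {0..r})" if t: "t \<in> {0..r}" for t
    unfolding g_def g'_def
  proof (rule leibniz_rule_vector_derivative[OF _ _ _ t])
    show "((\<lambda>t. kern w *\<^sub>R f (z0 + t *\<^sub>R w)) has_vector_derivative kern w *\<^sub>R partial_deriv w f (z0 + t *\<^sub>R w)) (at t within {0..r})"
      if "t \<in> {0..r}" "w \<in> unit_square" for t w
      using that by (intro has_vector_derivative_at_within[OF bounded_linear.has_vector_derivative[OF bounded_linear_scaleR_right]]
          partial_deriv_line averaging_diff) auto
    show "(\<lambda>w. kern w *\<^sub>R f (z0 + t *\<^sub>R w)) integrable_on unit_square" if "t \<in> {0..r}" for t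
      using that by (intro integrable_continuous continuous_intros averaging_cont_comp averaging_cont) auto
    have "continuous_on ({0..r} \<times> unit_square) (\<lambda>x. kern (snd x) *\<^sub>R (fst (snd x) *\<^sub>R deriv_x f (z0 + fst x *\<^sub>R snd x)
        + snd (snd x) *\<^sub>R deriv_y f (z0 + fst x *\<^sub>R snd x)))"
      by (intro continuous_intros ctr averaging_cont_partial continuous_on_compose2[OF continuous_on_kern[of UNIV]]) auto
    then show "continuous_on ({0..r} \<times> unit_square) (\<lambda>(t, w). kern w *\<^sub>R partial_deriv w f (z0 + t *\<^sub>R w))"
    proof (rule continuous_on_eq)
      show "kern (snd x) *\<^sub>R (fst (snd x) *\<^sub>R deriv_x f (z0 + fst x *\<^sub>R snd x) + snd (snd x) *\<^sub>R deriv_y f (z0 + fst x *\<^sub>R snd x))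
        = (case x of (t, w) \<Rightarrow> kern w *\<^sub>R partial_deriv w f (z0 + t *\<^sub>R w))" if "x \<in> {0..r} \<times> unit_square" for x
        using pw[of "fst x" "snd x"] that by (simp add: case_prod_beta mem_Times_iff)
    qed
  qed simp
  have bd: "norm (g' t) \<le> 4 * S" if t: "0 < t" "t < r" for t
  proof -
    have tt: "0 \<le> t" "t \<le> r" "t \<in> {0..r}" using t by auto
    let ?D = "\<lambda>w. kern w *\<^sub>R (Complex (fst w) (- snd w) * dbar f (z0 + t *\<^sub>R w))"
    have cn: "continuous_on unit_square (\<lambda>w. h (z0 + t *\<^sub>R w))" if "continuous_on (ball z0 (2 * r)) h" for h :: "plane \<Rightarrow> complex"
      by (rule averaging_cont_comp[OF tt(1,2) that])
    have cD: "continuous_on unit_square ?D"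
      unfolding dbar_def Complex_eq by (intro continuous_intros cn averaging_cont_partial)
    have "?D w = kern w *\<^sub>R partial_deriv w f (z0 + t *\<^sub>R w)
      + \<i> * (kern w *\<^sub>R (fst w *\<^sub>R deriv_y f (z0 + t *\<^sub>R w) - snd w *\<^sub>R deriv_x f (z0 + t *\<^sub>R w)))" if "w \<in> unit_square" for w
      unfolding pw[OF tt(3) that] dbar_def Complex_eq by (simp add: scaleR_conv_of_real algebra_simps)
    then have "integral unit_square ?D = integral unit_square (\<lambda>w. kern w *\<^sub>R partial_deriv w f (z0 + t *\<^sub>R w)
      + \<i> * (kern w *\<^sub>R (fst w *\<^sub>R deriv_y f (z0 + t *\<^sub>R w) - snd w *\<^sub>R deriv_x f (z0 + t *\<^sub>R w))))"
      by (rule integral_cong)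
    also have "\<dots> = g' t + \<i> * integral unit_square (\<lambda>w. kern w *\<^sub>R (fst w *\<^sub>R deriv_y f (z0 + t *\<^sub>R w) - snd w *\<^sub>R deriv_x f (z0 + t *\<^sub>R w)))"
    proof -
      have "continuous_on unit_square (\<lambda>w. kern w *\<^sub>R (fst w *\<^sub>R deriv_x f (z0 + t *\<^sub>R w) + snd w *\<^sub>R deriv_y f (z0 + t *\<^sub>R w)))"
        by (intro continuous_intros cn averaging_cont_partial)
      then have "continuous_on unit_square (\<lambda>w. kern w *\<^sub>R partial_deriv w f (z0 + t *\<^sub>R w))"
        by (rule continuous_on_eq) (simp add: pw[OF tt(3)])
      moreover have "continuous_on unit_square (\<lambda>w. kern w *\<^sub>R (fst w *\<^sub>R deriv_y f (z0 + t *\<^sub>R w) - snd w *\<^sub>R deriv_x f (z0 + t *\<^sub>R w)))"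
        by (intro continuous_intros cn averaging_cont_partial)
      ultimately show ?thesis
        unfolding g'_def by (subst integral_add) (simp_all only: integral_mult_right integrable_continuous continuous_on_mult_left)
    qed
    finally have "g' t = integral unit_square ?D" using averaging_angular_zero[OF t(1) tt(2)] by simp
    also have "norm \<dots> \<le> 4 * S"
    proof (rule norm_integral_unit_square_le[OF cD])
      fix w assume "w \<in> unit_square"
      show "norm (?D w) \<le> S"
      proof (cases "norm w \<ge> 1")
        case True then show ?thesis using S0 by (simp add: kern_eq_0)
      next
        case False
        have "t * norm w \<le> r * 1" using False tt by (intro mult_mono) auto
        then have "norm (dbar f (z0 + t *\<^sub>R w)) \<le> S" using tt by (intro S) (simp add: dist_norm)
        moreover have "norm (Complex (fst w) (- snd w)) \<le> 1"
          using False by (cases w) (simp add: complex_norm norm_Pair)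
        ultimately have "kern w * (norm (Complex (fst w) (- snd w)) * norm (dbar f (z0 + t *\<^sub>R w))) \<le> 1 * (1 * S)"
          by (intro mult_mono) auto
        then show ?thesis by (simp add: norm_mult)
      qed
    qed
    finally show ?thesis .
  qed
  have "norm (g r - g 0) \<le> (4 * S * r) - (4 * S * 0)"
  proof (rule differentiable_bound_general[OF r])
    show "continuous_on {0..r} g"
      by (rule continuous_on_vector_derivative) (rule dg)
    show "(g has_vector_derivative g' t) (at t)" if "0 < t" "t < r" for t
      using dg[of t] that at_within_Icc_at[of 0 t r] by simp
    show "((\<lambda>t. 4 * S * t) has_vector_derivative 4 * S) (at t)" for t
      by (auto intro!: derivative_eq_intros simp: has_real_derivative_iff_has_vector_derivative[symmetric])
    show "continuous_on {0..r} (\<lambda>t. 4 * S * t)" by (intro continuous_intros)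
    show "norm (g' t) \<le> 4 * S" if "0 < t" "t < r" for t using bd[OF that] .
  qed
  moreover have "g 0 = kern_mass *\<^sub>R f z0"
    using integral_linear[OF integrable_continuous[OF continuous_on_kern] bounded_linear_scaleR_left, of "(-1, -1)" "(1, 1)" "f z0"]
    by (simp add: g_def kern_mass_def o_def)
  ultimately show ?thesis by (simp add: g_def)
qed

end

text \<open>The average of the derivative is integrated by parts and so sees only \<open>u\<close>:
  48 is the area 4 of the square times the bound 12 for the derivative of the kernel, and
  \<open>1 / r\<close> undoes the chain rule. The error of averaging involves only
  \<open>dbar\<close> of the derivative.\<close>

lemma averaging_derivative_bound:
  assumes C2: "Ck_on 1 (ball z0 (2 * r)) (partial_deriv (dir c) u)" and C1: "Ck_on 1 (ball z0 (2 * r)) u" and r: "0 < r"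
    and S: "\<And>z. z \<in> cball z0 r \<Longrightarrow> norm (dbar (partial_deriv (dir c) u) z) \<le> S"
    and B: "\<And>z. z \<in> cball z0 r \<Longrightarrow> norm (u z) \<le> B"
  shows "kern_mass * norm (partial_deriv (dir c) u z0) \<le> 48 * B / r + 4 * S * r"
proof -
  let ?I = "integral unit_square (\<lambda>w. kern w *\<^sub>R partial_deriv (dir c) u (z0 + r *\<^sub>R w))"
  have r0: "0 \<le> r" "r \<le> r" using r by auto
  have B0: "0 \<le> B" using B[of z0] r by (auto intro: order_trans[OF norm_ge_zero])
  have "integral unit_square (\<lambda>w. (r * kern w) *\<^sub>R partial_deriv (dir c) u (z0 + r *\<^sub>R w))
    = - integral unit_square (\<lambda>w. partial_deriv (dir c) kern w *\<^sub>R u (z0 + r *\<^sub>R w))"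
    by (rule averaging_by_parts[OF C1 r r0 kern_differentiable]) (auto intro!: continuous_intros simp: kern_eq_0)
  moreover have "integral unit_square (\<lambda>w. (r * kern w) *\<^sub>R partial_deriv (dir c) u (z0 + r *\<^sub>R w)) = r *\<^sub>R ?I"
    unfolding integral_cmul[symmetric] by simp
  moreover have "norm (integral unit_square (\<lambda>w. partial_deriv (dir c) kern w *\<^sub>R u (z0 + r *\<^sub>R w))) \<le> 4 * (12 * B)"
  proof (rule norm_integral_unit_square_le)
    show "continuous_on unit_square (\<lambda>w. partial_deriv (dir c) kern w *\<^sub>R u (z0 + r *\<^sub>R w))"
      by (intro continuous_intros averaging_cont_comp[OF C1 r r0] averaging_cont[OF C1 r])
    show "norm (partial_deriv (dir c) kern w *\<^sub>R u (z0 + r *\<^sub>R w)) \<le> 12 * B" for w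
    proof (cases "norm w \<ge> 1")
      case True then show ?thesis using B0 by (simp add: partial_deriv_kern_eq_0)
    next
      case False
      have "norm (u (z0 + r *\<^sub>R w)) \<le> B" using False r by (intro B) (simp add: dist_norm mult_left_le)
      moreover have "\<bar>partial_deriv (dir c) kern w\<bar> \<le> 12"
        by (rule norm_partial_deriv_kern_le) (cases c; simp add: norm_Pair)
      ultimately show ?thesis unfolding norm_scaleR by (intro mult_mono) auto
    qed
  qed
  ultimately have "norm (r *\<^sub>R ?I) \<le> 48 * B" by simp
  then have "norm ?I \<le> 48 * B / r" using r by (simp add: field_simps)
  moreover have "norm (?I - kern_mass *\<^sub>R partial_deriv (dir c) u z0) \<le> 4 * S * r"
    by (rule averaging_bound[OF C2 r S])
  moreover have "norm (kern_mass *\<^sub>R partial_deriv (dir c) u z0) \<le> norm ?I + norm (?I - kern_mass *\<^sub>R partial_deriv (dir c) u z0)"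
    using norm_triangle_sub[of "kern_mass *\<^sub>R partial_deriv (dir c) u z0" ?I]
    by (simp only: norm_minus_commute[of "kern_mass *\<^sub>R partial_deriv (dir c) u z0" ?I])
  ultimately show ?thesis using kern_mass_pos by simp
qed

subsection \<open>Regularity at small energy\<close>

lemma nn_integral_affine_plane:
  fixes F :: "plane \<Rightarrow> ennreal"
  assumes F: "F \<in> borel_measurable borel" and r: "r > 0"
  shows "(\<integral>\<^sup>+z. F z \<partial>lborel) = ennreal (r\<^sup>2) * (\<integral>\<^sup>+w. F (z0 + r *\<^sub>R w) \<partial>lborel)"
proof -
  have "(\<integral>\<^sup>+z. F z \<partial>lborel) = (\<integral>\<^sup>+z. F z \<partial>density (distr lborel borel (\<lambda>x. z0 + r *\<^sub>R x)) (\<lambda>_. ennreal (\<bar>r\<bar> ^ DIM(plane))))"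
    using lborel_affine[of r z0] r by simp
  also have "\<dots> = (\<integral>\<^sup>+w. ennreal (r\<^sup>2) * F (z0 + r *\<^sub>R w) \<partial>lborel)"
    using F by (simp add: nn_integral_density nn_integral_distr power2_eq_square)
  also have "\<dots> = ennreal (r\<^sup>2) * (\<integral>\<^sup>+w. F (z0 + r *\<^sub>R w) \<partial>lborel)"
    by (intro nn_integral_cmult measurable_compose[OF _ F]) measurable
  finally show ?thesis .
qed

lemma ennreal_integral_unit_square:
  assumes c: "continuous_on unit_square g" and nn: "\<And>w. w \<in> unit_square \<Longrightarrow> 0 \<le> g w"
  shows "ennreal (integral unit_square g) = (\<integral>\<^sup>+w. ennreal (g w) * indicator unit_square w \<partial>lborel)"
proof -
  have i: "integrable lborel (\<lambda>x. indicator unit_square x *\<^sub>R g x)"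
    by (rule borel_integrable_compact[OF compact_cbox c])
  have "integral unit_square g = (LINT x|lborel. indicator unit_square x *\<^sub>R g x)"
    using set_borel_integral_eq_integral(2)[of unit_square g] i
    by (simp add: set_lebesgue_integral_def set_integrable_def)
  also have "ennreal \<dots> = (\<integral>\<^sup>+w. ennreal (indicator unit_square w *\<^sub>R g w) \<partial>lborel)"
    using nn by (intro nn_integral_eq_integral[OF i, symmetric]) (auto simp: indicator_def)
  also have "\<dots> = (\<integral>\<^sup>+w. ennreal (g w) * indicator unit_square w \<partial>lborel)"
    by (intro nn_integral_cong) (auto simp: indicator_def)
  finally show ?thesis .
qed

text \<open>A change of variables with Jacobian \<open>r\<^sup>2\<close>; the kernel is at most
  1.\<close>

lemma kern_average_power4:
  fixes s :: "plane \<Rightarrow> real"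
  assumes s: "continuous_on unit_disk s" and r: "r > 0" and sub: "ball z0 (2 * r) \<subseteq> unit_disk"
    and E: "(\<integral>\<^sup>+z\<in>unit_disk. ennreal (s z ^ 4) \<partial>lborel) \<le> ennreal E" and E0: "E \<ge> 0"
  shows "integral unit_square (\<lambda>w. kern w * s (z0 + r *\<^sub>R w) ^ 4) \<le> E / r\<^sup>2"
proof -
  let ?F = "\<lambda>z. ennreal (s z ^ 4) * indicator unit_disk z"
  have mem: "z0 + r *\<^sub>R w \<in> unit_disk" if "w \<in> unit_square" for w
  proof -
    have "r * norm w < r * 2" using unit_square_norm[OF that] r by simp
    then show ?thesis using r by (intro subsetD[OF sub]) (simp add: dist_norm)
  qed
  have "(\<lambda>z. indicator unit_disk z *\<^sub>R s z) \<in> borel_measurable borel"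
    by (rule borel_measurable_continuous_on_indicator[OF _ s]) auto
  then have "(\<lambda>z. ennreal ((indicator unit_disk z *\<^sub>R s z) ^ 4)) \<in> borel_measurable borel" by measurable
  moreover have "(\<lambda>z. ennreal ((indicator unit_disk z *\<^sub>R s z) ^ 4)) = ?F"
    by (auto simp: fun_eq_iff indicator_def)
  ultimately have F: "?F \<in> borel_measurable borel" by (simp only:)
  have c: "continuous_on unit_square (\<lambda>w. kern w * s (z0 + r *\<^sub>R w) ^ 4)"
    by (intro continuous_intros continuous_on_compose2[OF s]) (use mem in auto)
  have "ennreal (integral unit_square (\<lambda>w. kern w * s (z0 + r *\<^sub>R w) ^ 4))
    = (\<integral>\<^sup>+w. ennreal (kern w * s (z0 + r *\<^sub>R w) ^ 4) * indicator unit_square w \<partial>lborel)"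
    by (rule ennreal_integral_unit_square[OF c]) auto
  also have "\<dots> \<le> (\<integral>\<^sup>+w. ?F (z0 + r *\<^sub>R w) \<partial>lborel)"
  proof (rule nn_integral_mono)
    fix w
    have "kern w * s (z0 + r *\<^sub>R w) ^ 4 \<le> 1 * s (z0 + r *\<^sub>R w) ^ 4"
      by (intro mult_right_mono) auto
    then show "ennreal (kern w * s (z0 + r *\<^sub>R w) ^ 4) * indicator unit_square w \<le> ?F (z0 + r *\<^sub>R w)"
      using mem[of w] by (cases "w \<in> unit_square") (auto intro!: ennreal_leI)
  qed
  finally have 1: "ennreal (integral unit_square (\<lambda>w. kern w * s (z0 + r *\<^sub>R w) ^ 4)) \<le> (\<integral>\<^sup>+w. ?F (z0 + r *\<^sub>R w) \<partial>lborel)" .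
  have "ennreal (r\<^sup>2) * ennreal (integral unit_square (\<lambda>w. kern w * s (z0 + r *\<^sub>R w) ^ 4))
    \<le> ennreal (r\<^sup>2) * (\<integral>\<^sup>+w. ?F (z0 + r *\<^sub>R w) \<partial>lborel)"
    by (intro mult_left_mono 1) auto
  also have "\<dots> = (\<integral>\<^sup>+z. ?F z \<partial>lborel)" using nn_integral_affine_plane[OF F r] by simp
  also have "\<dots> \<le> ennreal E" using E by simp
  finally have "ennreal (r\<^sup>2 * integral unit_square (\<lambda>w. kern w * s (z0 + r *\<^sub>R w) ^ 4)) \<le> ennreal E"
    by (simp add: ennreal_mult')
  then have "r\<^sup>2 * integral unit_square (\<lambda>w. kern w * s (z0 + r *\<^sub>R w) ^ 4) \<le> E"
    using E0 by (simp add: ennreal_le_iff)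
  then show ?thesis using r by (simp add: field_simps)
qed

text \<open>Young's inequality \<open>s \<le> \<lambda> + s\<^sup>4 / \<lambda>\<^sup>3\<close> is used in place of Hoelder's inequality.\<close>

lemma kern_average_L4:
  fixes s :: "plane \<Rightarrow> real"
  assumes s: "continuous_on unit_disk s" and nn: "\<And>z. 0 \<le> s z" and r: "r > 0" and sub: "ball z0 (2 * r) \<subseteq> unit_disk"
    and E: "(\<integral>\<^sup>+z\<in>unit_disk. ennreal (s z ^ 4) \<partial>lborel) \<le> ennreal E" and E0: "E > 0"
  shows "integral unit_square (\<lambda>w. kern w * s (z0 + r *\<^sub>R w)) \<le> 5 * root 4 (E / r\<^sup>2)"
proof -
  \<comment> \<open>Balances Young's inequality after averaging: the constant term gives
    \<open>4 * l\<close>, where 4 is the area of the square, and the quartic term gives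
    \<open>l\<close>.\<close>
  define l where "l = root 4 (E / r\<^sup>2)"
  have l: "l > 0" "l ^ 4 = E / r\<^sup>2" using E0 r by (simp_all add: l_def)
  have young: "a \<le> l + a ^ 4 / l ^ 3" if "a \<ge> 0" for a
  proof (cases "a \<le> l")
    case True then show ?thesis using that l by (intro add_increasing2) auto
  next
    case False
    then have "a * l ^ 3 \<le> a * a ^ 3" using l by (intro mult_left_mono power_mono) auto
    then have "a \<le> a ^ 4 / l ^ 3" using l by (simp add: field_simps power_numeral_reduce)
    then show ?thesis using l by simp
  qed
  have mem: "z0 + r *\<^sub>R w \<in> unit_disk" if "w \<in> unit_square" for w
  proof -
    have "r * norm w < r * 2" using unit_square_norm[OF that] r by simp
    then show ?thesis using r by (intro subsetD[OF sub]) (simp add: dist_norm)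
  qed
  have cs: "continuous_on unit_square (\<lambda>w. s (z0 + r *\<^sub>R w))"
    by (rule continuous_on_compose2[OF s]) (use mem in \<open>auto intro!: continuous_intros\<close>)
  note i = integrable_continuous
  have "integral unit_square (\<lambda>w. kern w * s (z0 + r *\<^sub>R w))
    \<le> integral unit_square (\<lambda>w. l + (1 / l ^ 3) * (kern w * s (z0 + r *\<^sub>R w) ^ 4))"
  proof (rule integral_le)
    fix w
    have "kern w * s (z0 + r *\<^sub>R w) \<le> kern w * (l + s (z0 + r *\<^sub>R w) ^ 4 / l ^ 3)"
      by (intro mult_left_mono young nn) auto
    also have "\<dots> \<le> 1 * l + kern w * (s (z0 + r *\<^sub>R w) ^ 4 / l ^ 3)"
      unfolding distrib_left using l by (intro add_right_mono mult_right_mono) auto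
    finally show "kern w * s (z0 + r *\<^sub>R w) \<le> l + (1 / l ^ 3) * (kern w * s (z0 + r *\<^sub>R w) ^ 4)" by simp
  qed (intro i continuous_intros cs)+
  also have "\<dots> = integral unit_square (\<lambda>w. l) + (1 / l ^ 3) * integral unit_square (\<lambda>w. kern w * s (z0 + r *\<^sub>R w) ^ 4)"
    by (subst integral_add) (use l in \<open>auto intro!: i continuous_intros cs simp del: integral_const\<close>)
  also have "\<dots> \<le> 4 * l + (1 / l ^ 3) * (E / r\<^sup>2)"
  proof (intro add_mono mult_left_mono kern_average_power4[OF s r sub E])
    have "norm (integral unit_square (\<lambda>w. l)) \<le> 4 * l" using l by (intro norm_integral_unit_square_le) auto
    then show "integral unit_square (\<lambda>w. l) \<le> 4 * l" by simp
  qed (use l E0 in auto)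
  also have "(1 / l ^ 3) * (E / r\<^sup>2) = l"
    unfolding l(2)[symmetric] using l(1) by (simp add: power_numeral_reduce)
  also have "4 * l + l = 5 * l" by simp
  finally show ?thesis by (simp add: l_def)
qed

text \<open>Both the equation and the energy are invariant under \<open>\<psi> \<mapsto> \<surd>t \<psi>(t z)\<close>. At a maximum point of the
  scale-invariant quantity \<open>(\<rho> - |z|) |\<psi>|\<^sup>2\<close> the mean value inequality, applied at the natural scale
  \<open>|\<psi>|\<^sup>-\<^sup>2\<close>, contradicts the smallness of the energy unless that scale is comparable to \<open>\<rho> - |z|\<close>.\<close>

proposition eps_regularity:
  assumes K: "K > 0"
  defines "\<delta> \<equiv> kern_mass / (128 * K)"
  assumes f: "smooth_on unit_disk f" and g: "smooth_on unit_disk g"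
    and fb: "\<And>z. z \<in> unit_disk \<Longrightarrow> norm (dbar f z) \<le> K * (norm (f z) + norm (g z)) ^ 3"
    and gb: "\<And>z. z \<in> unit_disk \<Longrightarrow> norm (dbar g z) \<le> K * (norm (f z) + norm (g z)) ^ 3"
    and E: "(\<integral>\<^sup>+z\<in>unit_disk. ennreal ((norm (f z) + norm (g z)) ^ 4) \<partial>lborel) \<le> ennreal E" and E0: "E > 0"
    and small: "100 / kern_mass\<^sup>2 * sqrt E < \<delta>" and z: "z \<in> unit_disk"
  shows "(1 - norm z) * (norm (f z) + norm (g z))\<^sup>2 \<le> 400 / kern_mass\<^sup>2 * sqrt E"
proof -
  define s where "s z = norm (f z) + norm (g z)" for z
  have s0: "s z \<ge> 0" for z by (simp add: s_def)
  have cont: "continuous_on unit_disk s"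
    unfolding s_def by (intro continuous_intros smooth_on_continuous f g)
  note kp = kern_mass_pos
  have \<delta>: "\<delta> > 0" using K kp by (simp add: \<delta>_def)
  \<comment> \<open>The maximum is taken on a closed disk of radius \<open>\<rho> < 1\<close>,
    because the functions need not be bounded up to the circle; \<open>\<rho>\<close> tends to 1 at
    the end.\<close>
  have main: "(\<rho> - norm z) * (s z)\<^sup>2 \<le> 400 / kern_mass\<^sup>2 * sqrt E" if \<rho>: "0 < \<rho>" "\<rho> < 1" and z: "z \<in> cball 0 \<rho>" for \<rho> z
  proof -
    have sub: "cball 0 \<rho> \<subseteq> unit_disk" using \<rho> by auto
    have "continuous_on (cball 0 \<rho>) (\<lambda>z. (\<rho> - norm z) * (s z)\<^sup>2)"
      by (intro continuous_intros continuous_on_subset[OF cont sub])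
    then obtain z0 where z0: "z0 \<in> cball 0 \<rho>" and max: "\<And>z. z \<in> cball 0 \<rho> \<Longrightarrow> (\<rho> - norm z) * (s z)\<^sup>2 \<le> (\<rho> - norm z0) * (s z0)\<^sup>2"
      using continuous_attains_sup[of "cball 0 \<rho>" "\<lambda>z. (\<rho> - norm z) * (s z)\<^sup>2"] \<rho> by fastforce
    define M where "M = s z0"
    define d where "d = (\<rho> - norm z0) / 2"
    have R: "0 \<le> 400 / kern_mass\<^sup>2 * sqrt E" using E0 by simp
    show ?thesis
    proof (cases "d > 0 \<and> M > 0")
      case False
      then have "(\<rho> - norm z0) * (s z0)\<^sup>2 \<le> 0"
        using s0[of z0] z0 unfolding M_def d_def by (auto simp: mult_le_0_iff)
      then show ?thesis using max[OF z] R by linarith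
    next
      case True
      then have d: "d > 0" and M: "M > 0" by auto
      \<comment> \<open>The second entry is the natural scale, at which the \<open>dbar\<close>
        error can be absorbed; the first keeps the ball of radius \<open>2 * r\<close> where the
        maximum controls \<open>s\<close>.\<close>
      define r where "r = min (d / 2) (\<delta> / M\<^sup>2)"
      have r: "r > 0" "2 * r \<le> d" "r \<le> \<delta> / M\<^sup>2"
        using d M \<delta> min.cobounded1[of "d / 2" "\<delta> / M\<^sup>2"] by (simp_all add: r_def)
      have near: "\<rho> - norm x \<ge> d" if "dist z0 x \<le> d" for x
        using that norm_triangle_ineq2[of x z0] unfolding d_def by (simp add: dist_norm norm_minus_commute)
      \<comment> \<open>The weight is \<open>2 * d\<close> at \<open>z0\<close> and still at least
        \<open>d\<close> here, so maximality gives \<open>(s x)\<^sup>2 \<le> 2 * M\<^sup>2\<close>;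
        the factor is rounded up to 4.\<close>
      have sM: "s x \<le> 2 * M" if "dist z0 x \<le> d" for x
      proof -
        have x: "x \<in> cball 0 \<rho>" using near[OF that] d by simp
        have "d * (s x)\<^sup>2 \<le> (\<rho> - norm x) * (s x)\<^sup>2" using near[OF that] by (intro mult_right_mono) auto
        also have "\<dots> \<le> (\<rho> - norm z0) * M\<^sup>2" using max[OF x] unfolding M_def .
        also have "\<dots> = 2 * d * M\<^sup>2" by (simp add: d_def)
        finally have "(s x)\<^sup>2 \<le> 2 * M\<^sup>2" using d by simp
        also have "2 * M\<^sup>2 \<le> 2\<^sup>2 * M\<^sup>2" by (intro mult_right_mono) auto
        finally have "(s x)\<^sup>2 \<le> (2 * M)\<^sup>2" by (simp only: power_mult_distrib)
        then show ?thesis by (rule power2_le_imp_le) (use M in simp)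
      qed
      have bsub: "ball z0 (2 * r) \<subseteq> unit_disk"
      proof
        fix x assume "x \<in> ball z0 (2 * r)"
        then have "dist z0 x \<le> d" using r by simp
        from near[OF this] show "x \<in> unit_disk" using d \<rho> by simp
      qed
      have db: "norm (dbar u x) \<le> 8 * K * M ^ 3" if u: "u = f \<or> u = g" and "x \<in> cball z0 r" for u x
      proof -
        have dx: "dist z0 x \<le> d" using that r by simp
        have "x \<in> unit_disk" using near[OF dx] d \<rho> by simp
        then have "norm (dbar u x) \<le> K * (s x) ^ 3" using fb[of x] gb[of x] u by (auto simp: s_def)
        also have "\<dots> \<le> K * (2 * M) ^ 3" using sM[OF dx] K s0 by (intro mult_left_mono power_mono) auto
        finally show ?thesis by (simp add: power_mult_distrib)
      qed
      have mem: "z0 + r *\<^sub>R w \<in> unit_disk" if "w \<in> unit_square" for w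
      proof -
        have "r * norm w < r * 2" using unit_square_norm[OF that] r by simp
        then show ?thesis using r by (intro subsetD[OF bsub]) (simp add: dist_norm)
      qed
      have mv: "kern_mass * norm (u z0) \<le> integral unit_square (\<lambda>w. kern w * norm (u (z0 + r *\<^sub>R w))) + 4 * (8 * K * M ^ 3) * r"
        if u: "u = f \<or> u = g" for u
      proof -
        have sm: "smooth_on unit_disk u" using u f g by auto
        then have C1: "Ck_on 1 (ball z0 (2 * r)) u" using bsub Ck_on_subset unfolding smooth_on_def by blast
        let ?I = "integral unit_square (\<lambda>w. kern w *\<^sub>R u (z0 + r *\<^sub>R w))"
        have cu: "continuous_on unit_square (\<lambda>w. u (z0 + r *\<^sub>R w))"
          by (rule continuous_on_compose2[OF smooth_on_continuous[OF sm]]) (use mem in \<open>auto intro!: continuous_intros\<close>)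
        have "norm ?I \<le> integral unit_square (\<lambda>w. kern w * norm (u (z0 + r *\<^sub>R w)))"
          by (rule integral_norm_bound_integral) (auto intro!: integrable_continuous continuous_intros cu)
        moreover have "norm (?I - kern_mass *\<^sub>R u z0) \<le> 4 * (8 * K * M ^ 3) * r"
          by (rule averaging_bound[OF C1 r(1) db[OF u]])
        moreover have "norm (kern_mass *\<^sub>R u z0) \<le> norm ?I + norm (?I - kern_mass *\<^sub>R u z0)"
          using norm_triangle_sub[of "kern_mass *\<^sub>R u z0" ?I] by (simp only: norm_minus_commute)
        ultimately show ?thesis using kp by simp
      qed
      have "kern_mass * M = kern_mass * norm (f z0) + kern_mass * norm (g z0)"
        by (simp add: M_def s_def distrib_left)
      also have "\<dots> \<le> integral unit_square (\<lambda>w. kern w * norm (f (z0 + r *\<^sub>R w)))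
          + integral unit_square (\<lambda>w. kern w * norm (g (z0 + r *\<^sub>R w))) + 64 * K * M ^ 3 * r"
        using mv[of f] mv[of g] by simp
      also have "integral unit_square (\<lambda>w. kern w * norm (f (z0 + r *\<^sub>R w)))
          + integral unit_square (\<lambda>w. kern w * norm (g (z0 + r *\<^sub>R w)))
          = integral unit_square (\<lambda>w. kern w * s (z0 + r *\<^sub>R w))"
      proof -
        have "continuous_on unit_square (\<lambda>w. u (z0 + r *\<^sub>R w))" if "smooth_on unit_disk u" for u :: "plane \<Rightarrow> complex"
          by (rule continuous_on_compose2[OF smooth_on_continuous[OF that]]) (use mem in \<open>auto intro!: continuous_intros\<close>)
        note cu = this[OF f] this[OF g]
        show ?thesis unfolding s_def distrib_left
          by (rule integral_add[symmetric]) (intro integrable_continuous continuous_intros cu)+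
      qed
      also have "integral unit_square (\<lambda>w. kern w * s (z0 + r *\<^sub>R w)) \<le> 5 * root 4 (E / r\<^sup>2)"
        by (rule kern_average_L4[OF cont s0 r(1) bsub _ E0]) (use E in \<open>simp add: s_def\<close>)
      \<comment> \<open>The value of \<open>\<delta>\<close> is made for this: exactly half of
        \<open>kern_mass * M\<close> may be lost.\<close>
      also have "64 * K * M ^ 3 * r \<le> kern_mass / 2 * M"
      proof -
        have "64 * K * M ^ 3 * r \<le> 64 * K * M ^ 3 * (\<delta> / M\<^sup>2)" using K M r by (intro mult_left_mono) auto
        also have "\<dots> = kern_mass / 2 * M" using M K by (simp add: \<delta>_def field_simps power_numeral_reduce)
        finally show ?thesis .
      qed
      finally have "M \<le> (10 / kern_mass) * root 4 (E / r\<^sup>2)" using kp by (simp add: field_simps)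
      then have "M\<^sup>2 \<le> ((10 / kern_mass) * root 4 (E / r\<^sup>2))\<^sup>2" using M by (intro power_mono) auto
      also have "\<dots> = 100 / kern_mass\<^sup>2 * (sqrt E / r)"
      proof -
        have "(root 4 (E / r\<^sup>2))\<^sup>2 = sqrt (E / r\<^sup>2)"
        proof (rule real_sqrt_unique[symmetric])
          have "((root 4 (E / r\<^sup>2))\<^sup>2)\<^sup>2 = root 4 (E / r\<^sup>2) ^ 4" by simp
          also have "\<dots> = E / r\<^sup>2" using E0 by (intro real_root_pow_pos2) auto
          finally show "((root 4 (E / r\<^sup>2))\<^sup>2)\<^sup>2 = E / r\<^sup>2" .
        qed simp
        then show ?thesis using r by (simp add: power_mult_distrib power_divide real_sqrt_divide)
      qed
      finally have Mr: "M\<^sup>2 * r \<le> 100 / kern_mass\<^sup>2 * sqrt E" using r(1) kp by (simp add: field_simps)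
      \<comment> \<open>At the natural scale \<open>Mr\<close> would bound \<open>\<delta>\<close>
        by the energy term, against \<open>small\<close>. Hence \<open>r\<close> is a fixed fraction
        of the weight at \<open>z0\<close>.\<close>
      have "r \<noteq> \<delta> / M\<^sup>2"
      proof
        assume "r = \<delta> / M\<^sup>2"
        then have "M\<^sup>2 * r = \<delta>" using M by simp
        then show False using Mr small by linarith
      qed
      then have "r = d / 2" by (auto simp: r_def min_def split: if_splits)
      then have "\<rho> - norm z0 = 4 * r" by (simp add: d_def)
      then have "(\<rho> - norm z0) * (s z0)\<^sup>2 \<le> 400 / kern_mass\<^sup>2 * sqrt E"
        using mult_left_mono[OF Mr, of 4] by (simp add: M_def mult_ac)
      then show ?thesis using max[OF z] by linarith
    qed
  qed
  have ev: "\<forall>\<^sub>F \<rho> in at_left 1. (\<rho> - norm z) * (s z)\<^sup>2 \<le> 400 / kern_mass\<^sup>2 * sqrt E"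
  proof -
    have "norm z < 1" using z by simp
    then have "\<forall>\<^sub>F \<rho> in at_left 1. \<rho> \<in> {norm z<..<1}" by (rule eventually_at_left_real)
    then show ?thesis
    proof eventually_elim
      case (elim \<rho>)
      then show ?case using main[of \<rho> z] norm_ge_zero[of z] by (smt (verit) greaterThanLessThan_iff mem_cball_0)
    qed
  qed
  have "((\<lambda>\<rho>. (\<rho> - norm z) * (s z)\<^sup>2) \<longlongrightarrow> (1 - norm z) * (s z)\<^sup>2) (at_left 1)"
    by (intro tendsto_intros)
  from tendsto_upperbound[OF this ev] show ?thesis by (simp add: s_def)
qed

subsection \<open>Taylor polynomials\<close>

text \<open>Divided by factorials, so that differentiation only lowers exponents and the
  coefficients of a Taylor polynomial are the derivatives themselves.\<close>

definition taylor_mono :: "plane \<Rightarrow> multi_index \<Rightarrow> plane \<Rightarrow> complex" where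
  "taylor_mono p \<alpha> z = of_real ((fst z - fst p) ^ fst \<alpha> * (snd z - snd p) ^ snd \<alpha> / (fact (fst \<alpha>) * fact (snd \<alpha>)))"

lemma has_derivative_pow_fact:
  assumes "(L has_derivative L') (at (z::plane))"
  shows "((\<lambda>z. (L z :: real) ^ n / fact n) has_derivative (\<lambda>h. (if n = 0 then 0 else L z ^ (n - 1) / fact (n - 1)) * L' h)) (at z)"
proof (cases n)
  case (Suc m)
  have "((\<lambda>z. L z ^ n / fact n) has_derivative (\<lambda>h. (of_nat n * L' h * L z ^ (n - 1)) / fact n)) (at z)"
    by (rule bounded_linear.has_derivative[OF bounded_linear_divide has_derivative_power[OF assms]])
  moreover have "(of_nat n * L' h * L z ^ (n - 1)) / fact n = (if n = 0 then 0 else L z ^ (n - 1) / fact (n - 1)) * L' h" for h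
    using Suc by (simp add: fact_Suc field_simps del: of_nat_Suc)
  ultimately show ?thesis by simp
qed auto

lemma has_derivative_taylor_mono:
  "(taylor_mono p (a, b) has_derivative (\<lambda>h. (if a = 0 then 0 else fst h *\<^sub>R taylor_mono p (a - 1, b) z)
     + (if b = 0 then 0 else snd h *\<^sub>R taylor_mono p (a, b - 1) z))) (at z)"
proof -
  have x: "((\<lambda>z::plane. fst z - fst p) has_derivative fst) (at z)"
    and y: "((\<lambda>z::plane. snd z - snd p) has_derivative snd) (at z)"
    by (auto intro!: derivative_eq_intros)
  let ?x = "fst z - fst p" and ?y = "snd z - snd p"
  note d = has_derivative_of_real[OF has_derivative_mult[OF has_derivative_pow_fact[OF x, of a] has_derivative_pow_fact[OF y, of b]], where 'a = complex]
  have e1: "taylor_mono p (a, b) = (\<lambda>z. of_real ((fst z - fst p) ^ a / fact a * ((snd z - snd p) ^ b / fact b)))"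
    by (auto simp: taylor_mono_def)
  show ?thesis unfolding e1
    by (rule has_derivative_eq_rhs[OF d]) (auto simp: fun_eq_iff taylor_mono_def scaleR_conv_of_real field_simps)
qed

lemma partial_deriv_taylor_mono:
  "partial_deriv h (taylor_mono p (a, b)) z = (if a = 0 then 0 else fst h *\<^sub>R taylor_mono p (a - 1, b) z)
     + (if b = 0 then 0 else snd h *\<^sub>R taylor_mono p (a, b - 1) z)"
  by (rule partial_deriv_at[OF has_derivative_taylor_mono])

lemma Ck_on_taylor_mono: "open \<Omega> \<Longrightarrow> Ck_on k \<Omega> (taylor_mono p \<alpha>)"
proof (induction k arbitrary: \<alpha>)
  case 0
  show ?case using has_derivative_taylor_mono[of p "fst \<alpha>" "snd \<alpha>"]
    by (auto intro!: continuous_at_imp_continuous_on has_derivative_continuous)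
next
  case (Suc k)
  have "Ck_on k \<Omega> (partial_deriv h (taylor_mono p \<alpha>))" for h
  proof -
    have "partial_deriv h (taylor_mono p \<alpha>) = (\<lambda>z. (if fst \<alpha> = 0 then 0 else fst h *\<^sub>R taylor_mono p (fst \<alpha> - 1, snd \<alpha>) z)
     + (if snd \<alpha> = 0 then 0 else snd h *\<^sub>R taylor_mono p (fst \<alpha>, snd \<alpha> - 1) z))"
      by (rule ext) (simp only: partial_deriv_taylor_mono[of h p "fst \<alpha>" "snd \<alpha>", unfolded prod.collapse])
    moreover have "Ck_on k \<Omega> \<dots>"
      using Suc by (intro Ck_on_add; cases "fst \<alpha> = 0"; cases "snd \<alpha> = 0")
        (simp_all add: Ck_on_bounded_linear[OF bounded_linear_scaleR_right])
    ultimately show ?thesis by simp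
  qed
  moreover have "taylor_mono p \<alpha> differentiable (at z)" for z
    using differentiableI[OF has_derivative_taylor_mono[of p "fst \<alpha>" "snd \<alpha>" z]] by simp
  ultimately show ?case by simp
qed

lemma smooth_on_taylor_mono: "open \<Omega> \<Longrightarrow> smooth_on \<Omega> (taylor_mono p \<alpha>)"
  by (simp add: smooth_on_def Ck_on_taylor_mono)

lemma wderiv_zero [simp]: "wderiv w (\<lambda>z. 0) = (\<lambda>z. 0)"
  by (induction w) auto

lemma wderiv_taylor_mono:
  "wderiv w (taylor_mono p (a, b)) = (if count_list w True \<le> a \<and> count_list w False \<le> b
     then taylor_mono p (a - count_list w True, b - count_list w False) else (\<lambda>z. 0))"
proof (induction w arbitrary: a b)
  case (Cons c w)
  have "partial_deriv (1, 0) (taylor_mono p (a, b)) = (if a = 0 then (\<lambda>z. 0) else taylor_mono p (a - 1, b))"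
    "partial_deriv (0, 1) (taylor_mono p (a, b)) = (if b = 0 then (\<lambda>z. 0) else taylor_mono p (a, b - 1))"
    by (auto simp: partial_deriv_taylor_mono fun_eq_iff)
  then show ?case using Cons by (cases c) auto
qed simp

lemma taylor_mono_at: "taylor_mono p (a, b) p = (if a = 0 \<and> b = 0 then 1 else 0)"
  by (auto simp: taylor_mono_def)

lemma count_list_True_False: "count_list w True + count_list w False = length w"
  by (induction w) auto

text \<open>The strict inequality gives \<open>taylor_poly p k u\<close> degree below
  \<open>k\<close>, so that its derivatives of order \<open>k\<close> vanish.\<close>

definition multi_indices :: "nat \<Rightarrow> multi_index set" where
  "multi_indices k = {\<alpha>. mi_order \<alpha> < k}"

lemma finite_multi_indices: "finite (multi_indices k)"
proof (rule finite_subset)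
  show "multi_indices k \<subseteq> {..k} \<times> {..k}" by (auto simp: multi_indices_def mi_order_def)
qed simp

definition taylor_sum :: "plane \<Rightarrow> multi_index set \<Rightarrow> (multi_index \<Rightarrow> complex) \<Rightarrow> plane \<Rightarrow> complex" where
  "taylor_sum p I c z = (\<Sum>\<alpha>\<in>I. c \<alpha> * taylor_mono p \<alpha> z)"

lemma smooth_on_taylor_sum: "open \<Omega> \<Longrightarrow> smooth_on \<Omega> (taylor_sum p I c)"
  unfolding taylor_sum_def[abs_def]
  by (intro smooth_on_sum smooth_on_mult smooth_on_taylor_mono smooth_on_const)

lemma wderiv_sum:
  assumes "open \<Omega>" "\<And>i. i \<in> I \<Longrightarrow> smooth_on \<Omega> (u i)" "z \<in> \<Omega>"
  shows "wderiv w (\<lambda>z. \<Sum>i\<in>I. u i z) z = (\<Sum>i\<in>I. wderiv w (u i) z)"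
  using assms(2)
proof (induction I rule: infinite_finite_induct)
  case (insert i I)
  have "wderiv w (\<lambda>z. u i z + (\<Sum>i\<in>I. u i z)) z = wderiv w (u i) z + wderiv w (\<lambda>z. \<Sum>i\<in>I. u i z) z"
    using insert.prems by (intro wderiv_add[OF assms(1)] smooth_on_sum[OF assms(1)] assms(3)) auto
  then show ?case using insert by auto
qed auto

lemma wderiv_taylor_sum:
  "wderiv w (taylor_sum p I c) z = (\<Sum>\<alpha>\<in>I. c \<alpha> * wderiv w (taylor_mono p \<alpha>) z)"
proof -
  have "wderiv w (taylor_sum p I c) z = (\<Sum>\<alpha>\<in>I. wderiv w (\<lambda>z. c \<alpha> * taylor_mono p \<alpha> z) z)"
    unfolding taylor_sum_def[abs_def]
    by (rule wderiv_sum[of UNIV]) (auto intro!: smooth_on_mult smooth_on_taylor_mono)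
  also have "\<dots> = (\<Sum>\<alpha>\<in>I. c \<alpha> * wderiv w (taylor_mono p \<alpha>) z)"
    by (intro sum.cong refl wderiv_bounded_linear[OF bounded_linear_mult_right, of UNIV] smooth_on_taylor_mono) auto
  finally show ?thesis .
qed

lemma wderiv_taylor_sum_at:
  assumes "finite I"
  shows "wderiv w (taylor_sum p I c) p = (if (count_list w True, count_list w False) \<in> I then c (count_list w True, count_list w False) else 0)"
proof -
  have "wderiv w (taylor_mono p \<alpha>) p = (if \<alpha> = (count_list w True, count_list w False) then 1 else 0)" for \<alpha>
    by (cases \<alpha>) (auto simp: wderiv_taylor_mono taylor_mono_at)
  then have "wderiv w (taylor_sum p I c) p = (\<Sum>\<alpha>\<in>I. if \<alpha> = (count_list w True, count_list w False) then c \<alpha> else 0)"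
    unfolding wderiv_taylor_sum by (intro sum.cong) auto
  also have "\<dots> = (if (count_list w True, count_list w False) \<in> I then c (count_list w True, count_list w False) else 0)"
    by (rule sum.delta[OF assms])
  finally show ?thesis .
qed

lemma Dnorm_taylor_sum_high:
  assumes "\<And>\<alpha>. \<alpha> \<in> I \<Longrightarrow> mi_order \<alpha> < k"
  shows "Dnorm k (taylor_sum p I c) z = 0"
proof -
  have "norm (wderiv w (taylor_sum p I c) z) \<le> 0" if w: "length w = k" for w
  proof -
    have "wderiv w (taylor_mono p \<alpha>) z = 0" if "\<alpha> \<in> I" for \<alpha>
      using assms[OF that] w count_list_True_False[of w] by (cases \<alpha>) (auto simp: wderiv_taylor_mono mi_order_def)
    then show ?thesis unfolding wderiv_taylor_sum by simp
  qed
  then have "Dnorm k (taylor_sum p I c) z \<le> 2 ^ k * 0" by (rule Dnorm_le)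
  then show ?thesis using Dnorm_nonneg[of k "taylor_sum p I c" z] by simp
qed

definition taylor_poly :: "plane \<Rightarrow> nat \<Rightarrow> (plane \<Rightarrow> complex) \<Rightarrow> plane \<Rightarrow> complex" where
  "taylor_poly p k u = taylor_sum p (multi_indices k) (\<lambda>\<alpha>. mi_deriv \<alpha> u p)"

lemma smooth_on_taylor_poly: "open \<Omega> \<Longrightarrow> smooth_on \<Omega> (taylor_poly p k u)"
  by (simp add: taylor_poly_def smooth_on_taylor_sum)

lemma wderiv_taylor_poly_at:
  assumes "open \<Omega>" "smooth_on \<Omega> u" "p \<in> \<Omega>" "length w < k"
  shows "wderiv w (taylor_poly p k u) p = wderiv w u p"
proof -
  have "(count_list w True, count_list w False) \<in> multi_indices k"
    using assms(4) count_list_True_False[of w] by (simp add: multi_indices_def mi_order_def)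
  then show ?thesis
    using wderiv_eq_mi_deriv[OF assms(1-3), of w]
    by (simp add: taylor_poly_def wderiv_taylor_sum_at[OF finite_multi_indices])
qed

lemma Dnorm_taylor_poly: "Dnorm k (taylor_poly p k u) z = 0"
  unfolding taylor_poly_def by (rule Dnorm_taylor_sum_high) (simp add: multi_indices_def)

lemma increment_bound:
  fixes u :: "plane \<Rightarrow> complex"
  assumes \<Omega>: "open \<Omega>" "cball p s \<subseteq> \<Omega>" and u: "smooth_on \<Omega> u" and z: "dist p z \<le> s"
    and S: "\<And>x. x \<in> cball p (dist p z) \<Longrightarrow> Dnorm 1 u x \<le> S"
  shows "norm (u z - u p) \<le> S * dist p z"
proof -
  have "norm (u z - u p) \<le> S * norm (z - p)"
  proof (rule differentiable_bound[of "cball p (dist p z)"])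
    fix x assume x: "x \<in> cball p (dist p z)"
    have "x \<in> \<Omega>" using x z \<Omega>(2) by (intro subsetD[OF \<Omega>(2)]) auto
    then have d: "u differentiable (at x)" using smooth_on_differentiable[OF u] by blast
    show "(u has_derivative (\<lambda>v. partial_deriv v u x)) (at x within cball p (dist p z))"
      by (rule has_derivative_at_withinI[OF has_derivative_partial_deriv[OF d]])
    show "onorm (\<lambda>v. partial_deriv v u x) \<le> S"
    proof (rule onorm_le)
      fix v :: plane
      have "norm (partial_deriv v u x) \<le> \<bar>fst v\<bar> * norm (deriv_x u x) + \<bar>snd v\<bar> * norm (deriv_y u x)"
        unfolding partial_deriv_eq_coords[OF d, of v] by (rule order_trans[OF norm_triangle_ineq]) simp
      also have "\<dots> \<le> norm v * norm (deriv_x u x) + norm v * norm (deriv_y u x)"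
        using norm_fst_le[of "fst v" "snd v"] norm_snd_le[of "snd v" "fst v"] by (intro add_mono mult_right_mono) auto
      also have "\<dots> = Dnorm 1 u x * norm v" by (simp add: algebra_simps)
      also have "\<dots> \<le> S * norm v" using S[OF x] by (intro mult_right_mono) auto
      finally show "norm (partial_deriv v u x) \<le> S * norm v" .
    qed
  qed auto
  then show ?thesis by (simp add: dist_norm norm_minus_commute)
qed

lemma Dnorm_wderiv_le: "Dnorm j (wderiv w u) z \<le> Dnorm (length w + j) u z"
proof (induction w arbitrary: u)
  case (Cons c w)
  have "Dnorm j (wderiv (c # w) u) z \<le> Dnorm (length w + j) (partial_deriv (dir c) u) z"
    using Cons.IH by simp
  also have "\<dots> \<le> Dnorm (length (c # w) + j) u z" using Dnorm_partial_le[of "length w + j" c u z] by simp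
  finally show ?case .
qed simp

text \<open>Integration from \<open>p\<close> outwards lowers the order by one and gains a factor
  \<open>dist p z\<close>; each of the \<open>i\<close> steps costs at most \<open>2 ^ k\<close> for
  passing from single words to \<open>Dnorm\<close>.\<close>

lemma taylor_vanishing:
  fixes u :: "plane \<Rightarrow> complex"
  assumes \<Omega>: "open \<Omega>" "cball p s \<subseteq> \<Omega>" and u: "smooth_on \<Omega> u"
    and van: "\<And>w. length w < k \<Longrightarrow> wderiv w u p = 0"
  shows "i \<le> k \<Longrightarrow> dist p z \<le> s \<Longrightarrow> (\<And>x. x \<in> cball p (dist p z) \<Longrightarrow> Dnorm k u x \<le> S)
    \<Longrightarrow> Dnorm (k - i) u z \<le> (2 ^ k * dist p z) ^ i * S"
proof (induction i arbitrary: z)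
  case 0 show ?case using 0(3)[of z] by (simp only: mem_cball) simp
next
  case (Suc i)
  let ?r = "dist p z"
  have S0: "0 \<le> S" using Suc.prems(3)[of z] Dnorm_nonneg[of k u z] by (auto simp del: Dnorm_nonneg)
  have up: "Dnorm (k - i) u x \<le> (2 ^ k * ?r) ^ i * S" if x: "x \<in> cball p ?r" for x
  proof -
    have "Dnorm (k - i) u x \<le> (2 ^ k * dist p x) ^ i * S"
      using Suc.prems x by (intro Suc.IH) auto
    also have "\<dots> \<le> (2 ^ k * ?r) ^ i * S" using x S0 by (intro mult_right_mono power_mono mult_left_mono) auto
    finally show ?thesis .
  qed
  have "norm (wderiv w u z) \<le> (2 ^ k * ?r) ^ i * S * ?r" if w: "length w = k - Suc i" for w
  proof -
    have "norm (wderiv w u z - wderiv w u p) \<le> ((2 ^ k * ?r) ^ i * S) * ?r"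
    proof (rule increment_bound[OF \<Omega> smooth_on_wderiv[OF u] Suc.prems(2)])
      fix x assume x: "x \<in> cball p ?r"
      have "length w + 1 = k - i" using w Suc.prems(1) by simp
      then show "Dnorm 1 (wderiv w u) x \<le> (2 ^ k * ?r) ^ i * S"
        using Dnorm_wderiv_le[of 1 w u x] up[OF x] by simp
    qed
    moreover have "wderiv w u p = 0" using w Suc.prems(1) by (intro van) auto
    ultimately show ?thesis by simp
  qed
  then have "Dnorm (k - Suc i) u z \<le> 2 ^ (k - Suc i) * ((2 ^ k * ?r) ^ i * S * ?r)" by (rule Dnorm_le)
  also have "\<dots> \<le> 2 ^ k * ((2 ^ k * ?r) ^ i * S * ?r)" using S0 by (intro mult_right_mono power_increasing) auto
  also have "\<dots> = (2 ^ k * ?r) ^ Suc i * S" by (simp add: algebra_simps)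
  finally show ?case .
qed

text \<open>The remainder has vanishing derivatives of order below \<open>k\<close> at
  \<open>p\<close>, and \<open>Dnorm k\<close> of it is at most that of \<open>u\<close>, since the
  polynomial has degree below \<open>k\<close>.\<close>

lemma taylor_remainder:
  fixes u :: "plane \<Rightarrow> complex"
  assumes \<Omega>: "open \<Omega>" "cball p s \<subseteq> \<Omega>" and u: "smooth_on \<Omega> u" and s: "0 \<le> s"
    and j: "j \<le> k" and z: "dist p z \<le> s"
    and S: "\<And>x. x \<in> cball p (dist p z) \<Longrightarrow> Dnorm k u x \<le> S"
  shows "Dnorm j (\<lambda>z. u z - taylor_poly p k u z) z \<le> (2 ^ k * dist p z) ^ (k - j) * S"
proof -
  let ?T = "taylor_poly p k u"
  have p: "p \<in> \<Omega>" using \<Omega>(2) s by auto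
  note T = smooth_on_taylor_poly[OF \<Omega>(1), of p k u]
  have sm: "smooth_on \<Omega> (\<lambda>z. u z - ?T z)" by (rule smooth_on_diff[OF \<Omega>(1) u T])
  have "wderiv w (\<lambda>z. u z - ?T z) p = 0" if "length w < k" for w
    using wderiv_add[OF \<Omega>(1) u smooth_on_minus[OF \<Omega>(1) T] p, of w]
      wderiv_bounded_linear[OF bounded_linear_minus[OF bounded_linear_ident] \<Omega>(1) T p, of w]
      wderiv_taylor_poly_at[OF \<Omega>(1) u p that] by simp
  moreover have "Dnorm k (\<lambda>z. u z - ?T z) x \<le> S" if "x \<in> cball p (dist p z)" for x
  proof -
    have "x \<in> \<Omega>" using that z by (intro subsetD[OF \<Omega>(2)]) auto
    then show ?thesis using Dnorm_diff[OF \<Omega>(1) u T, of x k] S[OF that] by (simp add: Dnorm_taylor_poly)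
  qed
  ultimately have "Dnorm (k - (k - j)) (\<lambda>z. u z - ?T z) z \<le> (2 ^ k * dist p z) ^ (k - j) * S"
    by (intro taylor_vanishing[OF \<Omega> sm _ _ z]) auto
  then show ?thesis using j by simp
qed

lemma Dnorm_bounded_cball:
  assumes "cball p s \<subseteq> \<Omega>" "smooth_on \<Omega> u"
  obtains S where "S > 0" "\<And>x. x \<in> cball p s \<Longrightarrow> Dnorm k u x \<le> S"
proof -
  have "continuous_on (cball p s) (Dnorm k u)"
    using continuous_on_Dnorm[OF assms(2)] assms(1) continuous_on_subset by blast
  then have "bounded (Dnorm k u ` cball p s)"
    by (intro compact_imp_bounded compact_continuous_image) auto
  then obtain S where "\<And>y. y \<in> Dnorm k u ` cball p s \<Longrightarrow> norm y \<le> S" unfolding bounded_iff by blast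
  then have "Dnorm k u x \<le> max S 1" if "x \<in> cball p s" for x using that by fastforce
  then show ?thesis by (intro that[of "max S 1"]) auto
qed

section \<open>Order of vanishing and leading terms\<close>

lemma taylor_sum_homogeneous:
  assumes "\<And>\<alpha>. \<alpha> \<in> I \<Longrightarrow> mi_order \<alpha> \<noteq> j \<Longrightarrow> c \<alpha> = 0"
  shows "taylor_sum p I c (p + t *\<^sub>R v) = of_real t ^ j * taylor_sum p I c (p + v)"
  unfolding taylor_sum_def sum_distrib_left
proof (rule sum.cong)
  fix \<alpha> assume "\<alpha> \<in> I"
  show "c \<alpha> * taylor_mono p \<alpha> (p + t *\<^sub>R v) = of_real t ^ j * (c \<alpha> * taylor_mono p \<alpha> (p + v))"
  proof (cases "mi_order \<alpha> = j")
    case True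
    then show ?thesis by (auto simp: taylor_mono_def mi_order_def power_mult_distrib power_add)
  qed (use assms \<open>\<alpha> \<in> I\<close> in auto)
qed simp

text \<open>By strong induction on the order \<open>j\<close>, the Taylor polynomial of degree
  \<open>j\<close> is homogeneous of degree \<open>j\<close>, yet bounded by a multiple of
  \<open>dist p z ^ Suc j\<close>. Along rays this forces it to vanish.\<close>

lemma derivs_vanish_of_bigo:
  fixes u :: "plane \<Rightarrow> complex"
  assumes \<Omega>: "open \<Omega>" "cball p s \<subseteq> \<Omega>" and u: "smooth_on \<Omega> u" and s: "s > 0"
    and C: "\<And>z. z \<in> cball p s \<Longrightarrow> norm (u z) \<le> C * dist p z ^ M"
  shows "length w < M \<Longrightarrow> wderiv w u p = 0"
proof (induction "length w" arbitrary: w rule: less_induct)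
  case less
  define j where "j = length w"
  have p: "p \<in> \<Omega>" using \<Omega>(2) s by auto
  define T where "T = taylor_poly p (Suc j) u"
  obtain S where S: "S > 0" "\<And>x. x \<in> cball p s \<Longrightarrow> Dnorm (Suc j) u x \<le> S"
    using Dnorm_bounded_cball[OF \<Omega>(2) u] by blast
  have coef: "mi_deriv \<alpha> u p = 0" if "\<alpha> \<in> multi_indices (Suc j)" "mi_order \<alpha> \<noteq> j" for \<alpha>
  proof -
    have "length (replicate (snd \<alpha>) False @ replicate (fst \<alpha>) True) < j"
      using that by (simp add: multi_indices_def mi_order_def)
    then show ?thesis using less mi_deriv_eq_wderiv[of "fst \<alpha>" "snd \<alpha>" u] unfolding j_def by simp
  qed
  have C0: "0 \<le> C * dist p z ^ M" if "z \<in> cball p s" for z using C[OF that] norm_ge_zero order_trans by blast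
  have T_bound: "norm (T z) \<le> (C * s ^ (M - Suc j) + (2 ^ Suc j) ^ Suc j * S) * dist p z ^ Suc j" if z: "z \<in> cball p s" for z
  proof -
    have "Dnorm 0 (\<lambda>z. u z - T z) z \<le> (2 ^ Suc j * dist p z) ^ (Suc j - 0) * S"
      unfolding T_def using z s by (intro taylor_remainder[OF \<Omega> u]) (auto intro!: S simp del: Dnorm.simps)
    then have 1: "norm (u z - T z) \<le> (2 ^ Suc j) ^ Suc j * S * dist p z ^ Suc j"
      by (simp add: power_mult_distrib mult_ac)
    have "C \<ge> 0"
    proof -
      have "C * s ^ M \<ge> 0" using C0[of "p + (s, 0)"] s by (simp add: dist_norm norm_Pair)
      then show ?thesis using mult_neg_pos[of C "s ^ M"] zero_less_power[OF s, of M] by (meson not_less)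
    qed
    have "dist p z ^ M = dist p z ^ (M - Suc j) * dist p z ^ Suc j"
      by (subst power_add[symmetric]) (use less.prems in \<open>simp add: j_def\<close>)
    then have "norm (u z) \<le> C * (dist p z ^ (M - Suc j) * dist p z ^ Suc j)" using C[OF z] by (simp only:)
    also have "\<dots> \<le> C * (s ^ (M - Suc j) * dist p z ^ Suc j)"
      using z \<open>C \<ge> 0\<close> by (intro mult_left_mono mult_right_mono power_mono) auto
    finally have 2: "norm (u z) \<le> C * s ^ (M - Suc j) * dist p z ^ Suc j" by (simp add: mult.assoc)
    have "norm (T z) \<le> norm (u z) + norm (u z - T z)"
      using norm_triangle_sub[of "T z" "u z"] by (simp add: norm_minus_commute)
    then show ?thesis using 1 2 by (simp add: distrib_right)
  qed
  define C' where "C' = C * s ^ (M - Suc j) + (2 ^ Suc j) ^ Suc j * S"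
  have T0: "T (p + v) = 0" for v
  proof (cases "v = 0")
    case True
    then show ?thesis using T_bound[of p] s by simp
  next
    case False
    have lim: "((\<lambda>t. C' * norm v ^ Suc j * t) \<longlongrightarrow> C' * norm v ^ Suc j * 0) (at_right 0)" by (intro tendsto_intros)
    have "\<forall>\<^sub>F t in at_right 0. norm (T (p + v)) \<le> C' * norm v ^ Suc j * t"
    proof -
      have "0 < s / norm v" using s False by simp
      then have "\<forall>\<^sub>F t in at_right 0. t \<in> {0<..<s / norm v}" by (rule eventually_at_right_real)
      then show ?thesis
      proof eventually_elim
        case (elim t)
        have t: "t > 0" "t * norm v \<le> s" using elim False by (auto simp: field_simps)
        have "t ^ j * norm (T (p + v)) = norm (T (p + t *\<^sub>R v))"
          unfolding T_def taylor_poly_def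
          by (subst taylor_sum_homogeneous[where j = j]) (use coef t in \<open>auto simp: norm_mult norm_power\<close>)
        also have "\<dots> \<le> C' * dist p (p + t *\<^sub>R v) ^ Suc j"
          unfolding C'_def using t by (intro T_bound) (simp add: dist_norm)
        also have "\<dots> = t ^ j * (C' * norm v ^ Suc j * t)" using t by (simp add: dist_norm power_mult_distrib mult_ac)
        finally show ?case using t by simp
      qed
    qed
    from tendsto_lowerbound[OF lim this] show ?thesis by simp
  qed
  have "T z = 0" for z using T0[of "z - p"] by simp
  then have "T = (\<lambda>z. 0)" by auto
  then have "wderiv w T p = 0" by simp
  moreover have "wderiv w T p = wderiv w u p" unfolding T_def by (rule wderiv_taylor_poly_at[OF \<Omega>(1) u p]) (simp add: j_def)
  ultimately show ?case by simp
qed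

text \<open>The factor \<open>dist p z ^ i\<close> on the left, in place of an exponent
  \<open>M - i\<close> on the right, keeps the bound meaningful for \<open>i > M\<close>, where
  boundedness of the derivatives suffices.\<close>

lemma bigo_derivs:
  fixes u :: "plane \<Rightarrow> complex"
  assumes \<Omega>: "open \<Omega>" "cball p s \<subseteq> \<Omega>" and u: "smooth_on \<Omega> u" and s: "s > 0"
    and C: "\<And>z. z \<in> cball p s \<Longrightarrow> norm (u z) \<le> C * dist p z ^ M"
  shows "\<exists>B>0. \<forall>z\<in>cball p s. Dnorm i u z * dist p z ^ i \<le> B * dist p z ^ M"
proof (cases "i \<le> M")
  case True
  obtain S where S: "S > 0" "\<And>x. x \<in> cball p s \<Longrightarrow> Dnorm M u x \<le> S"
    using Dnorm_bounded_cball[OF \<Omega>(2) u] by blast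
  have "Dnorm i u z * dist p z ^ i \<le> ((2 ^ M) ^ (M - i) * S) * dist p z ^ M" if z: "z \<in> cball p s" for z
  proof -
    have "Dnorm (M - (M - i)) u z \<le> (2 ^ M * dist p z) ^ (M - i) * S"
      using z by (intro taylor_vanishing[OF \<Omega> u derivs_vanish_of_bigo[OF \<Omega> u s C]]) (auto intro!: S)
    then have "Dnorm i u z * dist p z ^ i \<le> (2 ^ M * dist p z) ^ (M - i) * S * dist p z ^ i"
      using True by (intro mult_right_mono) auto
    also have "\<dots> = ((2 ^ M) ^ (M - i) * S) * dist p z ^ M"
      using True by (simp add: power_mult_distrib mult_ac flip: power_add)
    finally show ?thesis .
  qed
  then show ?thesis using S(1) by (intro exI[of _ "(2 ^ M) ^ (M - i) * S"]) auto
next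
  case False
  obtain S where S: "S > 0" "\<And>x. x \<in> cball p s \<Longrightarrow> Dnorm i u x \<le> S"
    using Dnorm_bounded_cball[OF \<Omega>(2) u] by blast
  have "Dnorm i u z * dist p z ^ i \<le> (S * s ^ (i - M)) * dist p z ^ M" if z: "z \<in> cball p s" for z
  proof -
    have "Dnorm i u z * dist p z ^ i \<le> S * dist p z ^ i" using S(2)[OF z] by (intro mult_right_mono) auto
    also have "\<dots> = S * (dist p z ^ (i - M) * dist p z ^ M)" using False by (simp flip: power_add)
    also have "\<dots> \<le> S * (s ^ (i - M) * dist p z ^ M)"
      using z S by (intro mult_left_mono mult_right_mono power_mono) auto
    finally show ?thesis by (simp add: mult.assoc)
  qed
  then show ?thesis using S(1) s by (intro exI[of _ "S * s ^ (i - M)"]) auto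
qed

lemma smooth_on_dbar: "open \<Omega> \<Longrightarrow> smooth_on \<Omega> u \<Longrightarrow> smooth_on \<Omega> (dbar u)"
  unfolding dbar_def[abs_def] by (intro smooth_on_add smooth_on_mult smooth_on_partial_deriv smooth_on_const)

lemma wderiv_dbar:
  assumes "open \<Omega>" "smooth_on \<Omega> u" "z \<in> \<Omega>"
  shows "wderiv w (dbar u) z = wderiv (True # w) u z + \<i> * wderiv (False # w) u z"
proof -
  have "wderiv w (dbar u) z = wderiv w (deriv_x u) z + wderiv w (\<lambda>z. \<i> * deriv_y u z) z"
    unfolding dbar_def[abs_def]
    by (intro wderiv_add[OF assms(1)] smooth_on_mult[OF assms(1)] smooth_on_partial_deriv smooth_on_const assms)
  also have "wderiv w (\<lambda>z. \<i> * deriv_y u z) z = \<i> * wderiv w (deriv_y u) z"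
    by (intro wderiv_bounded_linear[OF bounded_linear_mult_right assms(1)] smooth_on_partial_deriv assms)
  finally show ?thesis by simp
qed

lemma count_list_replicate: "count_list (replicate n x) y = (if x = y then n else 0)"
  by (induction n) auto

text \<open>In other words, the part of degree \<open>m\<close> of the Taylor series of \<open>u\<close> is a multiple of \<open>(x + i y)\<^sup>m\<close>.\<close>

lemma leading_coefficients:
  fixes u :: "plane \<Rightarrow> complex"
  assumes \<Omega>: "open \<Omega>" "p \<in> \<Omega>" and u: "smooth_on \<Omega> u"
    and van: "\<And>w. length w < m \<Longrightarrow> wderiv w (dbar u) p = 0"
  shows "a + b = m \<Longrightarrow> mi_deriv (a, b) u p = \<i> ^ b * mi_deriv (m, 0) u p"
proof (induction b arbitrary: a)
  case 0 then show ?case by simp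
next
  case (Suc b)
  let ?w = "replicate b False @ replicate a True"
  have "wderiv (True # ?w) u p + \<i> * wderiv (False # ?w) u p = 0"
    using van[of ?w] Suc.prems wderiv_dbar[OF \<Omega>(1) u \<Omega>(2), of ?w] by (simp del: wderiv.simps)
  moreover have "wderiv (True # ?w) u p = mi_deriv (Suc a, b) u p" "wderiv (False # ?w) u p = mi_deriv (a, Suc b) u p"
    using wderiv_eq_mi_deriv[OF \<Omega>(1) u \<Omega>(2), of "True # ?w"] wderiv_eq_mi_deriv[OF \<Omega>(1) u \<Omega>(2), of "False # ?w"]
    by (simp_all del: wderiv.simps add: count_list_replicate)
  ultimately have "mi_deriv (a, Suc b) u p = \<i> * mi_deriv (Suc a, b) u p"
    by (simp add: complex_eq_iff)
  then show ?case using Suc.IH[of "Suc a"] Suc.prems by simp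
qed

text \<open>By the binomial theorem the leading part is a constant times
  \<open>(x + \<i> y) ^ m\<close>, whose modulus is exactly \<open>dist p z ^ m\<close>. A nonzero
  constant thus yields a lower bound in all directions.\<close>

lemma taylor_poly_leading:
  fixes u :: "plane \<Rightarrow> complex"
  assumes \<Omega>: "open \<Omega>" "p \<in> \<Omega>" and u: "smooth_on \<Omega> u"
    and low: "\<And>w. length w < m \<Longrightarrow> wderiv w u p = 0"
    and van: "\<And>w. length w < m \<Longrightarrow> wderiv w (dbar u) p = 0"
  shows "norm (taylor_poly p (Suc m) u z) = norm (mi_deriv (m, 0) u p) / fact m * dist p z ^ m"
proof -
  let ?x = "fst z - fst p" and ?y = "snd z - snd p"
  let ?c = "mi_deriv (m, 0) u p"
  define X Y where "X = complex_of_real ?x" and "Y = complex_of_real ?y"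
  have mono: "taylor_mono p (m - b, b) z = X ^ (m - b) * Y ^ b / (fact (m - b) * fact b)" for b
    by (simp add: taylor_mono_def X_def Y_def)
  have "taylor_poly p (Suc m) u z = (\<Sum>\<alpha>\<in>(\<lambda>b. (m - b, b)) ` {..m}. mi_deriv \<alpha> u p * taylor_mono p \<alpha> z)"
    unfolding taylor_poly_def taylor_sum_def
  proof (rule sum.mono_neutral_right[OF finite_multi_indices])
    show "(\<lambda>b. (m - b, b)) ` {..m} \<subseteq> multi_indices (Suc m)" by (auto simp: multi_indices_def mi_order_def)
    show "\<forall>\<alpha>\<in>multi_indices (Suc m) - (\<lambda>b. (m - b, b)) ` {..m}. mi_deriv \<alpha> u p * taylor_mono p \<alpha> z = 0"
    proof
      fix \<alpha> assume \<alpha>: "\<alpha> \<in> multi_indices (Suc m) - (\<lambda>b. (m - b, b)) ` {..m}"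
      obtain a b where ab: "\<alpha> = (a, b)" by force
      have "a + b \<noteq> m" using \<alpha> ab by (auto simp: image_iff)
      then have "length (replicate b False @ replicate a True) < m" using \<alpha> ab by (auto simp: multi_indices_def mi_order_def)
      then show "mi_deriv \<alpha> u p * taylor_mono p \<alpha> z = 0" using low ab by (simp add: mi_deriv_eq_wderiv)
    qed
  qed
  also have "\<dots> = (\<Sum>b\<le>m. mi_deriv (m - b, b) u p * taylor_mono p (m - b, b) z)"
    by (subst sum.reindex) (auto simp: inj_on_def)
  also have "\<dots> = (\<Sum>b\<le>m. ?c / fact m * (of_nat (m choose b) * (\<i> * Y) ^ b * X ^ (m - b)))"
  proof (rule sum.cong)
    fix b assume "b \<in> {..m}"
    then have b: "b \<le> m" by simp
    have "mi_deriv (m - b, b) u p = \<i> ^ b * ?c" using b by (intro leading_coefficients[OF \<Omega> u van]) auto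
    moreover have "(of_nat (m choose b) :: complex) = fact m / (fact b * fact (m - b))" by (rule binomial_fact[OF b])
    ultimately show "mi_deriv (m - b, b) u p * taylor_mono p (m - b, b) z
      = ?c / fact m * (of_nat (m choose b) * (\<i> * Y) ^ b * X ^ (m - b))"
      unfolding mono power_mult_distrib by (simp add: field_simps)
  qed simp
  also have "\<dots> = ?c / fact m * (\<i> * Y + X) ^ m"
    unfolding binomial_ring sum_distrib_left ..
  finally have "norm (taylor_poly p (Suc m) u z) = norm ?c / fact m * norm (\<i> * Y + X) ^ m"
    by (simp add: norm_mult norm_divide norm_power)
  also have "norm (\<i> * Y + X) = dist p z"
    by (simp add: X_def Y_def cmod_def dist_norm norm_prod_def norm_minus_commute[of z] power2_commute add.commute)
  finally show ?thesis .
qed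

text \<open>With \<open>m\<close> the lowest order of a nonzero derivative, both functions are O of
  \<open>dist p z ^ m\<close>. By the differential inequality so are their
  \<open>dbar\<close>-derivatives, whose derivatives of order below \<open>m\<close> therefore
  vanish at \<open>p\<close>, and \<open>taylor_poly_leading\<close> applies.\<close>

lemma finite_order_vanishing:
  fixes f g :: "plane \<Rightarrow> complex"
  assumes \<Omega>: "open \<Omega>" "cball p s \<subseteq> \<Omega>" and s: "s > 0" and f: "smooth_on \<Omega> f" and g: "smooth_on \<Omega> g" and K: "K \<ge> 0"
    and df: "\<And>z. z \<in> cball p s \<Longrightarrow> norm (dbar f z) \<le> K * (norm (f z) + norm (g z))"
    and dg: "\<And>z. z \<in> cball p s \<Longrightarrow> norm (dbar g z) \<le> K * (norm (f z) + norm (g z))"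
    and nonflat: "\<exists>w. wderiv w f p \<noteq> 0 \<or> wderiv w g p \<noteq> 0"
  obtains m c C r where "0 < c" "0 < C" "0 < r" "r \<le> s"
    "\<And>z. z \<in> cball p r \<Longrightarrow> c * dist p z ^ m \<le> norm (f z) + norm (g z)"
    "\<And>z. z \<in> cball p r \<Longrightarrow> norm (f z) + norm (g z) \<le> C * dist p z ^ m"
proof -
  have p: "p \<in> \<Omega>" using \<Omega>(2) s by auto
  define m where "m = (LEAST n. \<exists>w. length w = n \<and> (wderiv w f p \<noteq> 0 \<or> wderiv w g p \<noteq> 0))"
  have ex: "\<exists>n w. length w = n \<and> (wderiv w f p \<noteq> 0 \<or> wderiv w g p \<noteq> 0)" using nonflat by blast
  obtain w where w: "length w = m" "wderiv w f p \<noteq> 0 \<or> wderiv w g p \<noteq> 0"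
    using LeastI_ex[OF ex] unfolding m_def by blast
  have low: "wderiv v f p = 0" "wderiv v g p = 0" if "length v < m" for v
    using not_less_Least[of "length v" "\<lambda>n. \<exists>w. length w = n \<and> (wderiv w f p \<noteq> 0 \<or> wderiv w g p \<noteq> 0)"] that
    unfolding m_def by blast+
  obtain S where S: "S > 0" "\<And>x. x \<in> cball p s \<Longrightarrow> Dnorm m f x \<le> S" using Dnorm_bounded_cball[OF \<Omega>(2) f] by blast
  obtain S' where S': "S' > 0" "\<And>x. x \<in> cball p s \<Longrightarrow> Dnorm m g x \<le> S'" using Dnorm_bounded_cball[OF \<Omega>(2) g] by blast
  define C where "C = (2 ^ m) ^ m * S + (2 ^ m) ^ m * S'"
  have C: "C > 0" using S(1) S'(1) by (simp add: C_def add_pos_pos)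
  have up: "norm (f z) + norm (g z) \<le> C * dist p z ^ m" if z: "z \<in> cball p s" for z
  proof -
    have "Dnorm (m - m) f z \<le> (2 ^ m * dist p z) ^ m * S"
      using z by (intro taylor_vanishing[OF \<Omega> f low(1)]) (auto intro!: S)
    moreover have "Dnorm (m - m) g z \<le> (2 ^ m * dist p z) ^ m * S'"
      using z by (intro taylor_vanishing[OF \<Omega> g low(2)]) (auto intro!: S')
    ultimately show ?thesis by (simp add: C_def power_mult_distrib algebra_simps)
  qed
  have dup: "norm (dbar u z) \<le> (K * C) * dist p z ^ m" if "u = f \<or> u = g" "z \<in> cball p s" for u z
    using df[OF that(2)] dg[OF that(2)] that(1) mult_left_mono[OF up[OF that(2)] K] by (auto simp: mult.assoc)
  have van: "wderiv v (dbar u) p = 0" if "u = f \<or> u = g" "length v < m" for u v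
    using that f g by (intro derivs_vanish_of_bigo[OF \<Omega> smooth_on_dbar[OF \<Omega>(1)] s dup[OF that(1)]]) auto
  define cf where "cf u = norm (mi_deriv (m, 0) u p) / fact m" for u :: "plane \<Rightarrow> complex"
  \<comment> \<open>If both pure x-derivatives of order \<open>m\<close> vanished, so would all
    derivatives of order \<open>m\<close> by \<open>leading_coefficients\<close>, against the choice
    of \<open>w\<close>.\<close>
  have "cf f + cf g > 0"
  proof (rule ccontr)
    assume "\<not> cf f + cf g > 0"
    moreover have "cf u \<ge> 0" for u by (simp add: cf_def)
    ultimately have "cf f = 0" "cf g = 0" by (smt (verit))+
    then have z: "mi_deriv (m, 0) f p = 0" "mi_deriv (m, 0) g p = 0" by (simp_all add: cf_def)
    have "wderiv w u p = 0" if "u = f \<or> u = g" for u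
    proof -
      have su: "smooth_on \<Omega> u" using that f g by auto
      have "count_list w True + count_list w False = m" using count_list_True_False[of w] w(1) by simp
      from leading_coefficients[OF \<Omega>(1) p su van[OF that] this]
      show ?thesis using wderiv_eq_mi_deriv[OF \<Omega>(1) su p, of w] z that by auto
    qed
    then show False using w(2) by auto
  qed
  obtain Q where Q: "Q > 0" "\<And>x. x \<in> cball p s \<Longrightarrow> Dnorm (Suc m) f x \<le> Q" using Dnorm_bounded_cball[OF \<Omega>(2) f] by blast
  obtain Q' where Q': "Q' > 0" "\<And>x. x \<in> cball p s \<Longrightarrow> Dnorm (Suc m) g x \<le> Q'" using Dnorm_bounded_cball[OF \<Omega>(2) g] by blast
  define L where "L = (2 ^ Suc m) ^ Suc m * (Q + Q')"
  have L: "L > 0" using Q(1) Q'(1) by (simp add: L_def)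
  have lo: "(cf f + cf g - L * dist p z) * dist p z ^ m \<le> norm (f z) + norm (g z)" if z: "z \<in> cball p s" for z
  proof -
    have "Dnorm 0 (\<lambda>z. f z - taylor_poly p (Suc m) f z) z \<le> (2 ^ Suc m * dist p z) ^ (Suc m - 0) * Q"
      using z s by (intro taylor_remainder[OF \<Omega> f]) (auto intro!: Q simp del: Dnorm.simps)
    then have 1: "norm (f z - taylor_poly p (Suc m) f z) \<le> (2 ^ Suc m * dist p z) ^ Suc m * Q" by simp
    have "Dnorm 0 (\<lambda>z. g z - taylor_poly p (Suc m) g z) z \<le> (2 ^ Suc m * dist p z) ^ (Suc m - 0) * Q'"
      using z s by (intro taylor_remainder[OF \<Omega> g]) (auto intro!: Q' simp del: Dnorm.simps)
    then have 2: "norm (g z - taylor_poly p (Suc m) g z) \<le> (2 ^ Suc m * dist p z) ^ Suc m * Q'" by simp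
    have 3: "norm (taylor_poly p (Suc m) u z) = cf u * dist p z ^ m" if "u = f \<or> u = g" for u
      unfolding cf_def using that f g low by (intro taylor_poly_leading[OF \<Omega>(1) p _ _ van[OF that]]) auto
    have "cf f * dist p z ^ m \<le> norm (f z) + (2 ^ Suc m * dist p z) ^ Suc m * Q"
      using norm_triangle_sub[of "taylor_poly p (Suc m) f z" "f z"] 1 3[of f] by (simp add: norm_minus_commute)
    moreover have "cf g * dist p z ^ m \<le> norm (g z) + (2 ^ Suc m * dist p z) ^ Suc m * Q'"
      using norm_triangle_sub[of "taylor_poly p (Suc m) g z" "g z"] 2 3[of g] by (simp add: norm_minus_commute)
    moreover have "L * dist p z * dist p z ^ m = (2 ^ Suc m * dist p z) ^ Suc m * Q + (2 ^ Suc m * dist p z) ^ Suc m * Q'"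
      by (simp add: L_def power_mult_distrib algebra_simps)
    ultimately show ?thesis by (simp add: algebra_simps)
  qed
  \<comment> \<open>Within this radius the remainder takes at most half of the leading term.\<close>
  define r where "r = min s ((cf f + cf g) / (2 * L))"
  have r: "0 < r" "r \<le> s" "r \<le> (cf f + cf g) / (2 * L)" using s L \<open>cf f + cf g > 0\<close> by (simp_all add: r_def)
  show ?thesis
  proof (rule that[of "(cf f + cf g) / 2" C r m])
    fix z assume z: "z \<in> cball p r"
    then have zs: "z \<in> cball p s" using r by auto
    show "norm (f z) + norm (g z) \<le> C * dist p z ^ m" by (rule up[OF zs])
    have "L * dist p z \<le> L * ((cf f + cf g) / (2 * L))" using z r L by (intro mult_left_mono) auto
    also have "\<dots> = (cf f + cf g) / 2" using L by simp
    finally have "(cf f + cf g) / 2 * dist p z ^ m \<le> (cf f + cf g - L * dist p z) * dist p z ^ m"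
      by (intro mult_right_mono) auto
    then show "(cf f + cf g) / 2 * dist p z ^ m \<le> norm (f z) + norm (g z)" using lo[OF zs] by linarith
  qed (use r C \<open>cf f + cf g > 0\<close> in auto)
qed

subsection \<open>Zeros of finite order\<close>

text \<open>Written with conjugates instead of moduli, so that the rules for products of smooth
  functions apply.\<close>

definition dens :: "(plane \<Rightarrow> complex) \<Rightarrow> (plane \<Rightarrow> complex) \<Rightarrow> plane \<Rightarrow> complex" where
  "dens f g z = f z * cnj (f z) + g z * cnj (g z)"

definition quadr :: "real \<Rightarrow> real \<Rightarrow> (plane \<Rightarrow> complex) \<Rightarrow> (plane \<Rightarrow> complex) \<Rightarrow> plane \<Rightarrow> complex" where
  "quadr a b f g z = \<i> * (of_real a * (f z * cnj (f z)) + of_real b * (g z * cnj (g z)))"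

text \<open>The Dirac equation in the unknowns \<open>f = \<psi>\<^sub>2\<close> and \<open>g = cnj \<psi>\<^sub>1\<close>; conjugating one component turns both
  equations into \<open>dbar\<close>-equations. The ambient group only enters through \<open>a\<^sub>1, a\<^sub>2, b\<^sub>1, b\<^sub>2\<close>.\<close>

definition spin_system :: "(plane \<Rightarrow> complex) \<Rightarrow> (plane \<Rightarrow> complex) \<Rightarrow> (plane \<Rightarrow> complex) \<Rightarrow> bool" where
  "spin_system h f g \<longleftrightarrow> smooth_on unit_disk f \<and> smooth_on unit_disk g \<and>
     (\<exists>a1 a2 b1 b2. \<bar>a1\<bar> \<le> 2 \<and> \<bar>a2\<bar> \<le> 2 \<and> \<bar>b1\<bar> \<le> 2 \<and> \<bar>b2\<bar> \<le> 2 \<and>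
       (\<forall>z\<in>unit_disk.
          dbar f z = - (h z * (dens f g z * cnj (g z))) + quadr b1 b2 f g z * cnj (g z) \<and>
          dbar g z = h z * (dens f g z * cnj (f z)) + quadr a1 a2 f g z * cnj (f z)))"

lemma smooth_on_dens: "open \<Omega> \<Longrightarrow> smooth_on \<Omega> f \<Longrightarrow> smooth_on \<Omega> g \<Longrightarrow> smooth_on \<Omega> (dens f g)"
  unfolding dens_def[abs_def] by (intro smooth_on_add smooth_on_mult smooth_on_cnj)

lemma smooth_on_quadr: "open \<Omega> \<Longrightarrow> smooth_on \<Omega> f \<Longrightarrow> smooth_on \<Omega> g \<Longrightarrow> smooth_on \<Omega> (quadr a b f g)"
  unfolding quadr_def[abs_def] by (intro smooth_on_add smooth_on_mult smooth_on_cnj smooth_on_const)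

lemma dens_eq: "dens f g z = of_real ((norm (f z))\<^sup>2 + (norm (g z))\<^sup>2)"
  unfolding dens_def of_real_add complex_norm_square ..

lemma norm_dens_bounds:
  "norm (dens f g z) \<le> (norm (f z) + norm (g z))\<^sup>2" "(norm (f z) + norm (g z))\<^sup>2 \<le> 2 * norm (dens f g z)"
proof -
  have n: "norm (dens f g z) = (norm (f z))\<^sup>2 + (norm (g z))\<^sup>2"
    unfolding dens_eq norm_of_real by simp
  show "norm (dens f g z) \<le> (norm (f z) + norm (g z))\<^sup>2" unfolding n by (simp add: power2_sum)
  show "(norm (f z) + norm (g z))\<^sup>2 \<le> 2 * norm (dens f g z)"
    unfolding n using sum_squares_bound[of "norm (f z)" "norm (g z)"] by (simp add: power2_sum)
qed

lemma norm_quadr_le: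
  assumes "\<bar>a\<bar> \<le> 2" "\<bar>b\<bar> \<le> 2"
  shows "norm (quadr a b f g z) \<le> 2 * (norm (f z) + norm (g z))\<^sup>2"
proof -
  have "norm (quadr a b f g z) \<le> \<bar>a\<bar> * (norm (f z))\<^sup>2 + \<bar>b\<bar> * (norm (g z))\<^sup>2"
    unfolding quadr_def norm_mult norm_ii mult_1_left
    by (rule order_trans[OF norm_triangle_ineq]) (simp add: norm_mult power2_eq_square)
  also have "\<dots> \<le> 2 * (norm (f z))\<^sup>2 + 2 * (norm (g z))\<^sup>2" using assms by (intro add_mono mult_right_mono) auto
  also have "\<dots> \<le> 2 * (norm (f z) + norm (g z))\<^sup>2" by (simp add: power2_sum)
  finally show ?thesis .
qed

lemma spin_system_cubic_bound:
  assumes sys: "spin_system h f g" and z: "z \<in> unit_disk" and B: "norm (h z) \<le> B"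
  shows "norm (dbar f z) \<le> (B + 2) * (norm (f z) + norm (g z)) ^ 3"
    "norm (dbar g z) \<le> (B + 2) * (norm (f z) + norm (g z)) ^ 3"
proof -
  let ?s = "norm (f z) + norm (g z)"
  have B0: "0 \<le> B" using B norm_ge_zero order_trans by blast
  from sys obtain a1 a2 b1 b2 where c: "\<bar>a1\<bar> \<le> 2" "\<bar>a2\<bar> \<le> 2" "\<bar>b1\<bar> \<le> 2" "\<bar>b2\<bar> \<le> 2"
    and f: "dbar f z = - (h z * (dens f g z * cnj (g z))) + quadr b1 b2 f g z * cnj (g z)"
    and g: "dbar g z = h z * (dens f g z * cnj (f z)) + quadr a1 a2 f g z * cnj (f z)"
    unfolding spin_system_def using z by blast
  have 1: "norm (h z * (dens f g z * cnj (u z))) \<le> B * (?s\<^sup>2 * ?s)" if "norm (u z) \<le> ?s" for u :: "plane \<Rightarrow> complex"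
    unfolding norm_mult complex_mod_cnj
    using that B B0 norm_dens_bounds(1)[of f g z] by (intro mult_mono) auto
  have 2: "norm (quadr a b f g z * cnj (u z)) \<le> (2 * ?s\<^sup>2) * ?s" if "norm (u z) \<le> ?s" "\<bar>a\<bar> \<le> 2" "\<bar>b\<bar> \<le> 2"
    for u :: "plane \<Rightarrow> complex" and a b
    unfolding norm_mult complex_mod_cnj
    using that norm_quadr_le[OF that(2,3)] by (intro mult_mono) auto
  have e: "B * (?s\<^sup>2 * ?s) + (2 * ?s\<^sup>2) * ?s = (B + 2) * ?s ^ 3"
    by (simp add: power2_eq_square power3_eq_cube distrib_right mult.assoc)
  show "norm (dbar f z) \<le> (B + 2) * ?s ^ 3"
    unfolding f using 1[of g] 2[of g b1 b2] c e
    by (intro order_trans[OF norm_triangle_ineq]) simp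
  show "norm (dbar g z) \<le> (B + 2) * ?s ^ 3"
    unfolding g using 1[of f] 2[of f a1 a2] c e
    by (intro order_trans[OF norm_triangle_ineq]) simp
qed

text \<open>At a zero of finite order of one solution, the equation expresses \<open>h\<close> as a quotient of smooth functions whose
  denominator vanishes like a power of the distance.\<close>

definition conical_at :: "plane \<Rightarrow> real \<Rightarrow> (plane \<Rightarrow> complex) \<Rightarrow> bool" where
  "conical_at p r h \<longleftrightarrow> smooth_on (ball p r - {p}) h \<and>
     (\<forall>k. \<exists>B>0. \<forall>z\<in>ball p r - {p}. Dnorm k h z * dist p z ^ k \<le> B)"

text \<open>Induction on \<open>k\<close> with \<open>Dnorm_factor\<close>: the weights
  \<open>dist p z ^ i\<close> and \<open>dist p z ^ (k - i)\<close> of the two factors multiply to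
  \<open>dist p z ^ k\<close>, every term is O of \<open>dist p z ^ M\<close>, and this power
  cancels against the lower bound for \<open>v\<close>.\<close>

lemma conical_of_quotient:
  fixes h v F :: "plane \<Rightarrow> complex"
  assumes \<Omega>: "open \<Omega>" "cball p r \<subseteq> \<Omega>" and r: "r > 0" and v: "smooth_on \<Omega> v" and F: "smooth_on \<Omega> F"
    and eq: "\<And>z. z \<in> \<Omega> \<Longrightarrow> h z * v z = F z"
    and lo: "\<And>z. z \<in> cball p r \<Longrightarrow> c * dist p z ^ M \<le> norm (v z)" and c: "c > 0"
    and up: "\<And>z. z \<in> cball p r \<Longrightarrow> norm (v z) \<le> C * dist p z ^ M"
    and upF: "\<And>z. z \<in> cball p r \<Longrightarrow> norm (F z) \<le> C' * dist p z ^ M"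
  shows "conical_at p r h"
proof -
  let ?U = "ball p r - {p}"
  have U: "open ?U" by auto
  have sub: "?U \<subseteq> \<Omega>" "?U \<subseteq> cball p r" using \<Omega>(2) ball_subset_cball by fastforce+
  have nz: "v z \<noteq> 0" if "z \<in> ?U" for z
  proof -
    have "0 < c * dist p z ^ M" using that c by auto
    moreover have "z \<in> cball p r" using that by auto
    ultimately have "0 < norm (v z)" using lo less_le_trans by blast
    then show ?thesis by simp
  qed
  have "smooth_on ?U (\<lambda>z. F z * inverse (v z))"
    by (intro smooth_on_mult[OF U] smooth_on_inverse[OF U nz] smooth_on_subset[OF F sub(1)] smooth_on_subset[OF v sub(1)])
  moreover have "F z * inverse (v z) = h z" if "z \<in> ?U" for z
    using eq[of z] nz[OF that] that sub by (simp add: field_simps subset_eq)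
  ultimately have h: "smooth_on ?U h" using smooth_on_cong[OF U, of "\<lambda>z. F z * inverse (v z)" h] by blast
  have "\<exists>B>0. \<forall>z\<in>?U. Dnorm k h z * dist p z ^ k \<le> B" for k
  proof (induction k rule: less_induct)
    case (less k)
    then obtain B where B: "\<And>i. i < k \<Longrightarrow> B i > 0" "\<And>i z. i < k \<Longrightarrow> z \<in> ?U \<Longrightarrow> Dnorm i h z * dist p z ^ i \<le> B i"
      by metis
    obtain BF where BF: "BF > 0" "\<And>z. z \<in> cball p r \<Longrightarrow> Dnorm k F z * dist p z ^ k \<le> BF * dist p z ^ M"
      using bigo_derivs[OF \<Omega> F r upF, of k] by blast
    have "\<exists>V. \<forall>i. V i > 0 \<and> (\<forall>z\<in>cball p r. Dnorm i v z * dist p z ^ i \<le> V i * dist p z ^ M)"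
      using bigo_derivs[OF \<Omega> v r up] by metis
    then obtain V where V: "\<And>i. V i > 0" "\<And>i z. z \<in> cball p r \<Longrightarrow> Dnorm i v z * dist p z ^ i \<le> V i * dist p z ^ M"
      by blast
    define A where "A = 2 ^ k * (BF + 2 ^ k * (\<Sum>i<k. B i * V (k - i)))"
    have A: "A > 0" unfolding A_def using BF(1) B(1) V(1)
      by (intro mult_pos_pos add_pos_nonneg mult_nonneg_nonneg sum_nonneg) (auto intro: less_imp_le)
    have "Dnorm k h z * dist p z ^ k \<le> A / c" if z: "z \<in> ?U" for z
    proof -
      let ?d = "dist p z"
      have zc: "z \<in> cball p r" and d: "?d > 0" using z by auto
      have hF: "Dnorm k (\<lambda>z. h z * v z) z = Dnorm k F z"
        by (rule Dnorm_cong[OF U _ z]) (use eq sub in auto)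
      have "Dnorm k h z * norm (v z) \<le> 2 ^ k * (Dnorm k F z + 2 ^ k * (\<Sum>i<k. Dnorm i h z * Dnorm (k - i) v z))"
        using Dnorm_factor[OF U z h smooth_on_subset[OF v sub(1)], of k] unfolding hF .
      then have "Dnorm k h z * norm (v z) * ?d ^ k
        \<le> 2 ^ k * (Dnorm k F z + 2 ^ k * (\<Sum>i<k. Dnorm i h z * Dnorm (k - i) v z)) * ?d ^ k"
        by (rule mult_right_mono) simp
      also have "\<dots> = 2 ^ k * (Dnorm k F z * ?d ^ k + 2 ^ k * (\<Sum>i<k. (Dnorm i h z * ?d ^ i) * (Dnorm (k - i) v z * ?d ^ (k - i))))"
      proof -
        have "(\<Sum>i<k. Dnorm i h z * Dnorm (k - i) v z) * ?d ^ k = (\<Sum>i<k. (Dnorm i h z * ?d ^ i) * (Dnorm (k - i) v z * ?d ^ (k - i)))"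
          unfolding sum_distrib_right
        proof (rule sum.cong)
          fix i assume "i \<in> {..<k}"
          then have "?d ^ k = ?d ^ i * ?d ^ (k - i)" by (simp flip: power_add)
          then show "Dnorm i h z * Dnorm (k - i) v z * ?d ^ k = (Dnorm i h z * ?d ^ i) * (Dnorm (k - i) v z * ?d ^ (k - i))"
            by (simp add: mult_ac)
        qed simp
        then show ?thesis by (simp add: distrib_right mult.assoc)
      qed
      also have "\<dots> \<le> 2 ^ k * (BF * ?d ^ M + 2 ^ k * (\<Sum>i<k. B i * (V (k - i) * ?d ^ M)))"
      proof -
        have "Dnorm i h z * ?d ^ i * (Dnorm (k - i) v z * ?d ^ (k - i)) \<le> B i * (V (k - i) * ?d ^ M)" if "i < k" for i
          by (rule mult_mono[OF B(2)[OF that z] V(2)[OF zc] less_imp_le[OF B(1)[OF that]]]) simp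
        then have "(\<Sum>i<k. Dnorm i h z * ?d ^ i * (Dnorm (k - i) v z * ?d ^ (k - i))) \<le> (\<Sum>i<k. B i * (V (k - i) * ?d ^ M))"
          by (intro sum_mono) simp
        then show ?thesis using BF(2)[OF zc] by (intro mult_left_mono add_mono) auto
      qed
      also have "\<dots> = A * ?d ^ M" by (simp add: A_def sum_distrib_left sum_distrib_right algebra_simps)
      finally have 1: "Dnorm k h z * norm (v z) * ?d ^ k \<le> A * ?d ^ M" .
      have "(Dnorm k h z * ?d ^ k) * (c * ?d ^ M) \<le> (Dnorm k h z * ?d ^ k) * norm (v z)"
        by (intro mult_left_mono lo[OF zc]) auto
      also have "\<dots> \<le> A * ?d ^ M" using 1 by (simp add: mult_ac)
      finally have "(Dnorm k h z * ?d ^ k * c) * ?d ^ M \<le> A * ?d ^ M" by (simp add: mult_ac)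
      then have "Dnorm k h z * ?d ^ k * c \<le> A" using d by simp
      then show ?thesis using c by (simp add: field_simps)
    qed
    then show ?case using A c by (intro exI[of _ "A / c"]) auto
  qed
  then show ?thesis unfolding conical_at_def using h by blast
qed

text \<open>Multiplying the equation for \<open>g\<close> by \<open>f\<close>, that for
  \<open>f\<close> by \<open>g\<close>, and subtracting turns the two \<open>h\<close>-terms into
  \<open>h\<close> times the square of \<open>dens\<close>, which near \<open>p\<close> can vanish
  at most at \<open>p\<close>.\<close>

lemma spin_system_conical:
  assumes sys: "spin_system h f g" and p: "p \<in> unit_disk" and hB: "\<And>z. z \<in> unit_disk \<Longrightarrow> norm (h z) \<le> B"
    and nonflat: "\<exists>w. wderiv w f p \<noteq> 0 \<or> wderiv w g p \<noteq> 0"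
  shows "\<exists>r>0. cball p r \<subseteq> unit_disk \<and> conical_at p r h"
proof -
  have D: "open unit_disk" by simp
  from sys obtain a1 a2 b1 b2 where f: "smooth_on unit_disk f" and g: "smooth_on unit_disk g"
    and ef: "\<And>z. z \<in> unit_disk \<Longrightarrow> dbar f z = - (h z * (dens f g z * cnj (g z))) + quadr b1 b2 f g z * cnj (g z)"
    and eg: "\<And>z. z \<in> unit_disk \<Longrightarrow> dbar g z = h z * (dens f g z * cnj (f z)) + quadr a1 a2 f g z * cnj (f z)"
    unfolding spin_system_def by blast
  obtain s where s: "s > 0" "cball p s \<subseteq> unit_disk" using p open_contains_cball[of unit_disk] by (meson open_ball)
  have B0: "0 \<le> B" by (rule order_trans[OF norm_ge_zero hB[OF p]])
  obtain Sf where Sf: "Sf > 0" "\<And>x. x \<in> cball p s \<Longrightarrow> Dnorm 0 f x \<le> Sf" using Dnorm_bounded_cball[OF s(2) f] by blast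
  obtain Sg where Sg: "Sg > 0" "\<And>x. x \<in> cball p s \<Longrightarrow> Dnorm 0 g x \<le> Sg" using Dnorm_bounded_cball[OF s(2) g] by blast
  \<comment> \<open>On the compact ball the solution is bounded, so the cubic right-hand side is at
    most linear in the solution, as \<open>finite_order_vanishing\<close> demands.\<close>
  define K where "K = (B + 2) * (Sf + Sg)\<^sup>2"
  have K: "K \<ge> 0" using B0 by (simp add: K_def)
  have lin: "(B + 2) * (norm (f z) + norm (g z)) ^ 3 \<le> K * (norm (f z) + norm (g z))" if z: "z \<in> cball p s" for z
  proof -
    have "(norm (f z) + norm (g z))\<^sup>2 \<le> (Sf + Sg)\<^sup>2" using Sf(2)[OF z] Sg(2)[OF z] by (intro power_mono) auto
    then have "(B + 2) * ((norm (f z) + norm (g z))\<^sup>2 * (norm (f z) + norm (g z))) \<le> (B + 2) * ((Sf + Sg)\<^sup>2 * (norm (f z) + norm (g z)))"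
      using B0 by (intro mult_left_mono mult_right_mono) auto
    then show ?thesis by (simp add: K_def power3_eq_cube power2_eq_square mult.assoc)
  qed
  have zD: "z \<in> unit_disk" if "z \<in> cball p s" for z using that s by blast
  obtain m c C r where r: "0 < c" "0 < C" "0 < r" "r \<le> s"
    and lo: "\<And>z. z \<in> cball p r \<Longrightarrow> c * dist p z ^ m \<le> norm (f z) + norm (g z)"
    and up: "\<And>z. z \<in> cball p r \<Longrightarrow> norm (f z) + norm (g z) \<le> C * dist p z ^ m"
    by (rule finite_order_vanishing[OF D s(2,1) f g K _ _ nonflat])
      (use order_trans[OF spin_system_cubic_bound(1)[OF sys zD hB[OF zD]] lin]
         order_trans[OF spin_system_cubic_bound(2)[OF sys zD hB[OF zD]] lin] in auto)
  have rD: "cball p r \<subseteq> unit_disk" using r(4) s(2) by (meson order_trans subset_cball)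
  let ?v = "\<lambda>z. dens f g z * dens f g z"
  let ?F = "\<lambda>z. f z * (dbar g z - quadr a1 a2 f g z * cnj (f z)) - g z * (dbar f z - quadr b1 b2 f g z * cnj (g z))"
  note sm = smooth_on_dens[OF D f g] smooth_on_quadr[OF D f g] smooth_on_dbar[OF D f] smooth_on_dbar[OF D g]
    smooth_on_cnj[OF D f] smooth_on_cnj[OF D g] f g
  have eq: "h z * ?v z = ?F z" if "z \<in> unit_disk" for z
    unfolding ef[OF that] eg[OF that] by (simp add: dens_def algebra_simps)
  \<comment> \<open>\<open>dens\<close> is comparable to the power \<open>2 * m\<close> of the
    distance, and its square to the power \<open>4 * m\<close>.\<close>
  have pow4: "(C * dist p z ^ m) ^ 4 = C ^ 4 * dist p z ^ (4 * m)" "(c * dist p z ^ m) ^ 4 = c ^ 4 * dist p z ^ (4 * m)" for z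
    by (simp_all add: power_mult_distrib mult.commute flip: power_mult)
  have vup: "norm (?v z) \<le> C ^ 4 * dist p z ^ (4 * m)" if z: "z \<in> cball p r" for z
  proof -
    have "norm (?v z) \<le> (norm (f z) + norm (g z))\<^sup>2 * (norm (f z) + norm (g z))\<^sup>2"
      unfolding norm_mult by (intro mult_mono norm_dens_bounds) auto
    also have "\<dots> = (norm (f z) + norm (g z)) ^ 4" by (simp flip: power_add)
    also have "\<dots> \<le> (C * dist p z ^ m) ^ 4" using up[OF z] by (intro power_mono) auto
    finally show ?thesis by (simp only: pow4)
  qed
  have "conical_at p r h"
  proof (rule conical_of_quotient[OF D rD r(3) _ _ eq])
    show "smooth_on unit_disk ?v" by (intro smooth_on_mult[OF D] sm)
    show "smooth_on unit_disk ?F" by (intro smooth_on_mult[OF D] smooth_on_diff[OF D] sm)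
    show "c ^ 4 / 4 * dist p z ^ (4 * m) \<le> norm (?v z)" if z: "z \<in> cball p r" for z
    proof -
      have "(c * dist p z ^ m) ^ 4 \<le> (norm (f z) + norm (g z)) ^ 4" using lo[OF z] r by (intro power_mono) auto
      also have "\<dots> = (norm (f z) + norm (g z))\<^sup>2 * (norm (f z) + norm (g z))\<^sup>2" by (simp flip: power_add)
      also have "\<dots> \<le> (2 * norm (dens f g z)) * (2 * norm (dens f g z))" by (intro mult_mono norm_dens_bounds) auto
      finally show ?thesis unfolding pow4 by (simp add: norm_mult)
    qed
    show "norm (?v z) \<le> C ^ 4 * dist p z ^ (4 * m)" if z: "z \<in> cball p r" for z by (rule vup[OF z])
    show "norm (?F z) \<le> B * C ^ 4 * dist p z ^ (4 * m)" if z: "z \<in> cball p r" for z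
    proof -
      have zD: "z \<in> unit_disk" using z rD by blast
      have "norm (?F z) = norm (h z) * norm (?v z)" using eq[OF zD] by (metis norm_mult)
      also have "\<dots> \<le> B * (C ^ 4 * dist p z ^ (4 * m))" using hB[OF zD] vup[OF z] B0 by (intro mult_mono) auto
      finally show ?thesis by (simp add: mult.assoc)
    qed
    show "c ^ 4 / 4 > 0" using r by simp
  qed
  then show ?thesis using r(3) rD by blast
qed

subsection \<open>Zeros of infinite order\<close>

definition cplx_diff :: "plane \<Rightarrow> plane \<Rightarrow> complex" where
  "cplx_diff p z = Complex (fst z - fst p) (snd z - snd p)"

lemma cplx_diff_self [simp]: "cplx_diff p p = 0"
  by (simp add: cplx_diff_def complex_eq_iff)

lemma norm_cplx_diff: "norm (cplx_diff p z) = dist p z"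
  by (simp add: cplx_diff_def complex_norm dist_norm norm_prod_def power2_commute)

lemma has_derivative_cplx_diff: "(cplx_diff p has_derivative (\<lambda>h. Complex (fst h) (snd h))) (at z)"
  unfolding cplx_diff_def[abs_def] Complex_eq by (auto intro!: derivative_eq_intros)

lemma partial_deriv_cplx_diff: "partial_deriv v (cplx_diff p) z = Complex (fst v) (snd v)"
  by (rule partial_deriv_at[OF has_derivative_cplx_diff])

lemma smooth_on_cplx_diff: "smooth_on \<Omega> (cplx_diff p)"
proof -
  have "Ck_on k \<Omega> (cplx_diff p)" for k
  proof (cases k)
    case 0
    show ?thesis unfolding 0 Ck_on.simps
      by (intro continuous_at_imp_continuous_on ballI has_derivative_continuous[OF has_derivative_cplx_diff])
  next
    case (Suc j)
    then show ?thesis using differentiableI[OF has_derivative_cplx_diff] by (simp add: partial_deriv_cplx_diff[abs_def])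
  qed
  then show ?thesis by (simp add: smooth_on_def)
qed

lemma smooth_on_power:
  fixes u :: "plane \<Rightarrow> complex"
  shows "open \<Omega> \<Longrightarrow> smooth_on \<Omega> u \<Longrightarrow> smooth_on \<Omega> (\<lambda>z. u z ^ n)"
  by (induction n) (auto intro: smooth_on_mult)

lemma dbar_mult:
  assumes "u differentiable (at z)" "v differentiable (at z)"
  shows "dbar (\<lambda>z. u z * v z) z = dbar u z * v z + u z * dbar v z"
  unfolding dbar_def partial_deriv_bilinear[OF bounded_bilinear_mult assms] by (simp add: algebra_simps)

lemma dbar_cong:
  "open \<Omega> \<Longrightarrow> z \<in> \<Omega> \<Longrightarrow> (\<And>x. x \<in> \<Omega> \<Longrightarrow> u x = v x) \<Longrightarrow> dbar u z = dbar v z"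
  unfolding dbar_def using partial_deriv_cong[of \<Omega> z u v] by simp

lemma dbar_cplx_diff_power: "dbar (\<lambda>z. cplx_diff p z ^ n) z = 0"
proof (induction n)
  case 0 then show ?case by (simp add: dbar_def)
next
  case (Suc n)
  have d: "(\<lambda>z. cplx_diff p z ^ k) differentiable (at z)" for k
    using smooth_on_differentiable[OF smooth_on_power[OF open_UNIV smooth_on_cplx_diff[of UNIV p]]] by simp
  have "dbar (cplx_diff p) z = 0" by (simp add: dbar_def partial_deriv_cplx_diff complex_eq_iff)
  then show ?case using dbar_mult[OF d[of 1] d[of n]] Suc by simp
qed

lemma norm_partial_deriv_le_Dnorm:
  assumes "u differentiable (at z)"
  shows "norm (partial_deriv v u z) \<le> norm v * Dnorm 1 u z"
proof -
  have "norm (partial_deriv v u z) \<le> \<bar>fst v\<bar> * norm (deriv_x u z) + \<bar>snd v\<bar> * norm (deriv_y u z)"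
    unfolding partial_deriv_eq_coords[OF assms, of v] by (rule order_trans[OF norm_triangle_ineq]) simp
  also have "\<dots> \<le> norm v * norm (deriv_x u z) + norm v * norm (deriv_y u z)"
    using norm_fst_le[of "fst v" "snd v"] norm_snd_le[of "snd v" "fst v"] by (intro add_mono mult_right_mono) auto
  also have "\<dots> = norm v * Dnorm 1 u z" by (simp add: algebra_simps)
  finally show ?thesis .
qed

text \<open>A conical function is bounded and its gradient is O of the inverse distance. The square
  of \<open>cplx_diff\<close> outweighs both, so the product and its derivatives tend to 0 at
  \<open>p\<close>. This is the regularity needed for averaging across \<open>p\<close>.\<close>

lemma C1_of_conical:
  assumes h: "conical_at p s h" and s: "s > 0"
  defines "u \<equiv> \<lambda>z. cplx_diff p z ^ 2 * h z"
  shows "Ck_on 1 (ball p s) u" "dbar u p = 0"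
proof -
  let ?U = "ball p s - {p}"
  have U: "open ?U" by auto
  from h have sm: "smooth_on ?U h" unfolding conical_at_def by blast
  obtain B0 where B0: "B0 > 0" "\<And>z. z \<in> ?U \<Longrightarrow> Dnorm 0 h z * dist p z ^ 0 \<le> B0"
    using h unfolding conical_at_def by blast
  obtain B1 where B1: "B1 > 0" "\<And>z. z \<in> ?U \<Longrightarrow> Dnorm 1 h z * dist p z ^ 1 \<le> B1"
    using h unfolding conical_at_def by blast
  note Z = smooth_on_power[OF U smooth_on_cplx_diff, of p 2]
  have su: "smooth_on ?U u" unfolding u_def by (rule smooth_on_mult[OF U Z sm])
  have u_le: "norm (u z) \<le> B0 * (dist p z)\<^sup>2" if "z \<in> ball p s" for z
  proof (cases "z = p")
    case True then show ?thesis by (simp add: u_def)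
  next
    case False
    then have "norm (h z) \<le> B0" using B0(2)[of z] that by simp
    then show ?thesis by (simp add: u_def norm_mult norm_power norm_cplx_diff mult.commute mult_right_mono)
  qed
  have du: "(u has_derivative (\<lambda>v. 0)) (at p)"
    unfolding has_derivative_at_within
  proof (intro conjI)
    have u0: "u p = 0" by (simp add: u_def)
    have "((\<lambda>y. norm (u y) / norm (y - p)) \<longlongrightarrow> 0) (at p)"
    proof (rule Lim_null_comparison)
      show "\<forall>\<^sub>F y in at p. norm (norm (u y) / norm (y - p)) \<le> B0 * norm (y - p)"
        unfolding eventually_at
      proof (intro exI[of _ s] conjI ballI impI)
        fix y assume "y \<noteq> p \<and> dist y p < s"
        then have "norm (u y) \<le> B0 * (norm (y - p))\<^sup>2" using u_le[of y] by (simp add: dist_norm norm_minus_commute)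
        then show "norm (norm (u y) / norm (y - p)) \<le> B0 * norm (y - p)"
          using \<open>y \<noteq> p \<and> dist y p < s\<close> by (simp add: field_simps power2_eq_square)
      qed (rule s)
      have "((\<lambda>y. B0 * norm (y - p)) \<longlongrightarrow> B0 * norm (p - p)) (at p)" by (intro tendsto_intros)
      then show "((\<lambda>y. B0 * norm (y - p)) \<longlongrightarrow> 0) (at p)" by simp
    qed
    then have "((\<lambda>y. inverse (norm (y - p)) *\<^sub>R u y) \<longlongrightarrow> 0) (at p)"
      by (subst tendsto_norm_zero_iff[symmetric]) (simp add: divide_inverse mult.commute)
    then show "((\<lambda>y. (u y - u p - 0) /\<^sub>R norm (y - p)) \<longlongrightarrow> 0) (at p)" by (simp add: u0)
  qed simp
  have pu0: "partial_deriv v u p = 0" for v by (rule partial_deriv_at[OF du])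
  then show "dbar u p = 0" by (simp add: dbar_def)
  obtain A where A: "\<And>z. z \<in> cball p s \<Longrightarrow> Dnorm 1 (\<lambda>z. cplx_diff p z ^ 2) z * dist p z ^ 1 \<le> A * dist p z ^ 2" "A > 0"
  proof -
    have "\<exists>A>0. \<forall>z\<in>cball p s. Dnorm 1 (\<lambda>z. cplx_diff p z ^ 2) z * dist p z ^ 1 \<le> A * dist p z ^ 2"
      by (rule bigo_derivs[OF open_UNIV subset_UNIV smooth_on_power[OF open_UNIV smooth_on_cplx_diff] s, where C = 1])
        (simp add: norm_power norm_cplx_diff)
    then show ?thesis using that by blast
  qed
  have diff: "u differentiable (at z)" if "z \<in> ball p s" for z
    using that smooth_on_differentiable[OF su, of z] differentiableI[OF du] by (cases "z = p") auto
  have pd_le: "norm (partial_deriv v u z) \<le> norm v * (2 * (B1 + A * B0)) * dist p z" if z: "z \<in> ?U" for v z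
  proof -
    have d: "dist p z > 0" and zc: "z \<in> cball p s" using z by auto
    have "Dnorm 1 (\<lambda>z. cplx_diff p z ^ 2) z * dist p z \<le> (A * dist p z) * dist p z" using A(1)[OF zc] by (simp add: power2_eq_square mult.assoc)
    then have Az: "Dnorm 1 (\<lambda>z. cplx_diff p z ^ 2) z \<le> A * dist p z" using d by simp
    have "Dnorm 1 u z \<le> 2 ^ 1 * (\<Sum>i\<le>1. Dnorm i (\<lambda>z. cplx_diff p z ^ 2) z * Dnorm (1 - i) h z)"
      unfolding u_def by (rule Dnorm_mult[OF U z Z sm])
    also have "\<dots> = 2 * ((dist p z)\<^sup>2 * Dnorm 1 h z + Dnorm 1 (\<lambda>z. cplx_diff p z ^ 2) z * norm (h z))"
      by (simp add: norm_power norm_cplx_diff)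
    also have "\<dots> \<le> 2 * (dist p z * B1 + (A * dist p z) * B0)"
    proof -
      have "(dist p z)\<^sup>2 * Dnorm 1 h z = dist p z * (Dnorm 1 h z * dist p z ^ 1)" by (simp add: power2_eq_square mult_ac)
      also have "\<dots> \<le> dist p z * B1" by (intro mult_left_mono B1(2)[OF z]) auto
      finally have 1: "(dist p z)\<^sup>2 * Dnorm 1 h z \<le> dist p z * B1" .
      have 2: "Dnorm 1 (\<lambda>z. cplx_diff p z ^ 2) z * norm (h z) \<le> (A * dist p z) * B0"
        using Az B0(2)[OF z] A(2) by (intro mult_mono) auto
      show ?thesis by (intro mult_left_mono add_mono 1 2) auto
    qed
    finally have "norm v * Dnorm 1 u z \<le> norm v * (2 * (dist p z * B1 + (A * dist p z) * B0))"
      by (intro mult_left_mono) auto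
    also have "\<dots> = norm v * (2 * (B1 + A * B0)) * dist p z" by (simp only: distrib_left distrib_right mult_ac)
    finally show ?thesis
      using norm_partial_deriv_le_Dnorm[OF diff, of z v] z by simp
  qed
  have "continuous_on (ball p s) (partial_deriv v u)" for v
  proof -
    have "isCont (partial_deriv v u) z" if "z \<in> ball p s" for z
    proof (cases "z = p")
      case False
      then show ?thesis using that smooth_on_continuous[OF smooth_on_partial_deriv[OF su, of v]] U
        by (simp add: continuous_on_eq_continuous_at)
    next
      case True
      have "(partial_deriv v u \<longlongrightarrow> 0) (at p)"
      proof (rule Lim_null_comparison)
        show "\<forall>\<^sub>F z in at p. norm (partial_deriv v u z) \<le> norm v * (2 * (B1 + A * B0)) * dist p z"
          unfolding eventually_at
          by (rule exI[of _ s]) (use s pd_le in \<open>auto simp: dist_commute\<close>)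
        have "((\<lambda>z. norm v * (2 * (B1 + A * B0)) * dist p z) \<longlongrightarrow> norm v * (2 * (B1 + A * B0)) * dist p p) (at p)"
          by (intro tendsto_intros)
        then show "((\<lambda>z. norm v * (2 * (B1 + A * B0)) * dist p z) \<longlongrightarrow> 0) (at p)" by simp
      qed
      then show ?thesis using True by (simp add: isCont_def pu0)
    qed
    then show ?thesis by (simp add: continuous_at_imp_continuous_on)
  qed
  then show "Ck_on 1 (ball p s) u" using diff by simp
qed

lemma quotient_power_cancel:
  assumes "Z \<noteq> (0::complex)"
  shows "Z ^ 2 * (a * inverse (Z ^ (n + 2))) * Z ^ n = a"
proof -
  have "Z ^ (n + 2) = Z ^ 2 * Z ^ n" unfolding power_add by (rule mult.commute)
  then have "Z ^ 2 * (a * inverse (Z ^ (n + 2))) * Z ^ n = a * (inverse (Z ^ 2 * Z ^ n) * (Z ^ 2 * Z ^ n))"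
    by (simp only: mult_ac)
  also have "\<dots> = a" using assms by (subst left_inverse) simp_all
  finally show ?thesis .
qed

text \<open>Division by \<open>(z - p)\<^sup>n\<close> commutes with \<open>dbar\<close>, so the mean value inequality for the quotients holds
  uniformly in \<open>n\<close>; as the kernel lives on an annulus, it bounds the maximum of the quotients on a
  small disk by their values outside of it.\<close>

proposition flat_imp_zero:
  fixes f g :: "plane \<Rightarrow> complex"
  assumes \<Omega>: "open \<Omega>" "cball p (10 * \<rho>) \<subseteq> \<Omega>" and \<rho>: "\<rho> > 0"
    and f: "smooth_on \<Omega> f" and g: "smooth_on \<Omega> g"
    and df: "\<And>z. z \<in> cball p (10 * \<rho>) \<Longrightarrow> norm (dbar f z) \<le> K * (norm (f z) + norm (g z))"
    and dg: "\<And>z. z \<in> cball p (10 * \<rho>) \<Longrightarrow> norm (dbar g z) \<le> K * (norm (f z) + norm (g z))"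
    and K: "K \<ge> 0" and small: "64 * \<rho> * K \<le> kern_mass"
    and flat: "\<And>w. wderiv w f p = 0 \<and> wderiv w g p = 0" and z: "z \<in> ball p \<rho>"
  shows "f z = 0 \<and> g z = 0"
proof -
  define R where "R = 10 * \<rho>"
  have R: "R > 0" using \<rho> by (simp add: R_def)
  have sub: "cball p R \<subseteq> \<Omega>" using \<Omega>(2) by (simp add: R_def)
  have p: "p \<in> \<Omega>" using sub R by auto
  obtain Sf where Sf: "Sf > 0" "\<And>x. x \<in> cball p R \<Longrightarrow> Dnorm 0 f x \<le> Sf" using Dnorm_bounded_cball[OF sub f] by blast
  obtain Sg where Sg: "Sg > 0" "\<And>x. x \<in> cball p R \<Longrightarrow> Dnorm 0 g x \<le> Sg" using Dnorm_bounded_cball[OF sub g] by blast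
  define S where "S = Sf + Sg"
  have S: "S > 0" "norm (f x) + norm (g x) \<le> S" if "x \<in> cball p R" for x
    using Sf(1) Sg(1) Sf(2)[OF that] Sg(2)[OF that] by (auto simp: S_def)
  have S0: "S > 0" using Sf(1) Sg(1) by (simp add: S_def)
  define c0 where "c0 = kern_mass"
  have c0: "c0 > 0" using kern_mass_pos by (simp add: c0_def)
  define A where "A = 2 * (8 + c0) / c0"
  have key: "norm (f x) + norm (g x) \<le> A * S * (dist p x / \<rho>) ^ n" if x: "x \<in> ball p \<rho>" for x n
  proof -
    \<comment> \<open>Away from \<open>p\<close>, \<open>q u\<close> below is \<open>u\<close>
      divided by the \<open>n\<close>-th power of \<open>z - p\<close>. It is split into a square
      and a quotient by the power \<open>n + 2\<close>, because flatness makes that quotient conical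
      and \<open>C1_of_conical\<close> then gives class C^1 across \<open>p\<close>.\<close>
    define h where "h u x = u x * inverse (cplx_diff p x ^ (n + 2))" for u :: "plane \<Rightarrow> complex" and x
    define q where "q u x = cplx_diff p x ^ 2 * h u x" for u :: "plane \<Rightarrow> complex" and x
    have con: "conical_at p R (h u)" if u: "u = f \<or> u = g" for u
    proof -
      have su: "smooth_on \<Omega> u" and fl: "\<And>w. wderiv w u p = 0" using u f g flat by auto
      obtain T where T: "T > 0" "\<And>x. x \<in> cball p R \<Longrightarrow> Dnorm (n + 2) u x \<le> T" using Dnorm_bounded_cball[OF sub su] by blast
      show ?thesis
      proof (rule conical_of_quotient[OF \<Omega>(1) sub R _ su, where v = "\<lambda>x. cplx_diff p x ^ (n + 2)" and c = 1 and M = "n + 2" and C = 1])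
        show "smooth_on \<Omega> (\<lambda>x. cplx_diff p x ^ (n + 2))" by (rule smooth_on_power[OF \<Omega>(1) smooth_on_cplx_diff])
        show "h u x * cplx_diff p x ^ (n + 2) = u x" for x
        proof (cases "x = p")
          case True then show ?thesis using fl[of "[]"] by (simp add: h_def)
        next
          case False
          then have "cplx_diff p x \<noteq> 0" using norm_cplx_diff[of p x] by auto
          then have "cplx_diff p x ^ (n + 2) \<noteq> 0" by simp
          then show ?thesis unfolding h_def mult.assoc by (subst left_inverse) simp_all
        qed
        show "norm (u x) \<le> ((2 ^ (n + 2)) ^ (n + 2) * T) * dist p x ^ (n + 2)" if "x \<in> cball p R" for x
        proof -
          have "Dnorm (n + 2 - (n + 2)) u x \<le> (2 ^ (n + 2) * dist p x) ^ (n + 2) * T"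
            using that by (intro taylor_vanishing[OF \<Omega>(1) sub su fl]) (auto intro!: T simp del: Dnorm.simps add_2_eq_Suc')
          then have "norm (u x) \<le> (2 ^ (n + 2) * dist p x) ^ (n + 2) * T" by simp
          then show ?thesis by (simp only: power_mult_distrib mult_ac)
        qed
      qed (auto simp: norm_cplx_diff norm_power simp del: power_Suc)
    qed
    have nq: "norm (q u x) * dist p x ^ n = norm (u x)" if "x \<noteq> p" for u x
    proof -
      have nz: "cplx_diff p x \<noteq> 0" using norm_cplx_diff[of p x] that by auto
      then have "q u x * cplx_diff p x ^ n = u x" unfolding q_def h_def by (rule quotient_power_cancel)
      then show ?thesis by (metis norm_mult norm_power norm_cplx_diff)
    qed
    have q0: "q u p = 0" for u by (simp add: q_def)
    have qC1: "Ck_on 1 (ball p R) (q u)" and qd0: "dbar (q u) p = 0" if u: "u = f \<or> u = g" for u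
      using C1_of_conical[OF con[OF u] R] unfolding q_def[abs_def] by auto
    have qdbar: "norm (dbar (q u) x) * dist p x ^ n = norm (dbar u x)" if u: "u = f \<or> u = g" and x: "x \<in> ball p R" "x \<noteq> p" for u x
    proof -
      let ?U = "ball p R - {p}"
      have U: "open ?U" "x \<in> ?U" using x by auto
      have d1: "q u differentiable (at x)" using qC1[OF u] x by simp
      have d2: "(\<lambda>z. cplx_diff p z ^ n) differentiable (at x)"
        using smooth_on_differentiable[OF smooth_on_power[OF open_UNIV smooth_on_cplx_diff[of UNIV p]]] by simp
      have "dbar u x = dbar (\<lambda>x. q u x * cplx_diff p x ^ n) x"
      proof (rule dbar_cong[OF U])
        fix y assume "y \<in> ?U"
        then have "cplx_diff p y \<noteq> 0" using norm_cplx_diff[of p y] by auto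
        then show "u y = q u y * cplx_diff p y ^ n" unfolding q_def h_def by (rule quotient_power_cancel[symmetric])
      qed
      also have "\<dots> = dbar (q u) x * cplx_diff p x ^ n"
        unfolding dbar_mult[OF d1 d2] dbar_cplx_diff_power by simp
      finally show ?thesis by (simp add: norm_mult norm_power norm_cplx_diff)
    qed
    define s where "s x = norm (q f x) + norm (q g x)" for x
    have s_eq: "s x * dist p x ^ n = norm (f x) + norm (g x)" if "x \<noteq> p" for x
      using nq[OF that] by (simp add: s_def distrib_right)
    have sd: "norm (dbar (q u) x) \<le> K * s x" if u: "u = f \<or> u = g" and x: "x \<in> ball p R" for u x
    proof (cases "x = p")
      case True then show ?thesis using qd0[OF u] K by (simp add: s_def q0)
    next
      case False
      have "norm (dbar (q u) x) * dist p x ^ n \<le> K * (norm (f x) + norm (g x))"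
        unfolding qdbar[OF u x False] using df[of x] dg[of x] u x by (auto simp: R_def)
      also have "\<dots> = (K * s x) * dist p x ^ n" using s_eq[OF False] by (simp add: mult.assoc)
      finally show ?thesis using False by simp
    qed
    have far: "s x \<le> S / \<rho> ^ n" if x: "x \<in> cball p R" "\<rho> \<le> dist p x" for x
    proof -
      have xp: "x \<noteq> p" using x \<rho> by auto
      have "s x * \<rho> ^ n \<le> s x * dist p x ^ n" using x \<rho> by (intro mult_left_mono power_mono) (auto simp: s_def)
      also have "\<dots> \<le> S" using s_eq[OF xp] S(2)[OF x(1)] by simp
      finally show ?thesis using \<rho> by (simp add: field_simps)
    qed
    have sc: "continuous_on (cball p \<rho>) s"
    proof -
      have "continuous_on (ball p R) (q u)" if "u = f \<or> u = g" for u using Ck_on_mono[OF qC1[OF that], of 0] by simp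
      then have "continuous_on (ball p R) s" unfolding s_def by (intro continuous_intros) auto
      then show ?thesis by (rule continuous_on_subset) (use \<rho> in \<open>auto simp: R_def\<close>)
    qed
    obtain z0 where z0: "z0 \<in> cball p \<rho>" "\<And>y. y \<in> cball p \<rho> \<Longrightarrow> s y \<le> s z0"
      using continuous_attains_sup[of "cball p \<rho>" s] sc \<rho> by fastforce
    define M where "M = s z0"
    define Q where "Q = S / \<rho> ^ n"
    have Q: "Q > 0" using S0 \<rho> by (simp add: Q_def)
    have M0: "M \<ge> 0" by (simp add: M_def s_def)
    have sMQ: "s y \<le> M + Q" if "y \<in> cball p R" for y
    proof (cases "dist p y \<le> \<rho>")
      case True then show ?thesis using z0(2)[of y] Q by (simp add: M_def)
    next
      case False then show ?thesis using far[of y] that M0 by (simp add: Q_def)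
    qed
    have bsub: "ball z0 (2 * (4 * \<rho>)) \<subseteq> ball p R"
    proof
      fix y assume "y \<in> ball z0 (2 * (4 * \<rho>))"
      then have "dist z0 y < 8 * \<rho>" "dist p z0 \<le> \<rho>" using z0(1) by simp_all
      then show "y \<in> ball p R" unfolding R_def mem_ball using dist_triangle[of p y z0] \<rho> by linarith
    qed
    \<comment> \<open>At scale \<open>4 * \<rho>\<close> the kernel lives at distances between
      \<open>2 * \<rho>\<close> and \<open>4 * \<rho>\<close> from \<open>z0\<close>, hence at
      distance at least \<open>\<rho>\<close> from \<open>p\<close>, where \<open>far\<close>
      applies. The ball of radius \<open>8 * \<rho>\<close> stays within radius
      \<open>10 * \<rho>\<close> of \<open>p\<close>.\<close>
    have mv: "c0 * norm (q u z0) \<le> 4 * Q + 16 * \<rho> * K * (M + Q)" if u: "u = f \<or> u = g" for u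
    proof -
      have C1: "Ck_on 1 (ball z0 (2 * (4 * \<rho>))) (q u)" by (rule Ck_on_subset[OF qC1[OF u] bsub])
      let ?I = "integral unit_square (\<lambda>w. kern w *\<^sub>R q u (z0 + (4 * \<rho>) *\<^sub>R w))"
      have "norm (?I - kern_mass *\<^sub>R q u z0) \<le> 4 * (K * (M + Q)) * (4 * \<rho>)"
      proof (rule averaging_bound[OF C1])
        fix y assume y: "y \<in> cball z0 (4 * \<rho>)"
        then have "y \<in> ball z0 (2 * (4 * \<rho>))" using \<rho> by simp
        then have yR: "y \<in> ball p R" using bsub by blast
        show "norm (dbar (q u) y) \<le> K * (M + Q)"
          using sd[OF u yR] mult_left_mono[OF sMQ[of y] K] yR by simp
      qed (use \<rho> in simp)
      moreover have "norm ?I \<le> 4 * Q"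
      proof (rule norm_integral_unit_square_le)
        have mem: "z0 + (4 * \<rho>) *\<^sub>R w \<in> ball z0 (2 * (4 * \<rho>))" if "w \<in> unit_square" for w
          using unit_square_norm[OF that] \<rho> by (simp add: dist_norm)
        show "continuous_on unit_square (\<lambda>w. kern w *\<^sub>R q u (z0 + (4 * \<rho>) *\<^sub>R w))"
          using \<rho> by (intro continuous_on_scaleR continuous_on_kern averaging_cont_comp[OF C1] averaging_cont[OF C1]) auto
        fix w assume w: "w \<in> unit_square"
        show "norm (kern w *\<^sub>R q u (z0 + (4 * \<rho>) *\<^sub>R w)) \<le> Q"
        proof (cases "norm w \<ge> 1 \<or> norm w \<le> 1/2")
          case True then show ?thesis using Q by (simp add: kern_eq_0)
        next
          case False
          let ?y = "z0 + (4 * \<rho>) *\<^sub>R w"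
          have "norm ((4 * \<rho>) *\<^sub>R w) \<ge> 4 * \<rho> * (1/2)" using False \<rho> unfolding norm_scaleR by (intro mult_mono) auto
          moreover have "norm ((4 * \<rho>) *\<^sub>R w) \<le> dist p ?y + dist p z0"
            using dist_triangle[of z0 ?y p] by (simp add: dist_norm norm_minus_commute)
          ultimately have "\<rho> \<le> dist p ?y" using z0(1) by simp
          moreover have "?y \<in> cball p R" using mem[OF w] bsub by fastforce
          ultimately have "s ?y \<le> Q" unfolding Q_def by (intro far)
          then have "norm (q u ?y) \<le> Q" using u by (auto simp: s_def intro: order_trans[rotated])
          then have "kern w * norm (q u ?y) \<le> 1 * Q" by (intro mult_mono) auto
          then show ?thesis by simp
        qed
      qed
      moreover have "norm (kern_mass *\<^sub>R q u z0) \<le> norm ?I + norm (?I - kern_mass *\<^sub>R q u z0)"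
        using norm_triangle_sub[of "kern_mass *\<^sub>R q u z0" ?I] by (simp only: norm_minus_commute)
      ultimately show ?thesis using kern_mass_pos by (simp add: c0_def algebra_simps)
    qed
    have "c0 * M = c0 * norm (q f z0) + c0 * norm (q g z0)" by (simp add: M_def s_def distrib_left)
    also have "\<dots> \<le> 8 * Q + 32 * \<rho> * K * (M + Q)" using mv[of f] mv[of g] by simp
    finally have a: "c0 * M \<le> 8 * Q + 32 * \<rho> * K * (M + Q)" .
    \<comment> \<open>By \<open>small\<close> at most half of \<open>c0 * (M + Q)\<close> is lost,
      so \<open>M\<close> is absorbed with a constant that does not depend on
      \<open>n\<close>.\<close>
    have "32 * \<rho> * K * (M + Q) \<le> c0 / 2 * (M + Q)"
      using small M0 Q by (intro mult_right_mono) (auto simp: c0_def)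
    also have "c0 / 2 * (M + Q) = (c0 * M + c0 * Q) / 2" by (simp add: distrib_left)
    finally have b: "32 * \<rho> * K * (M + Q) \<le> (c0 * M + c0 * Q) / 2" .
    have "m \<le> 16 * q + y" if "m \<le> 8 * q + x" "x \<le> (m + y) / 2" for m q x y :: real
      using that by (simp add: field_simps)
    from this[OF a b] have "c0 * M \<le> 16 * Q + c0 * Q" .
    also have "\<dots> \<le> (2 * (8 + c0)) * Q" using c0 Q by (simp add: distrib_right)
    finally have M: "M \<le> A * Q" using c0 by (simp add: A_def field_simps)
    show ?thesis
    proof (cases "x = p")
      case True
      then show ?thesis using flat[of "[]"] c0 S0 by (simp add: A_def)
    next
      case False
      have "norm (f x) + norm (g x) = s x * dist p x ^ n" using s_eq[OF False] by simp
      also have "\<dots> \<le> (A * Q) * dist p x ^ n" using z0(2)[of x] x M by (intro mult_right_mono) (auto simp: M_def)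
      also have "\<dots> = A * S * (dist p x / \<rho>) ^ n" by (simp add: Q_def power_divide)
      finally show ?thesis .
    qed
  qed
  \<comment> \<open>\<open>A\<close> and \<open>S\<close> do not depend on \<open>n\<close>, and the
    ratio is below 1 inside the small disk.\<close>
  have "(\<lambda>n. A * S * (dist p z / \<rho>) ^ n) \<longlonglongrightarrow> A * S * 0"
    using z \<rho> by (intro tendsto_intros LIMSEQ_power_zero) auto
  then have "norm (f z) + norm (g z) \<le> 0"
    using key[OF z] by (intro LIMSEQ_le_const[where X = "\<lambda>n. A * S * (dist p z / \<rho>) ^ n"]) auto
  then have "norm (f z) \<le> 0 \<and> norm (g z) \<le> 0" using norm_ge_zero[of "f z"] norm_ge_zero[of "g z"] by linarith
  then show ?thesis by simp
qed

subsection \<open>Products with a conical singularity\<close>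

text \<open>The vectors on which all the seminorms are bounded form a subspace of a finite-dimensional space.\<close>

lemma seminorm_family_bound:
  fixes q :: "'z \<Rightarrow> ('i \<Rightarrow> complex) \<Rightarrow> real"
  assumes "finite I"
    and "\<And>z c d. z \<in> Z \<Longrightarrow> q z (\<lambda>i. c i + d i) \<le> q z c + q z d"
    and "\<And>z a c. z \<in> Z \<Longrightarrow> q z (\<lambda>i. a * c i) = norm a * q z c"
    and "\<And>z c d. z \<in> Z \<Longrightarrow> (\<And>i. i \<in> I \<Longrightarrow> c i = d i) \<Longrightarrow> q z c = q z d"
  shows "\<exists>B\<ge>0. \<forall>c. (\<exists>b. \<forall>z\<in>Z. q z c \<le> b) \<longrightarrow> (\<forall>z\<in>Z. q z c \<le> B * (\<Sum>i\<in>I. norm (c i)))"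
  using assms
proof (induction I arbitrary: q rule: finite_induct)
  case empty
  have "q z c = 0" if "z \<in> Z" for z c
  proof -
    have "q z c = q z (\<lambda>i. 0 * c i)" by (rule empty(3)[OF that]) simp
    also have "\<dots> = 0" using empty(2)[OF that, of 0 c] by simp
    finally show ?thesis .
  qed
  then show ?case by (intro exI[of _ 0]) auto
next
  case (insert j I)
  note add = insert.prems(1) and scale = insert.prems(2) and cong = insert.prems(3)
  \<comment> \<open>The family restricted to the hyperplane \<open>c j = 0\<close>, to which the
    induction hypothesis applies.\<close>
  define q' where "q' z c = q z (\<lambda>i. if i = j then 0 else c i)" for z and c :: "'i \<Rightarrow> complex"
  have "\<exists>B\<ge>0. \<forall>c. (\<exists>b. \<forall>z\<in>Z. q' z c \<le> b) \<longrightarrow> (\<forall>z\<in>Z. q' z c \<le> B * (\<Sum>i\<in>I. norm (c i)))"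
  proof (rule insert.IH)
    fix z and c d :: "'i \<Rightarrow> complex" assume z: "z \<in> Z"
    have "(\<lambda>i. if i = j then 0 else c i + d i) = (\<lambda>i. (if i = j then 0 else c i) + (if i = j then 0 else d i))" by auto
    then show "q' z (\<lambda>i. c i + d i) \<le> q' z c + q' z d" unfolding q'_def using add[OF z] by simp
  next
    fix z a and c :: "'i \<Rightarrow> complex" assume z: "z \<in> Z"
    have "(\<lambda>i. if i = j then 0 else a * c i) = (\<lambda>i. a * (if i = j then 0 else c i))" by auto
    then show "q' z (\<lambda>i. a * c i) = norm a * q' z c" unfolding q'_def using scale[OF z] by simp
  next
    fix z and c d :: "'i \<Rightarrow> complex" assume z: "z \<in> Z" and "\<And>i. i \<in> I \<Longrightarrow> c i = d i"
    then show "q' z c = q' z d" unfolding q'_def by (intro cong[OF z]) auto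
  qed
  then obtain B where B: "B \<ge> 0" "\<And>c b z. (\<And>z. z \<in> Z \<Longrightarrow> q' z c \<le> b) \<Longrightarrow> z \<in> Z \<Longrightarrow> q' z c \<le> B * (\<Sum>i\<in>I. norm (c i))"
    by metis
  have q'_eq: "q' z c = q z c" if "z \<in> Z" "c j = 0" for z c
    unfolding q'_def using that by (intro cong) auto
  show ?case
  proof (cases "\<exists>c b. c j \<noteq> 0 \<and> (\<forall>z\<in>Z. q z c \<le> b)")
    \<comment> \<open>All vectors with bounded seminorms lie in the hyperplane.\<close>
    case False
    have "q z c \<le> B * (\<Sum>i\<in>insert j I. norm (c i))" if "\<forall>z\<in>Z. q z c \<le> b" "z \<in> Z" for c b z
    proof -
      have cj: "c j = 0" using False that(1) by blast
      have "q z c \<le> B * (\<Sum>i\<in>I. norm (c i))"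
        using B(2)[of c b z] that q'_eq[of _ c] cj by simp
      then show ?thesis using insert.hyps cj by simp
    qed
    then show ?thesis using B(1) by blast
  next
    case True
    then obtain c0 b0 where c0: "c0 j \<noteq> 0" "\<And>z. z \<in> Z \<Longrightarrow> q z c0 \<le> b0" by blast
    \<comment> \<open>A fixed vector of the bounded subspace, normalised to \<open>c1 j = 1\<close>.
      Subtracting \<open>c j\<close> times it moves any other vector of the subspace into the
      hyperplane, at a cost proportional to \<open>norm (c j)\<close>.\<close>
    define c1 where "c1 i = inverse (c0 j) * c0 i" for i
    define b1 where "b1 = norm (inverse (c0 j)) * \<bar>b0\<bar>"
    have c1: "c1 j = 1" using c0(1) by (simp add: c1_def)
    have b1: "b1 \<ge> 0" by (simp add: b1_def)
    have qc1: "q z c1 \<le> b1" if "z \<in> Z" for z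
      unfolding c1_def b1_def scale[OF that] using c0(2)[OF that] by (intro mult_left_mono) auto
    define D where "D = B * (1 + (\<Sum>i\<in>I. norm (c1 i))) + b1"
    have D: "D \<ge> 0" using B(1) b1 by (simp add: D_def sum_nonneg)
    have "q z c \<le> D * (\<Sum>i\<in>insert j I. norm (c i))" if cb: "\<forall>z\<in>Z. q z c \<le> b" and z: "z \<in> Z" for c b z
    proof -
      define d where "d i = c i + (- c j) * c1 i" for i
      have dj: "d j = 0" by (simp add: d_def c1)
      have "q x d \<le> b + norm (c j) * b1" if x: "x \<in> Z" for x
      proof -
        have "q x d \<le> q x c + q x (\<lambda>i. (- c j) * c1 i)" unfolding d_def by (rule add[OF x])
        also have "\<dots> \<le> b + norm (c j) * b1"
          unfolding scale[OF x] using cb x qc1[OF x] by (intro add_mono) (auto intro: mult_left_mono)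
        finally show ?thesis .
      qed
      then have qd: "q z d \<le> B * (\<Sum>i\<in>I. norm (d i))"
        using B(2)[of d "b + norm (c j) * b1" z] z q'_eq[of _ d] dj by simp
      have "q z c = q z (\<lambda>i. d i + c j * c1 i)" by (simp add: d_def)
      also have "\<dots> \<le> q z d + norm (c j) * q z c1" using add[OF z, of d "\<lambda>i. c j * c1 i"] scale[OF z] by simp
      also have "\<dots> \<le> B * (\<Sum>i\<in>I. norm (c i) + norm (c j) * norm (c1 i)) + norm (c j) * b1"
      proof (intro add_mono mult_left_mono qc1[OF z] order_trans[OF qd] sum_mono B(1))
        show "norm (d i) \<le> norm (c i) + norm (c j) * norm (c1 i)" for i
          unfolding d_def by (rule order_trans[OF norm_triangle_ineq]) (simp add: norm_mult)
      qed auto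
      also have "\<dots> = B * (\<Sum>i\<in>I. norm (c i)) + (B * (\<Sum>i\<in>I. norm (c1 i)) + b1) * norm (c j)"
        by (simp add: sum.distrib sum_distrib_left algebra_simps)
      also have "\<dots> \<le> D * (\<Sum>i\<in>I. norm (c i)) + D * norm (c j)"
        using B(1) b1 by (intro add_mono mult_right_mono) (auto simp: D_def distrib_left intro!: sum_nonneg mult_nonneg_nonneg add_nonneg_nonneg)
      also have "\<dots> = D * (\<Sum>i\<in>insert j I. norm (c i))" using insert.hyps by (simp add: distrib_left)
      finally show ?thesis .
    qed
    then show ?thesis using D by blast
  qed
qed

text \<open>Keeps the top order apart from the lower ones: \<open>A\<close> is a known bound,
  \<open>X\<close> bounds what is still to be estimated, and the nonlinearity has to stay linear in
  \<open>X\<close>.\<close>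

definition jet_le :: "nat \<Rightarrow> real \<Rightarrow> real \<Rightarrow> (plane \<Rightarrow> complex) \<Rightarrow> plane \<Rightarrow> bool" where
  "jet_le k A X u z \<longleftrightarrow> (\<forall>i<k. Dnorm i u z \<le> A) \<and> Dnorm k u z \<le> X"

text \<open>For \<open>k \<ge> 1\<close> a Leibniz term of order \<open>k\<close> contains at most
  one factor of top order, so no product \<open>X * Y\<close> occurs.\<close>

lemma jet_le_mult:
  assumes \<Omega>: "open \<Omega>" "z \<in> \<Omega>" and u: "smooth_on \<Omega> u" and v: "smooth_on \<Omega> v" and k: "k \<ge> 1"
    and ju: "jet_le k A X u z" and jv: "jet_le k B Y v z"
  shows "jet_le k (2 ^ k * real (k + 1) * (A * B)) (2 ^ k * real (k + 1) * (A * B + A * Y + X * B)) (\<lambda>z. u z * v z) z"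
proof -
  have lowu: "\<And>i. i < k \<Longrightarrow> Dnorm i u z \<le> A" and lowv: "\<And>i. i < k \<Longrightarrow> Dnorm i v z \<le> B"
    and X: "Dnorm k u z \<le> X" and Y: "Dnorm k v z \<le> Y" using ju jv by (auto simp: jet_le_def)
  have A: "A \<ge> 0" by (rule order_trans[OF Dnorm_nonneg lowu[of 0]]) (use k in simp)
  have B: "B \<ge> 0" by (rule order_trans[OF Dnorm_nonneg lowv[of 0]]) (use k in simp)
  have X0: "X \<ge> 0" by (rule order_trans[OF Dnorm_nonneg X])
  have Y0: "Y \<ge> 0" by (rule order_trans[OF Dnorm_nonneg Y])
  have low: "Dnorm i (\<lambda>z. u z * v z) z \<le> 2 ^ k * real (k + 1) * (A * B)" if i: "i < k" for i
  proof -
    have "Dnorm i (\<lambda>z. u z * v z) z \<le> 2 ^ i * (\<Sum>j\<le>i. Dnorm j u z * Dnorm (i - j) v z)"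
      by (rule Dnorm_mult[OF \<Omega> u v])
    also have "\<dots> \<le> 2 ^ i * (\<Sum>j\<le>i. A * B)"
      using i A by (intro mult_left_mono sum_mono mult_mono lowu lowv) auto
    also have "\<dots> = 2 ^ i * (real (i + 1) * (A * B))" by simp
    also have "\<dots> \<le> 2 ^ k * (real (k + 1) * (A * B))"
      using i A B by (intro mult_mono power_increasing mult_right_mono) auto
    finally show ?thesis by (simp only: mult.assoc)
  qed
  have "Dnorm k (\<lambda>z. u z * v z) z \<le> 2 ^ k * (\<Sum>j\<le>k. Dnorm j u z * Dnorm (k - j) v z)"
    by (rule Dnorm_mult[OF \<Omega> u v])
  also have "\<dots> \<le> 2 ^ k * (\<Sum>j\<le>k. A * B + A * Y + X * B)"
  proof (intro mult_left_mono sum_mono)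
    fix j assume "j \<in> {..k}"
    then consider "j = 0" | "j = k" | "0 < j" "j < k" by force
    then show "Dnorm j u z * Dnorm (k - j) v z \<le> A * B + A * Y + X * B"
    proof cases
      case 1
      then have "Dnorm j u z * Dnorm (k - j) v z \<le> A * Y" using lowu[of 0] Y k A by (intro mult_mono) auto
      moreover have "0 \<le> A * B" "0 \<le> X * B" using A B X0 by auto
      ultimately show ?thesis by linarith
    next
      case 2
      then have "Dnorm j u z * Dnorm (k - j) v z \<le> X * B" using lowv[of 0] X k X0 by (intro mult_mono) auto
      moreover have "0 \<le> A * B" "0 \<le> A * Y" using A B Y0 by auto
      ultimately show ?thesis by linarith
    next
      case 3
      then have "Dnorm j u z * Dnorm (k - j) v z \<le> A * B" using lowu[of j] lowv[of "k - j"] A by (intro mult_mono) auto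
      moreover have "0 \<le> X * B" "0 \<le> A * Y" using A B X0 Y0 by auto
      ultimately show ?thesis by linarith
    qed
  qed auto
  also have "\<dots> = 2 ^ k * real (k + 1) * (A * B + A * Y + X * B)" by (simp only: sum_constant card_atMost mult.assoc) simp
  finally show ?thesis using low by (simp add: jet_le_def)
qed

lemma jet_le_mono: "jet_le k A X u z \<Longrightarrow> A \<le> A' \<Longrightarrow> X \<le> X' \<Longrightarrow> jet_le k A' X' u z"
  unfolding jet_le_def by (meson order_trans)

lemma jet_le_add:
  assumes \<Omega>: "open \<Omega>" "z \<in> \<Omega>" and u: "smooth_on \<Omega> u" and v: "smooth_on \<Omega> v"
    and ju: "jet_le k A X u z" and jv: "jet_le k B Y v z"
  shows "jet_le k (A + B) (X + Y) (\<lambda>z. u z + v z) z"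
  using ju jv Dnorm_add[OF \<Omega>(1) u v \<Omega>(2)] unfolding jet_le_def by (meson add_mono order_trans)

lemma jet_le_cmult:
  assumes \<Omega>: "open \<Omega>" "z \<in> \<Omega>" and u: "smooth_on \<Omega> u" and ju: "jet_le k A X u z" and c: "norm c \<le> C"
    and AX: "A \<ge> 0" "X \<ge> 0"
  shows "jet_le k (C * A) (C * X) (\<lambda>z. c * u z) z"
  using ju c AX order_trans[OF norm_ge_zero c] unfolding jet_le_def Dnorm_cmult[OF \<Omega>(1) u \<Omega>(2)]
  by (auto intro!: mult_mono)

text \<open>Two of the three factors are absorbed into \<open>L\<^sup>2\<close>, which keeps the
  bounds linear in \<open>A\<close> and \<open>X\<close>. The linear dependence of the final
  estimate on the L^4 norm rests on this.\<close>

lemma jet_le_triple: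
  assumes \<Omega>: "open \<Omega>" "z \<in> \<Omega>" and u: "smooth_on \<Omega> u" and v: "smooth_on \<Omega> v" and w: "smooth_on \<Omega> w" and k: "k \<ge> 1"
    and j: "jet_le k A X u z" "jet_le k A X v z" "jet_le k A X w z" and L: "A \<le> L"
  defines "W \<equiv> 2 ^ k * real (k + 1)"
  shows "jet_le k (3 * W\<^sup>2 * L\<^sup>2 * A) (3 * W\<^sup>2 * L\<^sup>2 * (A + X)) (\<lambda>z. u z * v z * w z) z"
proof -
  have "Dnorm 0 u z \<le> A" "Dnorm k u z \<le> X" using j(1) k by (auto simp: jet_le_def)
  then have A: "A \<ge> 0" and X: "X \<ge> 0" using Dnorm_nonneg order_trans by blast+
  have W: "W \<ge> 0" by (simp add: W_def)
  have j2: "jet_le k (W * (A * A)) (W * (A * A + A * X + X * A)) (\<lambda>z. u z * v z) z"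
    unfolding W_def using jet_le_mult[OF \<Omega> u v k j(1,2)] by (simp add: add.commute)
  have j3: "jet_le k (W * (W * (A * A) * A)) (W * (W * (A * A) * A + W * (A * A) * X + W * (A * A + A * X + X * A) * A)) (\<lambda>z. u z * v z * w z) z"
    unfolding W_def using jet_le_mult[OF \<Omega> smooth_on_mult[OF \<Omega>(1) u v] w k j2[unfolded W_def] j(3)] by (simp add: add.commute)
  have A2: "A * A \<le> L\<^sup>2" using A L by (simp add: power2_eq_square mult_mono)
  have "W * (W * (A * A) * A) = W\<^sup>2 * A * (A * A)" by (simp add: power2_eq_square mult_ac)
  also have "\<dots> \<le> W\<^sup>2 * A * L\<^sup>2" using A A2 by (intro mult_left_mono) auto
  also have "\<dots> \<le> 3 * W\<^sup>2 * L\<^sup>2 * A" using A by (simp add: mult_ac)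
  finally have 1: "W * (W * (A * A) * A) \<le> 3 * W\<^sup>2 * L\<^sup>2 * A" .
  have "W * (W * (A * A) * A + W * (A * A) * X + W * (A * A + A * X + X * A) * A) = W\<^sup>2 * (2 * A + 3 * X) * (A * A)"
    by (simp add: power2_eq_square algebra_simps)
  also have "\<dots> \<le> W\<^sup>2 * (2 * A + 3 * X) * L\<^sup>2" using A X A2 by (intro mult_left_mono) auto
  also have "\<dots> \<le> W\<^sup>2 * (3 * A + 3 * X) * L\<^sup>2" using A by (intro mult_right_mono mult_left_mono) auto
  also have "\<dots> = 3 * W\<^sup>2 * L\<^sup>2 * (A + X)" by (simp add: algebra_simps)
  finally have 2: "W * (W * (A * A) * A + W * (A * A) * X + W * (A * A + A * X + X * A) * A) \<le> 3 * W\<^sup>2 * L\<^sup>2 * (A + X)" .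
  show ?thesis by (rule jet_le_mono[OF j3 1 2])
qed

lemma jet_le_cnj: "open \<Omega> \<Longrightarrow> z \<in> \<Omega> \<Longrightarrow> smooth_on \<Omega> u \<Longrightarrow> jet_le k A X u z \<Longrightarrow> jet_le k A X (\<lambda>z. cnj (u z)) z"
  by (simp add: jet_le_def Dnorm_cnj)

text \<open>12 is the 3 of a triple product, times 2 for the coefficients, times 2 for the number of
  summands.\<close>

lemma jet_le_cubic:
  assumes \<Omega>: "open \<Omega>" "z \<in> \<Omega>" and f: "smooth_on \<Omega> f" and g: "smooth_on \<Omega> g" and k: "k \<ge> 1"
    and j: "jet_le k A X f z" "jet_le k A X g z" and L: "A \<le> L" and u: "u = f \<or> u = g"
    and ab: "\<bar>a\<bar> \<le> 2" "\<bar>b\<bar> \<le> 2"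
  defines "D \<equiv> 12 * (2 ^ k * real (k + 1))\<^sup>2 * L\<^sup>2"
  shows "jet_le k (D * A) (D * (A + X)) (\<lambda>z. dens f g z * cnj (u z)) z"
    "jet_le k (D * A) (D * (A + X)) (\<lambda>z. quadr a b f g z * cnj (u z)) z"
proof -
  have "Dnorm 0 f z \<le> A" "Dnorm k f z \<le> X" using j(1) k by (auto simp: jet_le_def)
  then have A: "A \<ge> 0" and X: "X \<ge> 0" using Dnorm_nonneg order_trans by blast+
  define D' where "D' = 3 * (2 ^ k * real (k + 1))\<^sup>2 * L\<^sup>2"
  have D': "D' \<ge> 0" "D = 4 * D'" by (simp_all add: D'_def D_def)
  have su: "smooth_on \<Omega> u" and ju: "jet_le k A X u z" using u f g j by auto
  note c = smooth_on_cnj[OF \<Omega>(1)]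
  have tf: "jet_le k (D' * A) (D' * (A + X)) (\<lambda>z. f z * cnj (f z) * cnj (u z)) z"
    unfolding D'_def by (intro jet_le_triple[OF \<Omega>] f c su k j ju jet_le_cnj[OF \<Omega>] L)
  have tg: "jet_le k (D' * A) (D' * (A + X)) (\<lambda>z. g z * cnj (g z) * cnj (u z)) z"
    unfolding D'_def by (intro jet_le_triple[OF \<Omega>] g c su k j ju jet_le_cnj[OF \<Omega>] L)
  have sf: "smooth_on \<Omega> (\<lambda>z. f z * cnj (f z) * cnj (u z))" and sg: "smooth_on \<Omega> (\<lambda>z. g z * cnj (g z) * cnj (u z))"
    by (intro smooth_on_mult[OF \<Omega>(1)] f g c su)+
  have nn: "D' * A \<ge> 0" "D' * (A + X) \<ge> 0" using D' A X by auto
  have eqs: "D * A = 4 * (D' * A)" "D * (A + X) = 4 * (D' * (A + X))" by (simp_all add: D'(2))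
  have "(\<lambda>z. dens f g z * cnj (u z)) = (\<lambda>z. f z * cnj (f z) * cnj (u z) + g z * cnj (g z) * cnj (u z))"
    by (simp add: dens_def distrib_right)
  then have "jet_le k (D' * A + D' * A) (D' * (A + X) + D' * (A + X)) (\<lambda>z. dens f g z * cnj (u z)) z"
    using jet_le_add[OF \<Omega> sf sg tf tg] by simp
  then show "jet_le k (D * A) (D * (A + X)) (\<lambda>z. dens f g z * cnj (u z)) z"
    by (rule jet_le_mono) (use nn eqs in linarith)+
  have qeq: "(\<lambda>z. quadr a b f g z * cnj (u z)) = (\<lambda>z. (\<i> * of_real a) * (f z * cnj (f z) * cnj (u z)) + (\<i> * of_real b) * (g z * cnj (g z) * cnj (u z)))"
    by (simp add: quadr_def algebra_simps)
  have q1: "jet_le k (2 * (D' * A)) (2 * (D' * (A + X))) (\<lambda>z. (\<i> * of_real a) * (f z * cnj (f z) * cnj (u z))) z"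
    by (rule jet_le_cmult[OF \<Omega> sf tf _ nn]) (use ab in \<open>simp add: norm_mult\<close>)
  have q2: "jet_le k (2 * (D' * A)) (2 * (D' * (A + X))) (\<lambda>z. (\<i> * of_real b) * (g z * cnj (g z) * cnj (u z))) z"
    by (rule jet_le_cmult[OF \<Omega> sg tg _ nn]) (use ab in \<open>simp add: norm_mult\<close>)
  have "jet_le k (2 * (D' * A) + 2 * (D' * A)) (2 * (D' * (A + X)) + 2 * (D' * (A + X))) (\<lambda>z. quadr a b f g z * cnj (u z)) z"
    unfolding qeq
    by (intro jet_le_add[OF \<Omega> smooth_on_mult[OF \<Omega>(1) smooth_on_const sf] smooth_on_mult[OF \<Omega>(1) smooth_on_const sg]] q1 q2)
  then show "jet_le k (D * A) (D * (A + X)) (\<lambda>z. quadr a b f g z * cnj (u z)) z"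
    by (rule jet_le_mono) (use nn eqs in linarith)+
qed

lemma dbar_wderiv:
  assumes "open \<Omega>" "smooth_on \<Omega> u" "z \<in> \<Omega>"
  shows "dbar (wderiv w u) z = wderiv w (dbar u) z"
  unfolding dbar_def[of "wderiv w u"] wderiv_dbar[OF assms]
  using wderiv_partial_commute[OF assms, of w] by simp

text \<open>A factor vanishing to order \<open>k\<close> matches the blow-up of \<open>h\<close>:
  the powers of \<open>dist p z\<close> cancel in every Leibniz term.\<close>

lemma conical_Dnorm_mult:
  assumes h: "conical_at p R h" and k: "\<And>i. i \<le> k \<Longrightarrow> Bh i > 0"
    and Bh: "\<And>i z. i \<le> k \<Longrightarrow> z \<in> ball p R - {p} \<Longrightarrow> Dnorm i h z * dist p z ^ i \<le> Bh i"
    and u: "smooth_on (ball p R - {p}) u" and z: "z \<in> ball p R - {p}"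
    and S: "S \<ge> 0" "\<And>j. j \<le> k \<Longrightarrow> Dnorm j u z \<le> (2 ^ k * dist p z) ^ (k - j) * S"
  shows "Dnorm k (\<lambda>z. h z * u z) z \<le> 2 ^ k * (\<Sum>i\<le>k. Bh i * (2 ^ k) ^ i) * S"
proof -
  have sm: "smooth_on (ball p R - {p}) h" using h by (simp add: conical_at_def)
  have "Dnorm k (\<lambda>z. h z * u z) z \<le> 2 ^ k * (\<Sum>i\<le>k. Dnorm i h z * Dnorm (k - i) u z)"
    by (rule Dnorm_mult[OF _ z sm u]) auto
  also have "\<dots> \<le> 2 ^ k * (\<Sum>i\<le>k. Bh i * (2 ^ k) ^ i * S)"
  proof (intro mult_left_mono sum_mono)
    fix i assume "i \<in> {..k}"
    then have i: "i \<le> k" by simp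
    have "Dnorm i h z * Dnorm (k - i) u z \<le> Dnorm i h z * ((2 ^ k * dist p z) ^ (k - (k - i)) * S)"
      by (intro mult_left_mono S(2)) auto
    also have "\<dots> = (Dnorm i h z * dist p z ^ i) * ((2 ^ k) ^ i * S)" using i by (simp add: power_mult_distrib mult_ac)
    also have "\<dots> \<le> Bh i * ((2 ^ k) ^ i * S)" using Bh[OF i z] S(1) by (intro mult_right_mono) auto
    finally show "Dnorm i h z * Dnorm (k - i) u z \<le> Bh i * (2 ^ k) ^ i * S" by (simp add: mult.assoc)
  qed auto
  finally show ?thesis by (simp add: sum_distrib_right mult.assoc)
qed

text \<open>The \<open>k\<close>-th derivatives of the nonlinearity \<open>h P\<close> are controlled by those of \<open>P\<close> without loss. The Taylor remainder
  of \<open>P\<close> compensates the singularity of \<open>h\<close>. The Taylor polynomials that can occur make \<open>h P\<close> smooth, so they lie in the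
  subspace of polynomials \<open>t\<close> for which the \<open>k\<close>-th derivatives of \<open>h t\<close> are bounded, on which the bound is uniform.\<close>

lemma conical_product_bound:
  assumes h: "conical_at p R h" and r: "0 < r" "r < R"
  obtains B where "B \<ge> 0"
    "\<And>P F S A z. smooth_on (ball p R) P \<Longrightarrow> smooth_on (ball p R) F \<Longrightarrow> (\<And>x. x \<in> ball p R \<Longrightarrow> h x * P x = F x) \<Longrightarrow>
      (\<And>i. i < k \<Longrightarrow> Dnorm i P p \<le> A) \<Longrightarrow> z \<in> cball p r \<Longrightarrow> z \<noteq> p \<Longrightarrow>
      (\<And>x. x \<in> cball p (dist p z) \<Longrightarrow> Dnorm k P x \<le> S) \<Longrightarrow> A \<ge> 0 \<Longrightarrow> Dnorm k F z \<le> B * (A + S)"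
proof -
  let ?U = "ball p R - {p}"
  have U: "open ?U" and b: "open (ball p R)" by auto
  have sm: "smooth_on ?U h" using h by (simp add: conical_at_def)
  obtain Bh where Bh: "\<And>i. Bh i > 0" "\<And>i z. z \<in> ?U \<Longrightarrow> Dnorm i h z * dist p z ^ i \<le> Bh i"
    using h unfolding conical_at_def by metis
  define B1 where "B1 = 2 ^ k * (\<Sum>i\<le>k. Bh i * (2 ^ k) ^ i)"
  have B1: "B1 \<ge> 0" unfolding B1_def by (intro mult_nonneg_nonneg sum_nonneg) (auto intro: less_imp_le[OF Bh(1)])
  have csub: "cball p r \<subseteq> ball p R" using r by auto
  let ?I = "multi_indices k" and ?Z = "cball p r - {p}"
  have ZU: "z \<in> ?U" if "z \<in> ?Z" for z using that r by auto
  define q where "q z c = Dnorm k (\<lambda>z. h z * taylor_sum p ?I c z) z" for z c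
  have st: "smooth_on ?U (\<lambda>z. h z * taylor_sum p ?I c z)" for c by (intro smooth_on_mult[OF U sm] smooth_on_taylor_sum[OF U])
  \<comment> \<open>One seminorm for each point of the punctured disk, on the coefficients of
    polynomials of degree below \<open>k\<close>. The constant is fixed here, before any
    \<open>P\<close> is considered.\<close>
  have "\<exists>B\<ge>0. \<forall>c. (\<exists>b. \<forall>z\<in>?Z. q z c \<le> b) \<longrightarrow> (\<forall>z\<in>?Z. q z c \<le> B * (\<Sum>i\<in>?I. norm (c i)))"
  proof (rule seminorm_family_bound[OF finite_multi_indices])
    fix z and c d :: "multi_index \<Rightarrow> complex" assume z: "z \<in> ?Z"
    have "(\<lambda>z. h z * taylor_sum p ?I (\<lambda>i. c i + d i) z) = (\<lambda>z. h z * taylor_sum p ?I c z + h z * taylor_sum p ?I d z)"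
      by (simp add: taylor_sum_def distrib_left distrib_right sum.distrib)
    then show "q z (\<lambda>i. c i + d i) \<le> q z c + q z d"
      unfolding q_def using Dnorm_add[OF U st st ZU[OF z], of k c d] by simp
  next
    fix z a and c :: "multi_index \<Rightarrow> complex" assume z: "z \<in> ?Z"
    have "(\<lambda>z. h z * taylor_sum p ?I (\<lambda>i. a * c i) z) = (\<lambda>z. a * (h z * taylor_sum p ?I c z))"
      by (simp add: taylor_sum_def sum_distrib_left mult_ac)
    then show "q z (\<lambda>i. a * c i) = norm a * q z c"
      unfolding q_def using Dnorm_cmult[OF U st ZU[OF z], of k a c] by simp
  next
    fix z and c d :: "multi_index \<Rightarrow> complex" assume "z \<in> ?Z" and "\<And>i. i \<in> ?I \<Longrightarrow> c i = d i"
    then have "taylor_sum p ?I c = taylor_sum p ?I d" by (auto simp: taylor_sum_def fun_eq_iff)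
    then show "q z c = q z d" by (simp add: q_def)
  qed
  then obtain B2 where B2: "B2 \<ge> 0" "\<And>c b z. (\<And>z. z \<in> ?Z \<Longrightarrow> q z c \<le> b) \<Longrightarrow> z \<in> ?Z \<Longrightarrow> q z c \<le> B2 * (\<Sum>i\<in>?I. norm (c i))"
    by metis
  define B where "B = B1 + B2 * real (card ?I)"
  show ?thesis
  proof (rule that[of B])
    show "B \<ge> 0" using B1 B2(1) by (simp add: B_def)
    fix P F S A z
    assume P: "smooth_on (ball p R) P" and F: "smooth_on (ball p R) F" and eq: "\<And>x. x \<in> ball p R \<Longrightarrow> h x * P x = F x"
      and low: "\<And>i. i < k \<Longrightarrow> Dnorm i P p \<le> A" and z: "z \<in> cball p r" "z \<noteq> p"
      and S: "\<And>x. x \<in> cball p (dist p z) \<Longrightarrow> Dnorm k P x \<le> S" and A: "A \<ge> 0"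
    define c where "c \<alpha> = mi_deriv \<alpha> P p" for \<alpha>
    define T where "T = taylor_poly p k P"
    have T_eq: "T = taylor_sum p ?I c" by (simp add: T_def taylor_poly_def c_def[abs_def])
    have T: "smooth_on (ball p R) T" unfolding T_def by (rule smooth_on_taylor_poly) simp
    have sR: "smooth_on (ball p R) (\<lambda>z. P z - T z)" by (rule smooth_on_diff[OF b P T])
    have sub: "?U \<subseteq> ball p R" by auto
    have rem: "Dnorm k (\<lambda>z. h z * (P z - T z)) y \<le> B1 * Y"
      if y: "y \<in> ?Z" and Y: "\<And>x. x \<in> cball p (dist p y) \<Longrightarrow> Dnorm k P x \<le> Y" for y Y
      unfolding B1_def
    proof (rule conical_Dnorm_mult[OF h Bh(1) Bh(2) smooth_on_subset[OF sR sub] ZU[OF y]])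
      have "0 \<le> Dnorm k P p" by simp
      also have "\<dots> \<le> Y" by (rule Y) simp
      finally show "Y \<ge> 0" .
      show "Dnorm j (\<lambda>z. P z - T z) y \<le> (2 ^ k * dist p y) ^ (k - j) * Y" if "j \<le> k" for j
        unfolding T_def using y r by (intro taylor_remainder[OF b csub P _ that _ Y]) auto
    qed auto
    have split: "Dnorm k F y \<le> Dnorm k (\<lambda>z. h z * (P z - T z)) y + q y c"
      "q y c \<le> Dnorm k F y + Dnorm k (\<lambda>z. h z * (P z - T z)) y" if y: "y \<in> ?Z" for y
    proof -
      have s1: "smooth_on ?U (\<lambda>z. h z * (P z - T z))" by (intro smooth_on_mult[OF U sm] smooth_on_subset[OF sR sub])
      have "Dnorm k F y = Dnorm k (\<lambda>z. h z * (P z - T z) + h z * taylor_sum p ?I c z) y"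
        by (rule Dnorm_cong[OF U _ ZU[OF y]]) (auto simp: T_eq algebra_simps simp flip: eq)
      then show "Dnorm k F y \<le> Dnorm k (\<lambda>z. h z * (P z - T z)) y + q y c"
        unfolding q_def using Dnorm_add[OF U s1 st ZU[OF y], of k c] by simp
      have "q y c = Dnorm k (\<lambda>z. F z - h z * (P z - T z)) y"
        unfolding q_def by (rule Dnorm_cong[OF U _ ZU[OF y]]) (auto simp: T_eq algebra_simps simp flip: eq)
      then show "q y c \<le> Dnorm k F y + Dnorm k (\<lambda>z. h z * (P z - T z)) y"
        using Dnorm_diff[OF U smooth_on_subset[OF F sub] s1 ZU[OF y], of k] by simp
    qed
    obtain SF where SF: "SF > 0" "\<And>x. x \<in> cball p r \<Longrightarrow> Dnorm k F x \<le> SF" using Dnorm_bounded_cball[OF csub F] by blast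
    obtain SP where SP: "SP > 0" "\<And>x. x \<in> cball p r \<Longrightarrow> Dnorm k P x \<le> SP" using Dnorm_bounded_cball[OF csub P] by blast
    \<comment> \<open>This bound depends on \<open>P\<close> and \<open>F\<close>. It only shows
      that the Taylor coefficients belong to the bounded subspace, on which the uniform constant
      \<open>B2\<close> takes over.\<close>
    have bdd: "q y c \<le> SF + B1 * SP" if y: "y \<in> ?Z" for y
    proof -
      have "Dnorm k (\<lambda>z. h z * (P z - T z)) y \<le> B1 * SP" using y by (intro rem SP) auto
      then show ?thesis using split(2)[OF y] SF(2)[of y] y by auto
    qed
    have "q z c \<le> B2 * (\<Sum>i\<in>?I. norm (c i))" by (rule B2(2)[OF bdd]) (use z in auto)
    also have "\<dots> \<le> B2 * (\<Sum>i\<in>?I. A)"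
    proof (intro mult_left_mono sum_mono B2(1))
      fix \<alpha> assume "\<alpha> \<in> ?I"
      then have "mi_order \<alpha> < k" by (simp add: multi_indices_def)
      then show "norm (c \<alpha>) \<le> A" unfolding c_def by (rule order_trans[OF norm_mi_deriv_le low])
    qed
    finally have "q z c \<le> B2 * real (card ?I) * A" by simp
    moreover have "Dnorm k (\<lambda>z. h z * (P z - T z)) z \<le> B1 * S" using z by (intro rem S) auto
    moreover have S0: "S \<ge> 0" by (rule order_trans[OF Dnorm_nonneg S[of p]]) simp
    moreover have "0 \<le> B1 * A" "0 \<le> B2 * real (card ?I) * S" using B1 B2(1) A S0 by auto
    ultimately show "Dnorm k F z \<le> B * (A + S)" using split(1)[of z] z by (simp add: B_def algebra_simps)
  qed
qed

text \<open>For a solution, \<open>h\<close> times the cubic term is, up to sign, the smooth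
  function \<open>dbar u\<close> minus another smooth term, hence smooth across \<open>p\<close>.
  This difference is the \<open>F\<close> of \<open>conical_product_bound\<close>.\<close>

lemma spin_system_rhs_bound:
  assumes h: "conical_at p R h" and R: "ball p R \<subseteq> unit_disk" and r: "0 < r" "r < R" and k: "k \<ge> 1" and L: "L \<ge> 0"
  obtains C where "C > 0"
    "\<And>f g u A X z. spin_system h f g \<Longrightarrow> u = f \<or> u = g \<Longrightarrow> A \<le> L \<Longrightarrow> A \<ge> 0 \<Longrightarrow> z \<in> cball p r \<Longrightarrow> z \<noteq> p \<Longrightarrow>
      (\<And>x. x \<in> cball p (dist p z) \<Longrightarrow> jet_le k A X f x \<and> jet_le k A X g x) \<Longrightarrow> Dnorm k (dbar u) z \<le> C * (A + X)"
proof -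
  obtain B where B: "B \<ge> 0"
    "\<And>P F S A z. smooth_on (ball p R) P \<Longrightarrow> smooth_on (ball p R) F \<Longrightarrow> (\<And>x. x \<in> ball p R \<Longrightarrow> h x * P x = F x) \<Longrightarrow>
      (\<And>i. i < k \<Longrightarrow> Dnorm i P p \<le> A) \<Longrightarrow> z \<in> cball p r \<Longrightarrow> z \<noteq> p \<Longrightarrow>
      (\<And>x. x \<in> cball p (dist p z) \<Longrightarrow> Dnorm k P x \<le> S) \<Longrightarrow> A \<ge> 0 \<Longrightarrow> Dnorm k F z \<le> B * (A + S)"
    by (rule conical_product_bound[OF h r]) blast
  define D where "D = 12 * (2 ^ k * real (k + 1))\<^sup>2 * L\<^sup>2"
  have D: "D \<ge> 0" by (simp add: D_def)
  define C where "C = 2 * B * D + D + 1"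
  show ?thesis
  proof (rule that[of C])
    show "C > 0" using B(1) D by (simp add: C_def add_nonneg_pos)
    fix f g u A X z
    assume sys: "spin_system h f g" and u: "u = f \<or> u = g" and A: "A \<le> L" "A \<ge> 0" and z: "z \<in> cball p r" "z \<noteq> p"
      and jet: "\<And>x. x \<in> cball p (dist p z) \<Longrightarrow> jet_le k A X f x \<and> jet_le k A X g x"
    have b: "open (ball p R)" by simp
    from sys obtain a1 a2 b1 b2 where c: "\<bar>a1\<bar> \<le> 2" "\<bar>a2\<bar> \<le> 2" "\<bar>b1\<bar> \<le> 2" "\<bar>b2\<bar> \<le> 2"
      and f: "smooth_on unit_disk f" and g: "smooth_on unit_disk g"
      and ef: "\<And>z. z \<in> unit_disk \<Longrightarrow> dbar f z = - (h z * (dens f g z * cnj (g z))) + quadr b1 b2 f g z * cnj (g z)"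
      and eg: "\<And>z. z \<in> unit_disk \<Longrightarrow> dbar g z = h z * (dens f g z * cnj (f z)) + quadr a1 a2 f g z * cnj (f z)"
      unfolding spin_system_def by blast
    have fb: "smooth_on (ball p R) f" and gb: "smooth_on (ball p R) g" using f g R smooth_on_subset by blast+
    note sm = smooth_on_dens[OF b fb gb] smooth_on_quadr[OF b fb gb] smooth_on_dbar[OF b fb] smooth_on_dbar[OF b gb]
      smooth_on_cnj[OF b fb] smooth_on_cnj[OF b gb]
    have inb: "x \<in> ball p R" if "x \<in> cball p (dist p z)" for x using that z r by auto
    have X: "X \<ge> 0" using jet[of p] by (auto simp: jet_le_def intro: order_trans[OF Dnorm_nonneg])
    \<comment> \<open>Both equations in one statement: \<open>s\<close> is -1 in the equation for
      \<open>f\<close> and 1 in that for \<open>g\<close>.\<close>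
    have main: "Dnorm k W z \<le> C * (A + X)"
      if v: "v = f \<or> v = g" and e: "\<bar>e1\<bar> \<le> 2" "\<bar>e2\<bar> \<le> 2" and sW: "smooth_on (ball p R) W" and s: "s = 1 \<or> s = (-1::complex)"
      and W: "\<And>x. x \<in> ball p R \<Longrightarrow> W x = s * (h x * (dens f g x * cnj (v x))) + quadr e1 e2 f g x * cnj (v x)"
      for v e1 e2 W s
    proof -
      have sv: "smooth_on (ball p R) v" using v fb gb by auto
      let ?P = "\<lambda>x. dens f g x * cnj (v x)" and ?Q = "\<lambda>x. quadr e1 e2 f g x * cnj (v x)"
      have sP: "smooth_on (ball p R) ?P" and sQ: "smooth_on (ball p R) ?Q"
        by (intro smooth_on_mult[OF b] sm smooth_on_cnj[OF b sv])+
      have jP: "jet_le k (D * A) (D * (A + X)) ?P x" and jQ: "jet_le k (D * A) (D * (A + X)) ?Q x"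
        if x: "x \<in> cball p (dist p z)" for x
        using jet_le_cubic[OF b inb[OF x] fb gb k _ _ A(1) v e, of X] jet[OF x] unfolding D_def by blast+
      define F where "F x = s * (W x - ?Q x)" for x
      have sF: "smooth_on (ball p R) F" unfolding F_def by (intro smooth_on_mult[OF b] smooth_on_diff[OF b] sW sQ smooth_on_const)
      have ss: "s * s = 1" using s by auto
      have "Dnorm k F z \<le> B * (D * A + D * (A + X))"
      proof (rule B(2)[OF sP sF _ _ z])
        show "h x * ?P x = F x" if "x \<in> ball p R" for x
          unfolding F_def W[OF that] using ss by (simp add: mult.assoc[symmetric])
        show "Dnorm i ?P p \<le> D * A" if "i < k" for i using jP[of p] that by (simp add: jet_le_def)
        show "Dnorm k ?P x \<le> D * (A + X)" if "x \<in> cball p (dist p z)" for x using jP[OF that] by (simp add: jet_le_def)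
        show "D * A \<ge> 0" using D A by simp
      qed
      also have "\<dots> \<le> B * (2 * D * (A + X))" using B(1) D X by (intro mult_left_mono) (simp_all add: distrib_left)
      finally have F: "Dnorm k F z \<le> 2 * B * D * (A + X)" by (simp add: mult_ac)
      have zb: "z \<in> ball p R" using z r by auto
      have "Dnorm k W z = Dnorm k (\<lambda>x. s * F x + ?Q x) z"
        by (rule Dnorm_cong[OF b _ zb]) (use ss in \<open>simp add: F_def mult.assoc[symmetric]\<close>)
      also have "\<dots> \<le> Dnorm k (\<lambda>x. s * F x) z + Dnorm k ?Q z"
        by (intro Dnorm_add[OF b _ sQ zb] smooth_on_mult[OF b] sF smooth_on_const)
      also have "Dnorm k (\<lambda>x. s * F x) z = Dnorm k F z" using Dnorm_cmult[OF b sF zb, of k s] s by auto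
      also have "Dnorm k F z + Dnorm k ?Q z \<le> 2 * B * D * (A + X) + D * (A + X)"
        using jQ[of z] by (intro add_mono F) (simp add: jet_le_def)
      also have "\<dots> \<le> C * (A + X)" using A X by (simp add: C_def distrib_right)
      finally show ?thesis .
    qed
    show "Dnorm k (dbar u) z \<le> C * (A + X)"
    proof (cases "u = f")
      case True
      show ?thesis unfolding True
        by (rule main[of g b1 b2 _ "-1"]) (use c sm ef R in auto)
    next
      case False
      then have ug: "u = g" using u by simp
      show ?thesis unfolding ug
        by (rule main[of f a1 a2 _ 1]) (use c sm eg R in auto)
    qed
  qed
qed

subsection \<open>Interior estimates\<close>

lemma root4_pow [simp]: "E \<ge> 0 \<Longrightarrow> root 4 E ^ 4 = E"
  by (rule real_root_pow_pos2) auto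

text \<open>A weighted maximum argument: only \<open>dbar\<close> of the \<open>k\<close>-th derivatives enters the interior estimate, and by the equation
  it contains no derivatives of order \<open>k + 1\<close>.\<close>

lemma spin_system_step:
  assumes h: "conical_at p R h" and R: "ball p R \<subseteq> unit_disk" "R > 0" and k: "k \<ge> 1" and L: "L \<ge> 0" and \<rho>: "\<rho> > 0"
  obtains r C where "r > 0" "C > 0"
    "\<And>f g A. spin_system h f g \<Longrightarrow> 0 \<le> A \<Longrightarrow> A \<le> L \<Longrightarrow>
       (\<And>x i. x \<in> ball p \<rho> \<Longrightarrow> i < k \<Longrightarrow> Dnorm i f x \<le> A \<and> Dnorm i g x \<le> A) \<Longrightarrow>
       (\<And>x. x \<in> ball p r \<Longrightarrow> Dnorm k f x \<le> C * A \<and> Dnorm k g x \<le> C * A)"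
proof -
  define r1 where "r1 = min (min \<rho> R) 1 / 2"
  have r1: "r1 > 0" "r1 < \<rho>" "r1 < R" "r1 \<le> 1" using \<rho> R(2) by (auto simp: r1_def)
  obtain C1 where C1: "C1 > 0"
    "\<And>f g u A X z. spin_system h f g \<Longrightarrow> u = f \<or> u = g \<Longrightarrow> A \<le> L \<Longrightarrow> A \<ge> 0 \<Longrightarrow> z \<in> cball p r1 \<Longrightarrow> z \<noteq> p \<Longrightarrow>
      (\<And>x. x \<in> cball p (dist p z) \<Longrightarrow> jet_le k A X f x \<and> jet_le k A X g x) \<Longrightarrow> Dnorm k (dbar u) z \<le> C1 * (A + X)"
    by (rule spin_system_rhs_bound[OF h R(1) r1(1,3) k L]) blast
  define c0 where "c0 = kern_mass"
  have c0: "c0 > 0" using kern_mass_pos by (simp add: c0_def)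
  \<comment> \<open>Chosen so that \<open>8 * 2 ^ k * C1 * r\<close>, the factor of the
    \<open>dbar\<close> term, is at most \<open>c0 / 4\<close> for
    \<open>r \<le> \<delta>\<close>.\<close>
  define \<delta> where "\<delta> = c0 / (32 * 2 ^ k * C1)"
  have \<delta>: "\<delta> > 0" using c0 C1(1) by (simp add: \<delta>_def)
  define C2 where "C2 = 2 ^ (k + 2) * 48 / c0 * (2 + 1 / \<delta>) + 1"
  have C2: "C2 > 0" using c0 \<delta> unfolding C2_def by (intro add_nonneg_pos mult_nonneg_nonneg) auto
  show ?thesis
  proof (rule that[of "r1 / 2" "4 * C2 / r1"])
    show "r1 / 2 > 0" "4 * C2 / r1 > 0" using r1 C2 by auto
    fix f g A x
    assume sys: "spin_system h f g" and A: "0 \<le> A" "A \<le> L"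
      and low: "\<And>x i. x \<in> ball p \<rho> \<Longrightarrow> i < k \<Longrightarrow> Dnorm i f x \<le> A \<and> Dnorm i g x \<le> A" and x: "x \<in> ball p (r1 / 2)"
    have f: "smooth_on unit_disk f" and g: "smooth_on unit_disk g" using sys by (auto simp: spin_system_def)
    have D: "open unit_disk" by simp
    have cD: "cball p r1 \<subseteq> unit_disk" using R(1) r1 by (auto simp: subset_eq)
    define s where "s y = Dnorm k f y + Dnorm k g y" for y
    have s0: "s y \<ge> 0" for y by (simp add: s_def)
    have "continuous_on (cball p r1) (\<lambda>y. (r1 - dist p y) * s y)"
      unfolding s_def by (intro continuous_intros continuous_on_subset[OF continuous_on_Dnorm cD] f g)
    then obtain z0 where z0: "z0 \<in> cball p r1" and max: "\<And>y. y \<in> cball p r1 \<Longrightarrow> (r1 - dist p y) * s y \<le> (r1 - dist p z0) * s z0"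
      using continuous_attains_sup[of "cball p r1" "\<lambda>y. (r1 - dist p y) * s y"] r1 by fastforce
    define M where "M = s z0"
    define d where "d = (r1 - dist p z0) / 2"
    have dM: "d * M \<le> C2 * A"
    proof (cases "d > 0")
      case False
      then have "d = 0" using z0 by (simp add: d_def)
      then show ?thesis using C2 A by simp
    next
      case True
      have M0: "M \<ge> 0" by (simp add: M_def s0)
      have "r1 - dist p z0 \<le> 2" using r1 zero_le_dist[of p z0] by linarith
      then have d1: "d \<le> 1" by (simp add: d_def)
      define r where "r = min (d / 2) \<delta>"
      have r: "r > 0" "r \<le> d / 2" "r \<le> \<delta>" using True \<delta> by (auto simp: r_def)
      have near: "r1 - dist p y \<ge> d" if "dist z0 y \<le> d" for y
        using that dist_triangle[of p y z0] unfolding d_def by (simp add: field_simps)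
      \<comment> \<open>The weight at \<open>z0\<close> is \<open>2 * d\<close>. The condition on
        \<open>y\<close> describes a disk around \<open>p\<close>, not around \<open>z0\<close>,
        because \<open>spin_system_rhs_bound\<close> needs the jets on whole disks around the
        singular point.\<close>
      have sM: "s y \<le> 2 * M" if "r1 - dist p y \<ge> d" for y
      proof -
        have "d * s y \<le> (r1 - dist p y) * s y" using that s0 by (intro mult_right_mono) auto
        also have "\<dots> \<le> (r1 - dist p z0) * s z0" using that True by (intro max) simp
        also have "\<dots> = d * (2 * M)" by (simp add: d_def M_def)
        finally show ?thesis using True by simp
      qed
      have bD: "ball z0 d \<subseteq> unit_disk"
      proof
        fix y assume "y \<in> ball z0 d"
        then have "r1 - dist p y \<ge> d" by (intro near) simp
        then have "y \<in> cball p r1" using True by simp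
        then show "y \<in> unit_disk" using cD by blast
      qed
      define Y where "Y = C1 * (A + 2 * M)"
      have Y: "Dnorm k (dbar u) y \<le> Y" if u: "u = f \<or> u = g" and y: "y \<in> ball z0 d" for u y
      proof -
        have off: "Dnorm k (dbar u) y \<le> Y" if y: "y \<in> ball z0 d" "y \<noteq> p" for y
          unfolding Y_def
        proof (rule C1(2)[OF sys u A(2,1) _ y(2)])
          have dy: "r1 - dist p y \<ge> d" using y by (intro near) simp
          then show "y \<in> cball p r1" using True by simp
          fix y' assume "y' \<in> cball p (dist p y)"
          then have y': "r1 - dist p y' \<ge> d" using dy by simp
          then have "y' \<in> ball p \<rho>" using True r1 by simp
          moreover have "Dnorm k f y' \<le> 2 * M" "Dnorm k g y' \<le> 2 * M"
            using sM[OF y'] Dnorm_nonneg[of k f y'] Dnorm_nonneg[of k g y'] unfolding s_def by linarith+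
          ultimately show "jet_le k A (2 * M) f y' \<and> jet_le k A (2 * M) g y'" using low by (simp add: jet_le_def)
        qed
        show ?thesis
        proof (cases "y = p")
          case False then show ?thesis using off y by blast
        next
          \<comment> \<open>The bound excludes the singular point; there it follows from the
            continuity of the derivatives of the smooth function \<open>dbar u\<close>.\<close>
          case True
          have "smooth_on unit_disk (dbar u)" using u f g smooth_on_dbar[OF D] by auto
          then have "isCont (Dnorm k (dbar u)) y"
            using continuous_on_Dnorm continuous_on_eq_continuous_at[OF D] bD y by blast
          then have lim: "(Dnorm k (dbar u) \<longlongrightarrow> Dnorm k (dbar u) y) (at y)" by (simp add: isCont_def)
          have "\<forall>\<^sub>F y' in at y. y' \<in> ball z0 d \<and> y' \<noteq> y"
            using y eventually_at_in_open[of "ball z0 d" y] by simp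
          then have "\<forall>\<^sub>F y' in at y. Dnorm k (dbar u) y' \<le> Y"
            by eventually_elim (use off True in auto)
          from tendsto_upperbound[OF lim this] show ?thesis by simp
        qed
      qed
      have bsub: "ball z0 (2 * r) \<subseteq> ball z0 d" using r by (intro subset_ball) simp
      have bD: "ball z0 (2 * r) \<subseteq> unit_disk" using bsub bD by blast
      have est: "c0 * Dnorm k u z0 \<le> 2 ^ k * (48 * A / r + 4 * Y * r)" if u: "u = f \<or> u = g" for u
      proof -
        have su: "smooth_on unit_disk u" using u f g by auto
        have "norm (wderiv w u z0) \<le> (48 * A / r + 4 * Y * r) / c0" if w: "length w = k" for w
        proof -
          \<comment> \<open>The last letter is split off, so that the averaging estimate trades it
            for the known bound \<open>A\<close> on the derivatives of order
            \<open>k - 1\<close>.\<close>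
          obtain w' c where wc: "w = w' @ [c]" using w k by (cases w rule: rev_cases) auto
          have eq: "wderiv w u = partial_deriv (dir c) (wderiv w' u)" by (simp add: wc wderiv_append)
          have C: "Ck_on 1 (ball z0 (2 * r)) (wderiv v u)" for v
            using smooth_on_wderiv[OF su, of v] bD Ck_on_subset unfolding smooth_on_def by blast
          have "kern_mass * norm (partial_deriv (dir c) (wderiv w' u) z0) \<le> 48 * A / r + 4 * Y * r"
          proof (rule averaging_derivative_bound[OF C[of w, unfolded eq] C r(1)])
            fix y assume y: "y \<in> cball z0 r"
            then have yd: "y \<in> ball z0 d" "y \<in> ball z0 (2 * r)" using r True by auto
            have "norm (dbar (wderiv w u) y) = norm (wderiv w (dbar u) y)"
              using yd bD by (subst dbar_wderiv[OF D su]) auto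
            also have "\<dots> \<le> Dnorm k (dbar u) y" using norm_wderiv_le_Dnorm[of w "dbar u" y] w by simp
            also have "\<dots> \<le> Y" by (rule Y[OF u yd(1)])
            finally show "norm (dbar (partial_deriv (dir c) (wderiv w' u)) y) \<le> Y" by (simp add: eq)
            have "y \<in> ball p \<rho>" using near[of y] yd(1) True r1 by simp
            then have "Dnorm (length w') u y \<le> A" using low[of y "length w'"] u w wc by auto
            then show "norm (wderiv w' u y) \<le> A" using norm_wderiv_le_Dnorm order_trans by blast
          qed
          then show ?thesis using c0 by (simp add: eq c0_def field_simps)
        qed
        then have "Dnorm k u z0 \<le> 2 ^ k * ((48 * A / r + 4 * Y * r) / c0)" by (rule Dnorm_le)
        then show ?thesis using c0 by (simp add: field_simps)
      qed
      have "c0 * M \<le> 2 ^ k * (48 * A / r + 4 * Y * r) + 2 ^ k * (48 * A / r + 4 * Y * r)"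
        unfolding M_def s_def distrib_left[of c0] by (intro add_mono est) simp_all
      also have "\<dots> = 96 * 2 ^ k * (A / r) + (8 * 2 ^ k * C1 * r) * (A + 2 * M)"
        by (simp add: Y_def algebra_simps)
      also have "(8 * 2 ^ k * C1 * r) * (A + 2 * M) \<le> (c0 / 4) * (A + 2 * M)"
      proof (rule mult_right_mono)
        have "8 * 2 ^ k * C1 * r \<le> 8 * 2 ^ k * C1 * \<delta>" using r C1(1) by (intro mult_left_mono) auto
        also have "\<dots> = c0 / 4" using C1(1) by (simp add: \<delta>_def)
        finally show "8 * 2 ^ k * C1 * r \<le> c0 / 4" .
      qed (use A M0 in auto)
      finally have "c0 * M \<le> 96 * 2 ^ k * (A / r) + c0 / 4 * (A + 2 * M)" by simp
      then have "c0 * M \<le> 2 * (96 * 2 ^ k * (A / r)) + c0 / 2 * A" by (simp add: field_simps)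
      then have "d * (c0 * M) \<le> d * (2 * (96 * 2 ^ k * (A / r)) + c0 / 2 * A)" using True by (intro mult_left_mono) auto
      also have "\<dots> = 192 * 2 ^ k * A * (d / r) + d * (c0 / 2 * A)" by (simp add: field_simps)
      also have "\<dots> \<le> 192 * 2 ^ k * A * (2 + 1 / \<delta>) + 1 * (c0 * A)"
      proof (rule add_mono)
        \<comment> \<open>Either \<open>r = d / 2\<close>, or \<open>r = \<delta>\<close> and
          \<open>d \<le> 1\<close>; in both cases the weight \<open>d\<close> compensates
          \<open>1 / r\<close>.\<close>
        have "d / r \<le> 2 + 1 / \<delta>"
        proof (cases "d / 2 \<le> \<delta>")
          case True
          then have "d / r = 2" using \<open>d > 0\<close> by (simp add: r_def)
          then show ?thesis using \<delta> by simp
        next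
          case False
          then have "d / r = d / \<delta>" by (simp add: r_def)
          also have "\<dots> \<le> 1 / \<delta>" using d1 \<delta> by (intro divide_right_mono) auto
          finally show ?thesis by simp
        qed
        then show "192 * 2 ^ k * A * (d / r) \<le> 192 * 2 ^ k * A * (2 + 1 / \<delta>)"
          by (rule mult_left_mono) (use A in simp)
        show "d * (c0 / 2 * A) \<le> 1 * (c0 * A)"
          by (rule mult_mono) (use A d1 c0 in \<open>auto intro!: mult_right_mono\<close>)
      qed
      also have "\<dots> = c0 * (C2 * A)" using c0 by (simp add: C2_def power_add field_simps)
      finally have "c0 * (d * M) \<le> c0 * (C2 * A)" by (simp add: mult_ac)
      then show ?thesis using c0 by simp
    qed
    have "r1 / 2 * s x \<le> (r1 - dist p x) * s x" using x s0 by (intro mult_right_mono) auto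
    also have "\<dots> \<le> 2 * (d * M)" using max[of x] x r1 by (simp add: d_def M_def)
    finally have "r1 / 2 * s x \<le> 2 * (C2 * A)" using dM by simp
    then have "s x \<le> 4 * C2 / r1 * A" using r1 by (simp add: field_simps)
    then show "Dnorm k f x \<le> 4 * C2 / r1 * A \<and> Dnorm k g x \<le> 4 * C2 / r1 * A"
      using Dnorm_nonneg[of k f x] Dnorm_nonneg[of k g x] unfolding s_def by linarith
  qed
qed

text \<open>A positive upper bound in place of the energy itself, so that the zero solution is no
  special case; the excess tends to 0 in the main proof.\<close>

definition energy_bound :: "(plane \<Rightarrow> complex) \<Rightarrow> (plane \<Rightarrow> complex) \<Rightarrow> real \<Rightarrow> bool" where
  "energy_bound f g E \<longleftrightarrow> E > 0 \<and> (\<integral>\<^sup>+z\<in>unit_disk. ennreal ((norm (f z) + norm (g z)) ^ 4) \<partial>lborel) \<le> ennreal E"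

text \<open>On half the distance from \<open>p\<close> to the circle, \<open>1 - norm x\<close> is
  at least \<open>(1 - norm p) / 2\<close>, so \<open>eps_regularity\<close> bounds the square of
  the sum by a multiple of \<open>sqrt E\<close>.\<close>

lemma spin_system_local_sup:
  assumes hB: "\<And>z. z \<in> unit_disk \<Longrightarrow> norm (h z) \<le> B" and B: "B \<ge> 0" and p: "p \<in> unit_disk"
    and small: "100 / kern_mass\<^sup>2 * sqrt \<epsilon> < kern_mass / (128 * (B + 2))"
  shows "\<exists>C>0. \<forall>f g E. spin_system h f g \<longrightarrow> energy_bound f g E \<longrightarrow> E \<le> \<epsilon> \<longrightarrow>
    (\<forall>x\<in>ball p ((1 - norm p) / 2). norm (f x) + norm (g x) \<le> C * root 4 E)"
proof -
  define D where "D = 400 / kern_mass\<^sup>2 / ((1 - norm p) / 2)"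
  have D: "D > 0" using p kern_mass_pos by (simp add: D_def)
  have "norm (f x) + norm (g x) \<le> sqrt D * root 4 E"
    if sys: "spin_system h f g" and E: "energy_bound f g E" "E \<le> \<epsilon>" and x: "x \<in> ball p ((1 - norm p) / 2)" for f g E x
  proof -
    let ?s = "norm (f x) + norm (g x)"
    have E0: "E > 0" using E by (simp add: energy_bound_def)
    have nx: "1 - norm x \<ge> (1 - norm p) / 2"
      using x norm_triangle_ineq2[of x p] by (simp add: dist_norm norm_minus_commute)
    then have xD: "x \<in> unit_disk" using p by simp
    have "100 / kern_mass\<^sup>2 * sqrt E \<le> 100 / kern_mass\<^sup>2 * sqrt \<epsilon>" using E by (intro mult_left_mono) auto
    then have sm: "100 / kern_mass\<^sup>2 * sqrt E < kern_mass / (128 * (B + 2))" using small by linarith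
    have fg: "smooth_on unit_disk f" "smooth_on unit_disk g" using sys by (auto simp: spin_system_def)
    have a: "(1 - norm x) * ?s\<^sup>2 \<le> 400 / kern_mass\<^sup>2 * sqrt E"
      by (rule eps_regularity[OF _ fg spin_system_cubic_bound(1)[OF sys _ hB] spin_system_cubic_bound(2)[OF sys _ hB] _ E0 sm xD])
        (use B E in \<open>auto simp: energy_bound_def\<close>)
    have "((1 - norm p) / 2) * ?s\<^sup>2 \<le> (1 - norm x) * ?s\<^sup>2" using nx by (intro mult_right_mono) auto
    from order_trans[OF this a] have "?s\<^sup>2 * ((1 - norm p) / 2) \<le> 400 / kern_mass\<^sup>2 * sqrt E" by (simp only: mult.commute)
    moreover have "(1 - norm p) / 2 > 0" using p by simp
    ultimately have "?s\<^sup>2 \<le> (400 / kern_mass\<^sup>2 * sqrt E) / ((1 - norm p) / 2)" by (simp only: pos_le_divide_eq)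
    also have "\<dots> = D * sqrt E" by (simp add: D_def)
    also have "\<dots> = (sqrt D * root 4 E)\<^sup>2"
    proof -
      have "sqrt E = (root 4 E)\<^sup>2"
        by (rule real_sqrt_unique) (use E0 root4_pow[of E] in \<open>simp_all flip: power_mult\<close>)
      then show ?thesis using D by (simp add: power_mult_distrib)
    qed
    finally show ?thesis by (rule power2_le_imp_le) (use D E0 in auto)
  qed
  then show ?thesis using D by (intro exI[of _ "sqrt D"]) auto
qed

text \<open>The radius and the constant precede the solutions in the order of quantifiers. Both
  cases of the proof are statements about all solutions for the given \<open>h\<close>, which makes
  this order possible.\<close>

proposition spin_system_local_estimate:
  assumes hB: "\<And>z. z \<in> unit_disk \<Longrightarrow> norm (h z) \<le> B" and B: "B \<ge> 0" and p: "p \<in> unit_disk"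
    and small: "100 / kern_mass\<^sup>2 * sqrt \<epsilon> < kern_mass / (128 * (B + 2))" and \<epsilon>: "\<epsilon> > 0"
  shows "\<exists>r>0. \<exists>C>0. ball p r \<subseteq> unit_disk \<and> (\<forall>f g E. spin_system h f g \<longrightarrow> energy_bound f g E \<longrightarrow> E \<le> \<epsilon> \<longrightarrow>
    (\<forall>x\<in>ball p r. \<forall>i\<le>k. Dnorm i f x \<le> C * root 4 E \<and> Dnorm i g x \<le> C * root 4 E))"
proof -
  define r0 where "r0 = (1 - norm p) / 2"
  have r0: "r0 > 0" using p by (simp add: r0_def)
  have r0D: "ball p r0 \<subseteq> unit_disk"
  proof
    fix x assume "x \<in> ball p r0"
    then show "x \<in> unit_disk" using norm_triangle_ineq2[of x p] p by (simp add: r0_def dist_norm norm_minus_commute)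
  qed
  obtain C0 where C0: "C0 > 0" "\<And>f g E x. spin_system h f g \<Longrightarrow> energy_bound f g E \<Longrightarrow> E \<le> \<epsilon> \<Longrightarrow> x \<in> ball p r0 \<Longrightarrow> norm (f x) + norm (g x) \<le> C0 * root 4 E"
    using spin_system_local_sup[of h B p \<epsilon>] hB B p small unfolding r0_def by blast
  show ?thesis
  proof (cases "\<exists>f g. spin_system h f g \<and> (\<exists>w. wderiv w f p \<noteq> 0 \<or> wderiv w g p \<noteq> 0)")
    case True
    then obtain f0 g0 where sys0: "spin_system h f0 g0" and nf: "\<exists>w. wderiv w f0 p \<noteq> 0 \<or> wderiv w g0 p \<noteq> 0" by blast
    \<comment> \<open>The witness solution serves to make \<open>h\<close> conical at
      \<open>p\<close>; the induction on \<open>k\<close> then treats arbitrary solutions.\<close>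
    obtain R where R: "R > 0" "cball p R \<subseteq> unit_disk" "conical_at p R h"
      using spin_system_conical[OF sys0 p hB nf] by blast
    have bR: "ball p R \<subseteq> unit_disk" using R(2) ball_subset_cball by blast
    show ?thesis
    proof (induction k)
      case 0
      have "norm (f x) \<le> C0 * root 4 E \<and> norm (g x) \<le> C0 * root 4 E"
        if "spin_system h f g" "energy_bound f g E" "E \<le> \<epsilon>" "x \<in> ball p r0" for f g E x
        using C0(2)[OF that] norm_ge_zero[of "f x"] norm_ge_zero[of "g x"] by linarith
      then show ?case using r0 C0(1) r0D by (intro exI[of _ r0] conjI exI[of _ C0]) auto
    next
      case (Suc k)
      then obtain r C where r: "r > 0" and C: "C > 0" and sub: "ball p r \<subseteq> unit_disk"
        and est: "\<And>f g E x i. spin_system h f g \<Longrightarrow> energy_bound f g E \<Longrightarrow> E \<le> \<epsilon> \<Longrightarrow> x \<in> ball p r \<Longrightarrow> i \<le> k \<Longrightarrow>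
          Dnorm i f x \<le> C * root 4 E \<and> Dnorm i g x \<le> C * root 4 E" by blast
      \<comment> \<open>For \<open>E \<le> \<epsilon>\<close> the lower-order bound
        \<open>C * root 4 E\<close> stays below this number, so the constant of the next step does
        not depend on \<open>E\<close>.\<close>
      have L: "C * root 4 \<epsilon> \<ge> 0" using C \<epsilon> by simp
      obtain r' C' where r': "r' > 0" "C' > 0"
        "\<And>f g A x. spin_system h f g \<Longrightarrow> 0 \<le> A \<Longrightarrow> A \<le> C * root 4 \<epsilon> \<Longrightarrow>
         (\<And>x i. x \<in> ball p r \<Longrightarrow> i < Suc k \<Longrightarrow> Dnorm i f x \<le> A \<and> Dnorm i g x \<le> A) \<Longrightarrow>
         x \<in> ball p r' \<Longrightarrow> Dnorm (Suc k) f x \<le> C' * A \<and> Dnorm (Suc k) g x \<le> C' * A"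
        by (rule spin_system_step[OF R(3) bR R(1) _ L r, of "Suc k"]) auto
      define C'' where "C'' = max C (C' * C)"
      have "Dnorm i f x \<le> C'' * root 4 E \<and> Dnorm i g x \<le> C'' * root 4 E"
        if sys: "spin_system h f g" and E: "energy_bound f g E" "E \<le> \<epsilon>" and x: "x \<in> ball p (min r r')" and i: "i \<le> Suc k" for f g E x i
      proof -
        have E0: "E > 0" using E by (simp add: energy_bound_def)
        have le: "C * root 4 E \<le> C'' * root 4 E" "C' * (C * root 4 E) \<le> C'' * root 4 E"
          using E0 by (auto simp: C''_def mult.assoc[symmetric] intro!: mult_right_mono)
        show ?thesis
        proof (cases "i \<le> k")
          case True
          then show ?thesis using est[OF sys E, of x i] x le(1) by (auto intro: order_trans)
        next
          case False
          then have "i = Suc k" using i by simp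
          moreover have "Dnorm (Suc k) f x \<le> C' * (C * root 4 E) \<and> Dnorm (Suc k) g x \<le> C' * (C * root 4 E)"
          proof (rule r'(3)[OF sys])
            show "C * root 4 E \<le> C * root 4 \<epsilon>" using E C by (intro mult_left_mono) auto
          qed (use est[OF sys E] x C E0 in auto)
          ultimately show ?thesis using le(2) by (auto intro: order_trans simp del: Dnorm.simps)
        qed
      qed
      moreover have "ball p (min r r') \<subseteq> unit_disk" using sub by auto
      moreover have "C'' > 0" using C by (simp add: C''_def)
      ultimately show ?case using r r'(1) by (intro exI[of _ "min r r'"] conjI exI[of _ C'']) (auto simp del: Dnorm.simps)
    qed
  next
    case False
    define K where "K = (B + 2) * (C0 * root 4 \<epsilon>)\<^sup>2"
    have K: "K \<ge> 0" using B by (simp add: K_def)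
    \<comment> \<open>The first entry keeps the disk of radius \<open>10 * \<rho>\<close> where the
      sup bound holds; the second yields \<open>64 * \<rho> * K \<le> kern_mass\<close>, with
      \<open>K + 1\<close> to avoid division by 0.\<close>
    define \<rho> where "\<rho> = min (r0 / 20) (kern_mass / (64 * (K + 1)))"
    have "kern_mass / (64 * (K + 1)) > 0" using K kern_mass_pos by simp
    then have \<rho>: "\<rho> > 0" "\<rho> \<le> r0 / 20" "\<rho> \<le> kern_mass / (64 * (K + 1))"
      unfolding \<rho>_def using r0 by (simp_all only: min.cobounded1 min.cobounded2)
    have sm: "64 * \<rho> * K \<le> kern_mass"
    proof -
      have "64 * \<rho> * K \<le> 64 * \<rho> * (K + 1)" using \<rho>(1) by simp
      also have "\<dots> \<le> 64 * (kern_mass / (64 * (K + 1))) * (K + 1)" using \<rho>(3) K by (intro mult_right_mono mult_left_mono) auto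
      also have "\<dots> = kern_mass"
      proof -
        have eq: "64 * (kern_mass / (64 * t)) * t = kern_mass" if "t > 0" for t :: real using that by simp
        show ?thesis by (rule eq) (use K in simp)
      qed
      finally show ?thesis .
    qed
    have cs: "cball p (10 * \<rho>) \<subseteq> ball p r0" using \<rho> r0 by auto
    \<comment> \<open>All these solutions vanish on the disk, so any constant serves; 1 is
      taken.\<close>
    have "Dnorm i f x \<le> 1 * root 4 E \<and> Dnorm i g x \<le> 1 * root 4 E"
      if sys: "spin_system h f g" and E: "energy_bound f g E" "E \<le> \<epsilon>" and x: "x \<in> ball p \<rho>" for f g E x i
    proof -
      have E0: "E > 0" using E by (simp add: energy_bound_def)
      have fg: "smooth_on unit_disk f" "smooth_on unit_disk g" using sys by (auto simp: spin_system_def)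
      have lin: "(B + 2) * (norm (f z) + norm (g z)) ^ 3 \<le> K * (norm (f z) + norm (g z))" if z: "z \<in> ball p r0" for z
      proof -
        have "C0 * root 4 E \<le> C0 * root 4 \<epsilon>" using E(2) C0(1) by (intro mult_left_mono) auto
        then have "norm (f z) + norm (g z) \<le> C0 * root 4 \<epsilon>" by (rule order_trans[OF C0(2)[OF sys E z]])
        then have "(norm (f z) + norm (g z))\<^sup>2 \<le> (C0 * root 4 \<epsilon>)\<^sup>2" by (intro power_mono) auto
        then have "(B + 2) * ((norm (f z) + norm (g z))\<^sup>2 * (norm (f z) + norm (g z))) \<le> (B + 2) * ((C0 * root 4 \<epsilon>)\<^sup>2 * (norm (f z) + norm (g z)))"
          using B by (intro mult_left_mono mult_right_mono) auto
        then show ?thesis by (simp add: K_def power3_eq_cube power2_eq_square mult.assoc)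
      qed
      have zero: "f y = 0 \<and> g y = 0" if y: "y \<in> ball p \<rho>" for y
      proof (rule flat_imp_zero[OF _ _ \<rho>(1) fg _ _ K sm _ y])
        show "cball p (10 * \<rho>) \<subseteq> unit_disk" using cs r0D by blast
        fix z assume "z \<in> cball p (10 * \<rho>)"
        then have z: "z \<in> ball p r0" "z \<in> unit_disk" using cs r0D by blast+
        show "norm (dbar f z) \<le> K * (norm (f z) + norm (g z))"
          by (rule order_trans[OF spin_system_cubic_bound(1)[OF sys z(2) hB[OF z(2)]] lin[OF z(1)]])
        show "norm (dbar g z) \<le> K * (norm (f z) + norm (g z))"
          by (rule order_trans[OF spin_system_cubic_bound(2)[OF sys z(2) hB[OF z(2)]] lin[OF z(1)]])
      qed (use False sys in auto)
      have "Dnorm i u x = Dnorm i (\<lambda>z. 0 :: complex) x" if "u = f \<or> u = g" for u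
        by (rule Dnorm_cong[OF open_ball _ x]) (use zero that in auto)
      then show ?thesis using E0 by simp
    qed
    moreover have "ball p \<rho> \<subseteq> unit_disk" using r0D \<rho> r0 by (auto simp: subset_eq)
    ultimately show ?thesis using \<rho>(1) by (intro exI[of _ \<rho>] conjI exI[of _ 1]) auto
  qed
qed

subsection \<open>Weak derivatives\<close>

text \<open>The derivatives of \<open>exp (-1/x)\<close> on the positive half line are combinations of the functions \<open>exp_step m\<close>.\<close>

definition exp_step :: "nat \<Rightarrow> real \<Rightarrow> real" where
  "exp_step m x = (if x \<le> 0 then 0 else exp (- inverse x) * inverse x ^ m)"

lemma exp_step_tendsto_0: "(exp_step m \<longlongrightarrow> 0) (at_right 0)"
proof -
  have "((\<lambda>x::real. (inverse x) ^ m / exp (inverse x)) \<longlongrightarrow> 0) (at_right 0)"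
    by (rule filterlim_compose[OF tendsto_power_div_exp_0 filterlim_inverse_at_top_right])
  then show ?thesis
  proof (rule Lim_transform_eventually)
    show "\<forall>\<^sub>F x in at_right 0. (inverse x) ^ m / exp (inverse x) = exp_step m x"
      unfolding eventually_at_right_field by (intro exI[of _ 1]) (auto simp: exp_step_def exp_minus field_simps)
  qed
qed

lemma has_real_derivative_exp_step:
  "(exp_step m has_real_derivative exp_step (m + 2) x - of_nat m * exp_step (m + 1) x) (at x)"
proof -
  consider "x > 0" | "x < 0" | "x = 0" by linarith
  then show ?thesis
  proof cases
    case 1
    have i: "((\<lambda>x::real. inverse x) has_real_derivative - (inverse x * inverse x)) (at x)"
      using 1 by (auto intro!: derivative_eq_intros simp: power2_eq_square)
    have e: "((\<lambda>x::real. exp (- inverse x)) has_real_derivative exp (- inverse x) * (inverse x * inverse x)) (at x)"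
      using DERIV_chain2[OF DERIV_exp DERIV_minus[OF i]] by simp
    have "((\<lambda>x. exp (- inverse x) * inverse x ^ m) has_real_derivative
      exp (- inverse x) * (inverse x * inverse x) * inverse x ^ m + (of_nat m * (- (inverse x * inverse x) * inverse x ^ (m - Suc 0))) * exp (- inverse x)) (at x)"
      by (rule DERIV_mult[OF e DERIV_power[OF i]])
    moreover have "exp (- inverse x) * (inverse x * inverse x) * inverse x ^ m + (of_nat m * (- (inverse x * inverse x) * inverse x ^ (m - Suc 0))) * exp (- inverse x)
      = exp_step (m + 2) x - of_nat m * exp_step (m + 1) x"
      using 1 by (cases m) (simp_all add: exp_step_def algebra_simps)
    ultimately have "((\<lambda>x. exp (- inverse x) * inverse x ^ m) has_real_derivative exp_step (m + 2) x - of_nat m * exp_step (m + 1) x) (at x)"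
      by simp
    then show ?thesis
      by (rule has_field_derivative_transform_within_open[where S = "{0<..}"]) (use 1 in \<open>auto simp: exp_step_def\<close>)
  next
    case 2
    have "((\<lambda>x::real. 0) has_real_derivative 0) (at x)" by simp
    then have "(exp_step m has_real_derivative 0) (at x)"
      by (rule has_field_derivative_transform_within_open[where S = "{..<0}"]) (use 2 in \<open>auto simp: exp_step_def\<close>)
    then show ?thesis using 2 by (simp add: exp_step_def)
  next
    \<comment> \<open>From the right the difference quotient is \<open>exp_step (Suc m)\<close>,
      which tends to 0 because the exponential beats every power; from the left it is 0.\<close>
    case 3
    have "((\<lambda>h. exp_step m h / h) \<longlongrightarrow> 0) (at_right 0)"
      using exp_step_tendsto_0[of "Suc m"]
    proof (rule Lim_transform_eventually)
      show "\<forall>\<^sub>F h in at_right 0. exp_step (Suc m) h = exp_step m h / h"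
        unfolding eventually_at_right_field by (intro exI[of _ 1]) (auto simp: exp_step_def field_simps)
    qed
    moreover have "((\<lambda>h. exp_step m h / h) \<longlongrightarrow> 0) (at_left 0)"
    proof (rule Lim_transform_eventually[OF tendsto_const])
      show "\<forall>\<^sub>F h in at_left 0. 0 = exp_step m h / h"
        unfolding eventually_at_left_field by (intro exI[of _ "-1"]) (auto simp: exp_step_def)
    qed
    ultimately have "((\<lambda>h. exp_step m h / h) \<longlongrightarrow> 0) (at 0)" by (simp add: filterlim_split_at)
    then show ?thesis using 3 by (simp add: DERIV_def exp_step_def)
  qed
qed

lemma smooth_on_exp_step_affine: "smooth_on UNIV (\<lambda>z::plane. exp_step m (c \<bullet> z + d))"
proof -
  have d: "((\<lambda>z::plane. exp_step m (c \<bullet> z + d)) has_derivative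
      (\<lambda>h. (exp_step (m + 2) (c \<bullet> z + d) - of_nat m * exp_step (m + 1) (c \<bullet> z + d)) * (c \<bullet> h))) (at z)" for m z
  proof -
    have "((\<lambda>z::plane. c \<bullet> z + d) has_derivative (\<lambda>h. c \<bullet> h)) (at z)"
      by (auto intro!: derivative_eq_intros)
    from has_derivative_compose[OF this has_field_derivative_imp_has_derivative[OF has_real_derivative_exp_step]]
    show ?thesis .
  qed
  have "Ck_on k UNIV (\<lambda>z::plane. exp_step m (c \<bullet> z + d))" for k
  proof (induction k arbitrary: m)
    case 0 show ?case unfolding Ck_on.simps
      by (intro continuous_at_imp_continuous_on ballI has_derivative_continuous[OF d])
  next
    case (Suc k)
    have "partial_deriv v (\<lambda>z::plane. exp_step m (c \<bullet> z + d)) =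
      (\<lambda>z. (c \<bullet> v) * (exp_step (m + 2) (c \<bullet> z + d) + (- of_nat m) * exp_step (m + 1) (c \<bullet> z + d)))" for v
      by (rule ext) (use partial_deriv_at[OF d] in simp)
    moreover have "Ck_on k UNIV (\<lambda>z. (c \<bullet> v) * (exp_step (m + 2) (c \<bullet> z + d) + (- of_nat m) * exp_step (m + 1) (c \<bullet> z + d)))" for v
      by (intro Ck_on_bounded_linear[OF bounded_linear_mult_right] Ck_on_add Suc) auto
    ultimately show ?case using differentiableI[OF d] by simp
  qed
  then show ?thesis by (simp add: smooth_on_def)
qed

text \<open>A smooth approximation of the indicator of a box from below:
  \<open>exp_step 0 (n * x)\<close> is 0 for \<open>x \<le> 0\<close> and tends to 1 for
  \<open>x > 0\<close> as \<open>n\<close> grows.\<close>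

definition box_bump :: "plane \<Rightarrow> plane \<Rightarrow> real \<Rightarrow> plane \<Rightarrow> real" where
  "box_bump a b n z = exp_step 0 (n * (fst z - fst a)) * exp_step 0 (n * (fst b - fst z))
     * (exp_step 0 (n * (snd z - snd a)) * exp_step 0 (n * (snd b - snd z)))"

lemma exp_step_bounds: "0 \<le> exp_step 0 x" "exp_step 0 x \<le> 1"
  by (auto simp: exp_step_def)

lemma smooth_on_box_bump: "smooth_on UNIV (box_bump a b n)"
proof -
  have "smooth_on UNIV (\<lambda>z::plane. exp_step 0 (n * (fst z - fst a)))" "smooth_on UNIV (\<lambda>z::plane. exp_step 0 (n * (fst b - fst z)))"
    "smooth_on UNIV (\<lambda>z::plane. exp_step 0 (n * (snd z - snd a)))" "smooth_on UNIV (\<lambda>z::plane. exp_step 0 (n * (snd b - snd z)))"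
    using smooth_on_exp_step_affine[of 0 "(n, 0)" "- n * fst a"] smooth_on_exp_step_affine[of 0 "(- n, 0)" "n * fst b"]
      smooth_on_exp_step_affine[of 0 "(0, n)" "- n * snd a"] smooth_on_exp_step_affine[of 0 "(0, - n)" "n * snd b"]
    by (simp_all add: inner_prod_def algebra_simps)
  then show ?thesis unfolding box_bump_def[abs_def] by (intro smooth_on_mult) auto
qed

lemma mem_box_plane: "z \<in> box a b \<longleftrightarrow> fst a < fst z \<and> fst z < fst b \<and> snd a < snd z \<and> snd z < snd b" for z a b :: plane
  by (cases a; cases b; cases z) (auto simp: box_def Basis_prod_def)

lemma box_bump_eq_0: "n > 0 \<Longrightarrow> z \<notin> box a b \<Longrightarrow> box_bump a b n z = 0"
  by (auto simp: box_bump_def mem_box_plane exp_step_def mult_le_0_iff not_less)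

lemma box_bump_bounds: "0 \<le> box_bump a b n z" "box_bump a b n z \<le> 1"
  unfolding box_bump_def by (intro mult_nonneg_nonneg mult_le_one exp_step_bounds)+

lemma test_function_box_bump:
  assumes "n > 0" "cbox a b \<subseteq> \<Omega>"
  shows "test_function \<Omega> (box_bump a b n)"
proof -
  have "{z. box_bump a b n z \<noteq> 0} \<subseteq> cbox a b" using box_bump_eq_0[OF assms(1)] box_subset_cbox[of a b] by blast
  then have c: "closure {z. box_bump a b n z \<noteq> 0} \<subseteq> cbox a b" by (rule closure_minimal) (rule closed_cbox)
  moreover have "compact (closure {z. box_bump a b n z \<noteq> 0})"
    using c bounded_subset[OF bounded_cbox] by (auto simp: compact_eq_bounded_closed)
  ultimately show ?thesis using assms(2) smooth_on_box_bump by (simp add: test_function_def)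
qed

lemma box_bump_tendsto:
  "(\<lambda>n. box_bump a b (real (Suc n)) z) \<longlonglongrightarrow> indicator (box a b) z"
proof (cases "z \<in> box a b")
  case False
  then show ?thesis by (simp add: box_bump_eq_0)
next
  case True
  have l: "(\<lambda>n. exp_step 0 (real (Suc n) * x)) \<longlonglongrightarrow> 1" if "x > 0" for x
  proof -
    have "filterlim (\<lambda>n. real (Suc n)) at_top sequentially"
      by (rule filterlim_compose[OF filterlim_real_sequentially filterlim_Suc])
    from filterlim_tendsto_pos_mult_at_top[OF tendsto_const that this]
    have "filterlim (\<lambda>n. real (Suc n) * x) at_top sequentially" by (simp only: mult.commute)
    then have "(\<lambda>n. inverse (real (Suc n) * x)) \<longlonglongrightarrow> 0" by (rule tendsto_inverse_0_at_top)
    then have "(\<lambda>n. exp (- inverse (real (Suc n) * x))) \<longlonglongrightarrow> exp (- 0)" by (intro tendsto_intros)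
    moreover have "\<not> real (Suc n) * x \<le> 0" for n using that by (simp add: not_le)
    ultimately show ?thesis by (simp add: exp_step_def)
  qed
  have "(\<lambda>n. box_bump a b (real (Suc n)) z) \<longlonglongrightarrow> 1 * 1 * (1 * 1)"
    unfolding box_bump_def using True by (intro tendsto_mult l) (auto simp: mem_box_plane)
  then show ?thesis using True by simp
qed

section \<open>Test functions and integration by parts\<close>

lemma test_function_zero_outside:
  assumes "test_function \<Omega> \<phi>" "z \<notin> closure {z. \<phi> z \<noteq> 0}"
  shows "\<phi> z = 0" "partial_deriv v \<phi> z = 0"
proof -
  let ?U = "- closure {z. \<phi> z \<noteq> 0}"
  have z: "\<phi> x = 0" if "x \<in> ?U" for x using that closure_subset[of "{z. \<phi> z \<noteq> 0}"] by blast
  have mem: "z \<in> ?U" using assms(2) by simp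
  show "\<phi> z = 0" by (rule z[OF mem])
  have "partial_deriv v \<phi> z = partial_deriv v (\<lambda>z. 0) z"
    by (rule partial_deriv_cong[OF _ mem z]) auto
  then show "partial_deriv v \<phi> z = 0" by simp
qed

lemma test_function_partial_deriv:
  assumes "test_function \<Omega> \<phi>"
  shows "test_function \<Omega> (partial_deriv v \<phi>)"
proof -
  let ?K = "closure {z. \<phi> z \<noteq> 0}"
  have "{z. partial_deriv v \<phi> z \<noteq> 0} \<subseteq> ?K" using test_function_zero_outside(2)[OF assms] by blast
  then have c: "closure {z. partial_deriv v \<phi> z \<noteq> 0} \<subseteq> ?K" by (rule closure_minimal) simp
  moreover have "compact (closure {z. partial_deriv v \<phi> z \<noteq> 0})"
    using bounded_subset[OF compact_imp_bounded c] assms by (simp add: test_function_def compact_eq_bounded_closed)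
  ultimately show ?thesis using assms by (auto simp: test_function_def smooth_on_partial_deriv)
qed

lemma test_function_integrable:
  fixes w :: "plane \<Rightarrow> spinor"
  assumes \<phi>: "test_function \<Omega> \<phi>" and w: "locally_integrable_on \<Omega> w"
  shows "set_integrable lborel \<Omega> (\<lambda>z. \<phi> z *\<^sub>R w z)"
proof -
  let ?K = "closure {z. \<phi> z \<noteq> 0}"
  have K: "compact ?K" "?K \<subseteq> \<Omega>" using \<phi> by (auto simp: test_function_def)
  have c: "continuous_on UNIV \<phi>" using \<phi> by (auto simp: test_function_def intro: smooth_on_continuous)
  have "bounded (\<phi> ` ?K)" using K(1) continuous_on_subset[OF c] by (intro compact_imp_bounded compact_continuous_image) auto
  then obtain C where C: "\<And>z. z \<in> ?K \<Longrightarrow> norm (\<phi> z) \<le> C" unfolding bounded_iff by auto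
  have i: "integrable lborel (\<lambda>z. indicator ?K z *\<^sub>R w z)" using w K by (auto simp: locally_integrable_on_def set_integrable_def)
  have eq: "indicator \<Omega> z *\<^sub>R (\<phi> z *\<^sub>R w z) = \<phi> z *\<^sub>R (indicator ?K z *\<^sub>R w z)" for z
    using test_function_zero_outside(1)[OF \<phi>, of z] K(2) by (auto simp: indicator_def)
  have "integrable lborel (\<lambda>z. \<phi> z *\<^sub>R (indicator ?K z *\<^sub>R w z))"
  proof (rule Bochner_Integration.integrable_bound[OF integrable_scaleR_right[OF i, of C]])
    have "\<phi> \<in> borel_measurable lborel" using borel_measurable_continuous_onI[OF c] by simp
    then show "(\<lambda>z. \<phi> z *\<^sub>R (indicator ?K z *\<^sub>R w z)) \<in> borel_measurable lborel"
      using borel_measurable_integrable[OF i] by (rule borel_measurable_scaleR)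
    show "AE z in lborel. norm (\<phi> z *\<^sub>R (indicator ?K z *\<^sub>R w z)) \<le> norm (C *\<^sub>R (indicator ?K z *\<^sub>R w z))"
      by (rule AE_I2) (auto simp: indicator_def intro!: mult_right_mono order_trans[OF C abs_ge_self, simplified])
  qed
  then show ?thesis unfolding set_integrable_def eq .
qed

lemma locally_integrable_continuous: "continuous_on \<Omega> f \<Longrightarrow> locally_integrable_on \<Omega> f"
  unfolding locally_integrable_on_def set_integrable_def
  by (auto intro: borel_integrable_compact continuous_on_subset)

text \<open>The product \<open>\<phi> f\<close>, extended by 0, is continuously differentiable on
  the plane, since \<open>\<Omega>\<close> and the complement of the support of
  \<open>\<phi>\<close> cover it. Its derivative integrates to 0 over a box around the
  support.\<close>

lemma test_function_by_parts:
  fixes f :: "plane \<Rightarrow> spinor"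
  assumes \<Omega>: "open \<Omega>" and \<phi>: "test_function \<Omega> \<phi>" and f: "smooth_on \<Omega> f"
  shows "(LINT z:\<Omega>|lborel. partial_deriv (dir c) \<phi> z *\<^sub>R f z) = - (LINT z:\<Omega>|lborel. \<phi> z *\<^sub>R partial_deriv (dir c) f z)"
proof -
  let ?K = "closure {z. \<phi> z \<noteq> 0}" and ?p = "partial_deriv (dir c)"
  have K: "compact ?K" "?K \<subseteq> \<Omega>" using \<phi> by (auto simp: test_function_def)
  have s\<phi>: "smooth_on UNIV \<phi>" using \<phi> by (auto simp: test_function_def)
  define G where "G z = (if z \<in> \<Omega> then \<phi> z *\<^sub>R f z else 0)" for z
  have G_out: "G z = 0" if "z \<notin> ?K" for z using test_function_zero_outside(1)[OF \<phi> that] by (simp add: G_def)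
  have GO: "smooth_on \<Omega> G"
  proof (rule smooth_on_cong[OF \<Omega>, THEN iffD1])
    show "smooth_on \<Omega> (\<lambda>z. \<phi> z *\<^sub>R f z)" by (rule smooth_on_scaleR[OF \<Omega> smooth_on_subset[OF s\<phi>] f]) simp
  qed (simp add: G_def)
  have oK: "open (- ?K)" by auto
  have GK: "smooth_on (- ?K) G"
  proof (rule smooth_on_cong[OF oK, THEN iffD1])
    show "smooth_on (- ?K) (\<lambda>z. 0 :: spinor)" by simp
  qed (use G_out in simp)
  have d: "G differentiable (at z)" for z
    using smooth_on_differentiable[OF GO, of z] smooth_on_differentiable[OF GK, of z] K(2) by blast
  have cG: "continuous_on UNIV (?p G)"
  proof -
    have "continuous_on (\<Omega> \<union> - ?K) (?p G)"
      by (intro continuous_on_open_Un \<Omega> oK smooth_on_continuous smooth_on_partial_deriv GO GK)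
    moreover have "\<Omega> \<union> - ?K = UNIV" using K(2) by blast
    ultimately show ?thesis by simp
  qed
  have pG_out: "?p G z = 0" if "z \<notin> ?K" for z
    using partial_deriv_cong[OF oK, of z G "\<lambda>z. 0"] that G_out by simp
  have pG: "indicator \<Omega> z *\<^sub>R (?p \<phi> z *\<^sub>R f z) + indicator \<Omega> z *\<^sub>R (\<phi> z *\<^sub>R ?p f z) = ?p G z" for z
  proof (cases "z \<in> \<Omega>")
    case True
    have "?p G z = ?p (\<lambda>z. \<phi> z *\<^sub>R f z) z" by (rule partial_deriv_cong[OF \<Omega> True]) (simp add: G_def)
    also have "\<dots> = ?p \<phi> z *\<^sub>R f z + \<phi> z *\<^sub>R ?p f z"
      using True by (intro partial_deriv_bilinear[OF bounded_bilinear_scaleR] smooth_on_differentiable[OF s\<phi>] smooth_on_differentiable[OF f]) auto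
    finally show ?thesis using True by simp
  next
    case False then show ?thesis using pG_out[of z] K(2) by auto
  qed
  obtain M where M: "M > 0" "?K \<subseteq> box (- M, - M) (M, M)"
  proof -
    obtain M where M: "\<And>z. z \<in> ?K \<Longrightarrow> norm z \<le> M" using K(1) compact_imp_bounded bounded_iff by metis
    have "z \<in> box (- (\<bar>M\<bar> + 1), - (\<bar>M\<bar> + 1)) (\<bar>M\<bar> + 1, \<bar>M\<bar> + 1)" if "z \<in> ?K" for z
      using M[OF that] norm_fst_le[of "fst z" "snd z"] norm_snd_le[of "snd z" "fst z"] by (auto simp: mem_box_plane abs_le_iff)
    then show ?thesis by (intro that[of "\<bar>M\<bar> + 1"]) auto
  qed
  let ?C = "cbox (- M, - M) (M, M) :: plane set"
  have z0: "G (x, y) = 0" if "\<bar>x\<bar> = M \<or> \<bar>y\<bar> = M" for x y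
    using that M by (intro G_out) (auto simp: subset_iff mem_box_plane)
  have "integral ?C (?p G) = 0"
    using M(1) d continuous_on_subset[OF cG] z0
    by (cases c) (auto intro!: integral_deriv_x_zero integral_deriv_y_zero)
  moreover have iG: "set_integrable lborel ?C (?p G)"
    unfolding set_integrable_def using continuous_on_subset[OF cG] by (intro borel_integrable_compact) auto
  ultimately have "(LINT z:?C|lborel. ?p G z) = 0" using set_borel_integral_eq_integral(2)[OF iG] by simp
  then have "(LINT z|lborel. ?p G z) = 0"
  proof -
    have "indicator ?C z *\<^sub>R ?p G z = ?p G z" for z
      using pG_out[of z] M(2) box_subset_cbox by (cases "z \<in> ?C") (auto simp: subset_iff)
    then show ?thesis using \<open>(LINT z:?C|lborel. ?p G z) = 0\<close> by (simp add: set_lebesgue_integral_def)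
  qed
  moreover have "(LINT z|lborel. ?p G z) = (LINT z:\<Omega>|lborel. ?p \<phi> z *\<^sub>R f z) + (LINT z:\<Omega>|lborel. \<phi> z *\<^sub>R ?p f z)"
  proof -
    have 1: "set_integrable lborel \<Omega> (\<lambda>z. ?p \<phi> z *\<^sub>R f z)"
      by (intro test_function_integrable test_function_partial_deriv \<phi> locally_integrable_continuous smooth_on_continuous f)
    have 2: "set_integrable lborel \<Omega> (\<lambda>z. \<phi> z *\<^sub>R ?p f z)"
      by (intro test_function_integrable \<phi> locally_integrable_continuous smooth_on_continuous smooth_on_partial_deriv f)
    show ?thesis
      using Bochner_Integration.integral_add[OF 1[unfolded set_integrable_def] 2[unfolded set_integrable_def]] pG
      by (simp add: set_lebesgue_integral_def)
  qed
  ultimately show ?thesis by (simp add: add_eq_0_iff)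
qed

text \<open>The derivative applied last to \<open>\<phi>\<close> is the first to be moved to
  \<open>f\<close>, which reverses the word.\<close>

lemma wderiv_by_parts:
  fixes f :: "plane \<Rightarrow> spinor"
  assumes \<Omega>: "open \<Omega>" and f: "smooth_on \<Omega> f"
  shows "test_function \<Omega> \<phi> \<Longrightarrow> (LINT z:\<Omega>|lborel. wderiv w \<phi> z *\<^sub>R f z) = (- 1) ^ length w *\<^sub>R (LINT z:\<Omega>|lborel. \<phi> z *\<^sub>R wderiv (rev w) f z)"
proof (induction w arbitrary: \<phi>)
  case (Cons c w)
  have "(LINT z:\<Omega>|lborel. wderiv (c # w) \<phi> z *\<^sub>R f z) = (- 1) ^ length w *\<^sub>R (LINT z:\<Omega>|lborel. partial_deriv (dir c) \<phi> z *\<^sub>R wderiv (rev w) f z)"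
    using Cons.IH[OF test_function_partial_deriv[OF Cons.prems]] by simp
  also have "\<dots> = (- 1) ^ length w *\<^sub>R - (LINT z:\<Omega>|lborel. \<phi> z *\<^sub>R partial_deriv (dir c) (wderiv (rev w) f) z)"
    by (subst test_function_by_parts[OF \<Omega> Cons.prems smooth_on_wderiv[OF f]]) simp
  finally show ?case by (simp add: wderiv_append)
qed simp

lemma smooth_is_weak_deriv:
  assumes \<Omega>: "open \<Omega>" and f: "smooth_on \<Omega> f"
  shows "is_weak_deriv \<Omega> \<alpha> f (mi_deriv \<alpha> f)"
  unfolding is_weak_deriv_def
proof (intro conjI allI impI)
  show "locally_integrable_on \<Omega> f" by (intro locally_integrable_continuous smooth_on_continuous f)
  show "locally_integrable_on \<Omega> (mi_deriv \<alpha> f)"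
    by (intro locally_integrable_continuous smooth_on_continuous smooth_on_mi_deriv f)
  fix \<phi> assume \<phi>: "test_function \<Omega> \<phi>"
  let ?w = "replicate (snd \<alpha>) False @ replicate (fst \<alpha>) True"
  have "mi_deriv \<alpha> f z = wderiv (rev ?w) f z" if "z \<in> \<Omega>" for z
    using wderiv_eq_mi_deriv[OF \<Omega> f that, of "rev ?w"] by (simp add: count_list_replicate)
  then have "(LINT z:\<Omega>|lborel. \<phi> z *\<^sub>R mi_deriv \<alpha> f z) = (LINT z:\<Omega>|lborel. \<phi> z *\<^sub>R wderiv (rev ?w) f z)"
    unfolding set_lebesgue_integral_def by (intro Bochner_Integration.integral_cong) (auto simp: indicator_def)
  moreover have "mi_deriv \<alpha> \<phi> = wderiv ?w \<phi>" using mi_deriv_eq_wderiv[of "fst \<alpha>" "snd \<alpha>" \<phi>] by simp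
  ultimately show "(LINT z:\<Omega>|lborel. mi_deriv \<alpha> \<phi> z *\<^sub>R f z) = (- 1) ^ mi_order \<alpha> *\<^sub>R (LINT z:\<Omega>|lborel. \<phi> z *\<^sub>R mi_deriv \<alpha> f z)"
    using wderiv_by_parts[OF \<Omega> f \<phi>, of ?w] by (simp add: mi_order_def add.commute)
qed

section \<open>Uniqueness of weak derivatives\<close>

lemma fundamental_lemma_box:
  fixes u :: "plane \<Rightarrow> spinor"
  assumes u: "locally_integrable_on \<Omega> u" and sub: "cbox a b \<subseteq> \<Omega>"
    and z: "\<And>\<phi>. test_function \<Omega> \<phi> \<Longrightarrow> (LINT z:\<Omega>|lborel. \<phi> z *\<^sub>R u z) = 0"
  shows "(LINT z:box a b|lborel. u z) = 0"
proof -
  have i: "integrable lborel (\<lambda>z. indicator (cbox a b) z *\<^sub>R u z)"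
    using u sub by (auto simp: locally_integrable_on_def set_integrable_def)
  let ?s = "\<lambda>n z. box_bump a b (real (Suc n)) z *\<^sub>R (indicator (cbox a b) z *\<^sub>R u z)"
  have bm: "box_bump a b n \<in> borel_measurable lborel" for n
    using borel_measurable_continuous_onI[OF smooth_on_continuous[OF smooth_on_box_bump]] by simp
  \<comment> \<open>The bumps are between 0 and 1 and live on the closed box, on which
    \<open>u\<close> is integrable; this gives the dominating function.\<close>
  have lim: "(\<lambda>n. LINT z|lborel. ?s n z) \<longlonglongrightarrow> (LINT z|lborel. indicator (box a b) z *\<^sub>R (indicator (cbox a b) z *\<^sub>R u z))"
  proof (rule integral_dominated_convergence[where w = "\<lambda>z. norm (indicator (cbox a b) z *\<^sub>R u z)"])
    show "(\<lambda>z. indicator (box a b) z *\<^sub>R (indicator (cbox a b) z *\<^sub>R u z)) \<in> borel_measurable lborel"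
      by (rule borel_measurable_scaleR[OF _ borel_measurable_integrable[OF i]]) simp
    show "?s n \<in> borel_measurable lborel" for n
      by (rule borel_measurable_scaleR[OF bm borel_measurable_integrable[OF i]])
    show "integrable lborel (\<lambda>z. norm (indicator (cbox a b) z *\<^sub>R u z))" by (rule integrable_norm[OF i])
    show "AE z in lborel. (\<lambda>n. ?s n z) \<longlonglongrightarrow> indicator (box a b) z *\<^sub>R (indicator (cbox a b) z *\<^sub>R u z)"
      by (intro AE_I2 tendsto_scaleR box_bump_tendsto tendsto_const)
    show "AE z in lborel. norm (?s n z) \<le> norm (indicator (cbox a b) z *\<^sub>R u z)" for n
      using box_bump_bounds[of a b "real (Suc n)"] by (intro AE_I2) (simp only: norm_scaleR, simp add: mult_left_le_one_le del: of_nat_Suc)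
  qed
  have zero: "(LINT z|lborel. ?s n z) = 0" for n
  proof -
    have "(LINT z|lborel. ?s n z) = (LINT z:\<Omega>|lborel. box_bump a b (real (Suc n)) z *\<^sub>R u z)"
      unfolding set_lebesgue_integral_def
    proof (rule Bochner_Integration.integral_cong)
      fix x
      show "?s n x = indicator \<Omega> x *\<^sub>R (box_bump a b (real (Suc n)) x *\<^sub>R u x)"
      proof (cases "x \<in> cbox a b")
        case True then show ?thesis using sub by auto
      next
        case False
        then have "x \<notin> box a b" using box_subset_cbox by blast
        then have "box_bump a b (real (Suc n)) x = 0" by (intro box_bump_eq_0) auto
        then show ?thesis by simp
      qed
    qed simp
    also have "\<dots> = 0" by (intro z test_function_box_bump sub) simp
    finally show ?thesis .
  qed
  have "(LINT z|lborel. indicator (box a b) z *\<^sub>R (indicator (cbox a b) z *\<^sub>R u z)) = 0"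
    by (rule LIMSEQ_unique[OF lim]) (simp only: zero tendsto_const)
  moreover have "(\<lambda>z. indicator (box a b) z *\<^sub>R (indicator (cbox a b) z *\<^sub>R u z)) = (\<lambda>z. indicator (box a b) z *\<^sub>R u z)"
    using box_subset_cbox[of a b] by (auto simp: fun_eq_iff indicator_def)
  ultimately show ?thesis by (simp only: set_lebesgue_integral_def)
qed

lemma box_Int_plane:
  "box a b \<inter> box c d = box (max (fst a) (fst c), max (snd a) (snd c)) (min (fst b) (fst d), min (snd b) (snd d))"
  for a b c d :: plane
  by (auto simp: mem_box_plane)

text \<open>Boxes are stable under intersection and generate the Borel sets, so the Dynkin system of
  sets over which the integral vanishes contains all Borel sets.\<close>

lemma ae_zero_of_box_integrals:
  fixes v :: "plane \<Rightarrow> spinor"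
  assumes v: "integrable lborel v" and z: "\<And>a b. (LINT z:box a b|lborel. v z) = 0"
  shows "AE z in lborel. v z = 0"
proof (rule sigma_finite_measure.density_zero[OF sigma_finite_lborel v])
  have si: "set_integrable lborel A v" if "A \<in> sets borel" for A
    unfolding set_integrable_def using that v by (intro integrable_mult_indicator) auto
  fix A assume "A \<in> sets (lborel :: plane measure)"
  then have sig: "A \<in> sigma_sets UNIV (range (\<lambda>(a, b). box a b :: plane set))"
    by (simp add: borel_eq_box)
  have "Int_stable (range (\<lambda>(a, b). box a b :: plane set))"
  proof (rule Int_stableI_image)
    fix i j :: "plane \<times> plane"
    show "\<exists>k\<in>UNIV. (case i of (a, b) \<Rightarrow> box a b) \<inter> (case j of (a, b) \<Rightarrow> box a b) = (case k of (a, b) \<Rightarrow> box a b)"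
      unfolding case_prod_beta box_Int_plane by (metis fst_conv snd_conv UNIV_I)
  qed
  moreover have "range (\<lambda>(a, b). box a b :: plane set) \<subseteq> Pow UNIV" by simp
  ultimately show "(LINT z:A|lborel. v z) = 0" using sig
  proof (induction rule: sigma_sets_induct_disjoint)
    case (basic A) then show ?case using z by auto
  next
    case empty show ?case by (simp add: set_lebesgue_integral_def)
  next
    case (compl A)
    then have A: "A \<in> sets borel" by (simp add: borel_eq_box)
    \<comment> \<open>The plane is an increasing union of boxes, so the total integral is 0 and
      complements can be subtracted.\<close>
    have lim: "(\<lambda>n. LINT z:box (- real n, - real n) (real n, real n)|lborel. v z) \<longlonglongrightarrow> (LINT z:(\<Union>n. box (- real n, - real n) (real n, real n))|lborel. v z)"
    proof (rule set_integral_cont_up)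
      show "incseq (\<lambda>n. box (- real n, - real n) (real n, real n) :: plane set)"
        by (auto simp: incseq_def mem_box_plane)
      show "set_integrable lborel (\<Union>n. box (- real n, - real n) (real n, real n)) v" by (rule si) auto
    qed auto
    have un: "(\<Union>n. box (- real n, - real n) (real n, real n)) = (UNIV :: plane set)"
    proof -
      have "\<exists>n. x \<in> box (- real n, - real n) (real n, real n)" for x :: plane
      proof -
        obtain n where "\<bar>fst x\<bar> + \<bar>snd x\<bar> < real n" using reals_Archimedean2 by blast
        then show ?thesis by (intro exI[of _ n]) (auto simp: mem_box_plane)
      qed
      then show ?thesis by auto
    qed
    have "(LINT z:UNIV|lborel. v z) = 0"
      by (rule LIMSEQ_unique[OF lim[unfolded un]]) (simp only: z tendsto_const)
    moreover have "(LINT z:A \<union> (UNIV - A)|lborel. v z) = (LINT z:A|lborel. v z) + (LINT z:(UNIV - A)|lborel. v z)"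
      using A by (intro set_integral_Un si) auto
    ultimately show ?case using compl by (simp add: Un_Diff_cancel)
  next
    case (union A)
    then have A: "\<And>i. A i \<in> sets borel" by (auto simp: borel_eq_box)
    have "(LINT z:(\<Union>i. A i)|lborel. v z) = (\<Sum>i. (LINT z:(A i)|lborel. v z))"
      using union A by (intro lebesgue_integral_countable_add si) (auto simp: disjoint_family_on_def)
    then show ?case using union by simp
  qed
qed

text \<open>By Lindelof, countably many boxes with closed boxes inside \<open>\<Omega>\<close> cover
  \<open>\<Omega>\<close>. Restricting \<open>u\<close> to one of them leads to integrals over
  intersections with other boxes, which are again such boxes.\<close>

lemma fundamental_lemma:
  fixes u :: "plane \<Rightarrow> spinor"
  assumes \<Omega>: "open \<Omega>" and u: "locally_integrable_on \<Omega> u"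
    and z: "\<And>\<phi>. test_function \<Omega> \<phi> \<Longrightarrow> (LINT z:\<Omega>|lborel. \<phi> z *\<^sub>R u z) = 0"
  shows "AE z in lborel. z \<in> \<Omega> \<longrightarrow> u z = 0"
proof -
  define F where "F = {box a b | a b. cbox a b \<subseteq> \<Omega>}"
  have "\<Union>F = \<Omega>"
  proof
    show "\<Union>F \<subseteq> \<Omega>" using box_subset_cbox by (fastforce simp: F_def)
    show "\<Omega> \<subseteq> \<Union>F"
    proof
      fix x assume "x \<in> \<Omega>"
      then obtain a b where "cbox a b \<subseteq> \<Omega>" "x \<in> box a b" using \<Omega> open_contains_cbox[of \<Omega> x] by metis
      then show "x \<in> \<Union>F" by (auto simp: F_def)
    qed
  qed
  moreover obtain F' where F': "F' \<subseteq> F" "countable F'" "\<Union>F' = \<Union>F"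
    using Lindelof[of F] by (auto simp: F_def)
  ultimately have cov: "\<Union>F' = \<Omega>" by simp
  have ae: "AE z in lborel. z \<in> B \<longrightarrow> u z = 0" if BF: "B \<in> F'" for B
  proof -
    obtain a b where B: "B = box a b" "cbox a b \<subseteq> \<Omega>" using BF F'(1) unfolding F_def by blast
    have "set_integrable lborel (cbox a b) u" using u B(2) by (auto simp: locally_integrable_on_def)
    then have "set_integrable lborel (box a b) u" by (rule set_integrable_subset) (auto simp: box_subset_cbox)
    then have i: "integrable lborel (\<lambda>z. indicator (box a b) z *\<^sub>R u z)" by (simp add: set_integrable_def)
    have "AE z in lborel. indicator (box a b) z *\<^sub>R u z = 0"
    proof (rule ae_zero_of_box_integrals[OF i])
      fix c d :: plane
      obtain e f where ef: "box c d \<inter> box a b = box e f" "cbox e f \<subseteq> cbox a b"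
      proof -
        let ?e = "(max (fst c) (fst a), max (snd c) (snd a))" and ?f = "(min (fst d) (fst b), min (snd d) (snd b))"
        have "box c d \<inter> box a b = box ?e ?f" by (rule box_Int_plane)
        moreover have "cbox ?e ?f \<subseteq> cbox a b" by (cases a; cases b) (auto simp: cbox_Pair_eq)
        ultimately show ?thesis using that by blast
      qed
      have "(LINT z:box c d|lborel. indicator (box a b) z *\<^sub>R u z) = (LINT z:box e f|lborel. u z)"
        unfolding set_lebesgue_integral_def ef(1)[symmetric] by (intro Bochner_Integration.integral_cong) (auto simp: indicator_def)
      also have "\<dots> = 0"
        using ef(2) B(2) by (intro fundamental_lemma_box[OF u _ z]) auto
      finally show "(LINT z:box c d|lborel. indicator (box a b) z *\<^sub>R u z) = 0" .
    qed
    then show ?thesis by eventually_elim (auto simp: B(1) indicator_def split: if_splits)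
  qed
  have "AE z in lborel. \<forall>B\<in>F'. z \<in> B \<longrightarrow> u z = 0"
    by (rule AE_ball_countable[OF F'(2), THEN iffD2]) (use ae in blast)
  then show ?thesis by eventually_elim (use cov in auto)
qed

lemma weak_deriv_unique:
  assumes \<Omega>: "open \<Omega>" and g: "is_weak_deriv \<Omega> \<alpha> f g" and g': "is_weak_deriv \<Omega> \<alpha> f g'"
  shows "AE z in lborel. z \<in> \<Omega> \<longrightarrow> g z = g' z"
proof -
  have li: "locally_integrable_on \<Omega> g" "locally_integrable_on \<Omega> g'" using g g' by (auto simp: is_weak_deriv_def)
  have "AE z in lborel. z \<in> \<Omega> \<longrightarrow> g z - g' z = 0"
  proof (rule fundamental_lemma[OF \<Omega>])
    show "locally_integrable_on \<Omega> (\<lambda>z. g z - g' z)"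
      using li by (auto simp: locally_integrable_on_def intro: set_integral_diff)
    fix \<phi> assume \<phi>: "test_function \<Omega> \<phi>"
    have "(- 1) ^ mi_order \<alpha> *\<^sub>R (LINT z:\<Omega>|lborel. \<phi> z *\<^sub>R g z) = (- 1 :: real) ^ mi_order \<alpha> *\<^sub>R (LINT z:\<Omega>|lborel. \<phi> z *\<^sub>R g' z)"
      using g g' \<phi> by (simp add: is_weak_deriv_def)
    then have eq: "(LINT z:\<Omega>|lborel. \<phi> z *\<^sub>R g z) = (LINT z:\<Omega>|lborel. \<phi> z *\<^sub>R g' z)" by simp
    have "(LINT z:\<Omega>|lborel. \<phi> z *\<^sub>R (g z - g' z)) = (LINT z:\<Omega>|lborel. \<phi> z *\<^sub>R g z) - (LINT z:\<Omega>|lborel. \<phi> z *\<^sub>R g' z)"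
      unfolding scaleR_diff_right by (intro set_integral_diff(2) test_function_integrable \<phi> li)
    then show "(LINT z:\<Omega>|lborel. \<phi> z *\<^sub>R (g z - g' z)) = 0" using eq by simp
  qed
  then show ?thesis by eventually_elim auto
qed

text \<open>The classical derivative is a witness for the choice in \<open>weak_deriv\<close>, and
  uniqueness identifies the two almost everywhere.\<close>

lemma weak_deriv_smooth:
  assumes \<Omega>: "open \<Omega>" and f: "smooth_on \<Omega> f"
  shows "AE z in lborel. z \<in> \<Omega> \<longrightarrow> weak_deriv \<Omega> \<alpha> f z = mi_deriv \<alpha> f z"
    "is_weak_deriv \<Omega> \<alpha> f (weak_deriv \<Omega> \<alpha> f)"
proof -
  show w: "is_weak_deriv \<Omega> \<alpha> f (weak_deriv \<Omega> \<alpha> f)"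
    unfolding weak_deriv_def by (rule someI[of _ "mi_deriv \<alpha> f"]) (rule smooth_is_weak_deriv[OF \<Omega> f])
  show "AE z in lborel. z \<in> \<Omega> \<longrightarrow> weak_deriv \<Omega> \<alpha> f z = mi_deriv \<alpha> f z"
    by (rule weak_deriv_unique[OF \<Omega> w smooth_is_weak_deriv[OF \<Omega> f]])
qed

text \<open>The chosen weak derivative is known to be integrable on compact sets only. An exhaustion
  of \<open>\<Omega>\<close> by finite unions of closed boxes gives the measurability needed to
  replace it under the integral.\<close>

lemma locally_integrable_set_measurable:
  fixes g :: "plane \<Rightarrow> spinor"
  assumes \<Omega>: "open \<Omega>" and g: "locally_integrable_on \<Omega> g"
  shows "set_borel_measurable lborel \<Omega> g"
proof -
  obtain D where D: "countable D" "D \<subseteq> Pow \<Omega>" "\<And>X. X \<in> D \<Longrightarrow> \<exists>a b. X = cbox a b" "\<Union>D = \<Omega>"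
    using open_countable_Union_open_cbox[OF \<Omega>] by metis
  show ?thesis
  proof (cases "D = {}")
    case True
    then show ?thesis using D(4) by (auto simp: set_borel_measurable_def)
  next
    case False
    define E where "E = from_nat_into D"
    have ED: "E n \<in> D" for n using from_nat_into[OF False] by (simp add: E_def)
    have EU: "(\<Union>n. E n) = \<Omega>" using range_from_nat_into[OF False D(1)] D(4) by (simp add: E_def)
    have lim: "(\<lambda>n. indicator (\<Union>i<n. E i) z *\<^sub>R g z) \<longlonglongrightarrow> indicator \<Omega> z *\<^sub>R g z" for z
      using LIMSEQ_indicator_UN[of E z] unfolding EU by (intro tendsto_scaleR tendsto_const) auto
    have "(\<lambda>z. indicator (\<Union>i<n. E i) z *\<^sub>R g z) \<in> borel_measurable lborel" for n
    proof -
      have "compact (E i)" for i using D(3)[OF ED[of i]] by auto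
      then have "compact (\<Union>i<n. E i)" by auto
      moreover have "(\<Union>i<n. E i) \<subseteq> \<Omega>" using EU by auto
      ultimately have "set_integrable lborel (\<Union>i<n. E i) g" using g by (simp add: locally_integrable_on_def)
      then show ?thesis unfolding set_integrable_def by (rule borel_measurable_integrable)
    qed
    then show ?thesis unfolding set_borel_measurable_def using lim by (rule borel_measurable_LIMSEQ_metric)
  qed
qed

section \<open>Sobolev norms of smooth functions\<close>

lemma smooth_bounded_Lp:
  assumes \<Omega>: "open \<Omega>" "bounded \<Omega>" and w: "continuous_on \<Omega> w" and C: "\<And>z. z \<in> \<Omega> \<Longrightarrow> norm (w z) \<le> C" and p: "p > 0"
  shows "w \<in> Lp_on \<Omega> p" "(LINT z:\<Omega>|lborel. norm (w z) powr p) \<le> measure lborel \<Omega> * C powr p"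
proof -
  have m: "(\<lambda>z. indicator \<Omega> z *\<^sub>R w z) \<in> borel_measurable borel"
    using borel_measurable_continuous_on_indicator[OF _ w] \<Omega> by auto
  have fin: "emeasure lborel \<Omega> < \<infinity>" using \<Omega>(2) by (rule emeasure_bounded_finite)
  have sb: "set_borel_measurable lborel \<Omega> w" using m by (simp add: set_borel_measurable_def)
  have eq: "(\<lambda>z. indicator \<Omega> z *\<^sub>R (norm (w z) powr p)) = (\<lambda>z. norm (indicator \<Omega> z *\<^sub>R w z) powr p)"
    using p by (auto simp: fun_eq_iff indicator_def)
  have ic: "integrable lborel (\<lambda>z. indicator \<Omega> z *\<^sub>R C powr p)"
    using fin \<Omega>(1) by (intro integrable_scaleR_left integrable_real_indicator) auto
  have bd: "norm (indicator \<Omega> z *\<^sub>R (norm (w z) powr p)) \<le> norm (indicator \<Omega> z *\<^sub>R C powr p)" for z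
    using C[of z] p by (auto simp: indicator_def intro: powr_mono2)
  have i: "integrable lborel (\<lambda>z. indicator \<Omega> z *\<^sub>R (norm (w z) powr p))"
  proof (rule Bochner_Integration.integrable_bound[OF ic])
    have "(\<lambda>z. norm (indicator \<Omega> z *\<^sub>R w z) powr p) \<in> borel_measurable borel" using m by measurable
    then show "(\<lambda>z. indicator \<Omega> z *\<^sub>R (norm (w z) powr p)) \<in> borel_measurable lborel" unfolding eq by simp
  qed (use bd in auto)
  show "w \<in> Lp_on \<Omega> p" using sb i by (simp add: Lp_on_def set_integrable_def)
  have "(LINT z|lborel. indicator \<Omega> z *\<^sub>R (norm (w z) powr p)) \<le> (LINT z|lborel. indicator \<Omega> z *\<^sub>R C powr p)"
    using bd by (intro integral_mono i ic) (auto simp: indicator_def abs_le_iff split: if_splits)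
  also have "\<dots> = measure lborel \<Omega> * C powr p" using \<Omega>(1) by simp
  finally show "(LINT z:\<Omega>|lborel. norm (w z) powr p) \<le> measure lborel \<Omega> * C powr p" by (simp add: set_lebesgue_integral_def)
qed

lemma set_lebesgue_integral_cong_open_AE:
  fixes F G :: "plane \<Rightarrow> real"
  assumes "AE z in lborel. z \<in> \<Omega> \<longrightarrow> F z = G z"
    and "set_borel_measurable lborel \<Omega> F" "set_borel_measurable lborel \<Omega> G"
  shows "(LINT z:\<Omega>|lborel. F z) = (LINT z:\<Omega>|lborel. G z)"
  unfolding set_lebesgue_integral_def
proof (rule integral_cong_AE)
  show "AE z in lborel. indicator \<Omega> z *\<^sub>R F z = indicator \<Omega> z *\<^sub>R G z"
    using assms(1) by eventually_elim (auto simp: indicator_def)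
qed (use assms in \<open>auto simp: set_borel_measurable_def\<close>)

lemma integral_weak_deriv_norm_powr:
  assumes \<Omega>: "open \<Omega>" and f: "smooth_on \<Omega> f" and p: "p > 0"
  shows "(LINT z:\<Omega>|lborel. norm (weak_deriv \<Omega> \<alpha> f z) powr p) = (LINT z:\<Omega>|lborel. norm (mi_deriv \<alpha> f z) powr p)"
proof (rule set_lebesgue_integral_cong_open_AE)
  show "AE z in lborel. z \<in> \<Omega> \<longrightarrow> norm (weak_deriv \<Omega> \<alpha> f z) powr p = norm (mi_deriv \<alpha> f z) powr p"
    using weak_deriv_smooth(1)[OF \<Omega> f, of \<alpha>] by eventually_elim auto
  have m: "set_borel_measurable lborel \<Omega> (\<lambda>z. norm (g z) powr p)" if "locally_integrable_on \<Omega> g" for g :: "plane \<Rightarrow> spinor"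
  proof -
    have "(\<lambda>z. indicator \<Omega> z *\<^sub>R g z) \<in> borel_measurable lborel"
      using locally_integrable_set_measurable[OF \<Omega> that] by (simp add: set_borel_measurable_def)
    then have "(\<lambda>z. norm (indicator \<Omega> z *\<^sub>R g z) powr p) \<in> borel_measurable lborel" by measurable
    moreover have "(\<lambda>z. norm (indicator \<Omega> z *\<^sub>R g z) powr p) = (\<lambda>z. indicator \<Omega> z *\<^sub>R (norm (g z) powr p))"
      using p by (auto simp: fun_eq_iff indicator_def)
    ultimately show ?thesis by (simp add: set_borel_measurable_def)
  qed
  show "set_borel_measurable lborel \<Omega> (\<lambda>z. norm (weak_deriv \<Omega> \<alpha> f z) powr p)"
    using weak_deriv_smooth(2)[OF \<Omega> f, of \<alpha>] by (intro m) (simp add: is_weak_deriv_def)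
  show "set_borel_measurable lborel \<Omega> (\<lambda>z. norm (mi_deriv \<alpha> f z) powr p)"
    by (intro m locally_integrable_continuous smooth_on_continuous smooth_on_mi_deriv f)
qed

lemma sobolev_norm_le:
  assumes \<Omega>: "open \<Omega>" "bounded \<Omega>" and f: "smooth_on \<Omega> f" and p: "p > 1" and C0: "C \<ge> 0"
    and C: "\<And>z \<alpha>. z \<in> \<Omega> \<Longrightarrow> mi_order \<alpha> \<le> k \<Longrightarrow> norm (mi_deriv \<alpha> f z) \<le> C"
  shows "f \<in> sobolev_space \<Omega> k p"
    "sobolev_norm \<Omega> k p f \<le> (real (card {\<alpha>. mi_order \<alpha> \<le> k}) * measure lborel \<Omega>) powr (1 / p) * C"
proof -
  have Lp: "mi_deriv \<alpha> f \<in> Lp_on \<Omega> p" "(LINT z:\<Omega>|lborel. norm (mi_deriv \<alpha> f z) powr p) \<le> measure lborel \<Omega> * C powr p"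
    if "mi_order \<alpha> \<le> k" for \<alpha>
    using that p by (auto intro!: smooth_bounded_Lp[OF \<Omega>] smooth_on_continuous smooth_on_mi_deriv f C)
  have "mi_deriv (0, 0) f = f" by (simp add: mi_deriv_def)
  then have "f \<in> Lp_on \<Omega> p" using Lp(1)[of "(0, 0)"] by (simp add: mi_order_def)
  then show "f \<in> sobolev_space \<Omega> k p"
    unfolding sobolev_space_def using Lp(1) smooth_is_weak_deriv[OF \<Omega>(1) f] by blast
  have "(\<Sum>\<alpha> | mi_order \<alpha> \<le> k. LINT z:\<Omega>|lborel. norm (weak_deriv \<Omega> \<alpha> f z) powr p)
    \<le> (\<Sum>\<alpha> | mi_order \<alpha> \<le> k. measure lborel \<Omega> * C powr p)"
    using p Lp(2) by (intro sum_mono) (simp add: integral_weak_deriv_norm_powr[OF \<Omega>(1) f])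
  also have "\<dots> = (real (card {\<alpha>. mi_order \<alpha> \<le> k}) * measure lborel \<Omega>) * C powr p" by simp
  finally have "sobolev_norm \<Omega> k p f \<le> ((real (card {\<alpha>. mi_order \<alpha> \<le> k}) * measure lborel \<Omega>) * C powr p) powr (1 / p)"
    unfolding sobolev_norm_def using p
    by (intro powr_mono2 sum_nonneg) (auto simp: set_lebesgue_integral_def intro!: integral_nonneg_AE)
  also have "\<dots> = (real (card {\<alpha>. mi_order \<alpha> \<le> k}) * measure lborel \<Omega>) powr (1 / p) * (C powr p) powr (1 / p)"
    by (rule powr_mult)
  also have "(C powr p) powr (1 / p) = C" using p C0 by (simp add: powr_powr)
  finally show "sobolev_norm \<Omega> k p f \<le> (real (card {\<alpha>. mi_order \<alpha> \<le> k}) * measure lborel \<Omega>) powr (1 / p) * C" .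
qed

text \<open>Finiteness matters: the integral in \<open>sobolev_norm\<close> is 0 by default for a
  function that is not integrable, whereas \<open>energy\<close> would be infinite.\<close>

lemma sobolev_norm_0_4:
  assumes f: "smooth_on unit_disk f" and fin: "energy f unit_disk < \<infinity>"
  shows "energy f unit_disk = ennreal (sobolev_norm unit_disk 0 4 f ^ 4)" "sobolev_norm unit_disk 0 4 f \<ge> 0"
proof -
  have D: "open unit_disk" by simp
  have z: "{\<alpha>::multi_index. mi_order \<alpha> \<le> 0} = {(0, 0)}" by (auto simp: mi_order_def)
  have powr4: "norm x powr 4 = norm x ^ 4" for x :: spinor by (cases "x = 0") (simp_all add: powr_numeral)
  let ?I = "LINT z:unit_disk|lborel. norm (f z) powr 4"
  have m: "(\<lambda>z. indicator unit_disk z *\<^sub>R f z) \<in> borel_measurable borel"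
    using borel_measurable_continuous_on_indicator[OF _ smooth_on_continuous[OF f]] by auto
  have nn: "(\<integral>\<^sup>+z. ennreal (indicator unit_disk z *\<^sub>R (norm (f z) powr 4)) \<partial>lborel) = energy f unit_disk"
    unfolding energy_def by (intro nn_integral_cong) (auto simp: indicator_def powr4)
  have "(\<lambda>z. norm (indicator unit_disk z *\<^sub>R f z) ^ 4) \<in> borel_measurable borel" using m by measurable
  moreover have "(\<lambda>z. norm (indicator unit_disk z *\<^sub>R f z) ^ 4) = (\<lambda>z. indicator unit_disk z *\<^sub>R (norm (f z) powr 4))"
    by (auto simp: fun_eq_iff indicator_def powr4)
  ultimately have m4: "(\<lambda>z. indicator unit_disk z *\<^sub>R (norm (f z) powr 4)) \<in> borel_measurable lborel" by simp
  have i: "integrable lborel (\<lambda>z. indicator unit_disk z *\<^sub>R (norm (f z) powr 4))"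
  proof (rule integrableI_bounded[OF m4])
    have "(\<integral>\<^sup>+z. ennreal (norm (indicator unit_disk z *\<^sub>R (norm (f z) powr 4))) \<partial>lborel) = energy f unit_disk"
      unfolding nn[symmetric] by (intro nn_integral_cong) (auto simp: indicator_def)
    then show "(\<integral>\<^sup>+z. ennreal (norm (indicator unit_disk z *\<^sub>R (norm (f z) powr 4))) \<partial>lborel) < \<infinity>" using fin by simp
  qed
  have I: "energy f unit_disk = ennreal ?I"
    unfolding nn[symmetric] set_lebesgue_integral_def by (intro nn_integral_eq_integral i) (auto simp: indicator_def)
  have I0: "?I \<ge> 0" unfolding set_lebesgue_integral_def by (intro Bochner_Integration.integral_nonneg) (auto simp: indicator_def)
  have s: "sobolev_norm unit_disk 0 4 f = ?I powr (1 / 4)"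
    unfolding sobolev_norm_def z using integral_weak_deriv_norm_powr[OF D f, of 4 "(0, 0)"] by (simp add: mi_deriv_def)
  have "(?I powr (1 / 4)) ^ 4 = ?I"
  proof (cases "?I = 0")
    case False
    then have "?I > 0" using I0 by simp
    then have "(?I powr (1 / 4)) ^ 4 = (?I powr (1 / 4)) powr 4" by (simp add: powr_numeral)
    then show ?thesis using I0 by (simp add: powr_powr)
  qed simp
  then show "energy f unit_disk = ennreal (sobolev_norm unit_disk 0 4 f ^ 4)" using I s by simp
  show "sobolev_norm unit_disk 0 4 f \<ge> 0" using s by simp
qed

subsection \<open>The Dirac equation as a \<open>dbar\<close>-system\<close>

lemma norm_spinor: "(norm (s::spinor))\<^sup>2 = (norm (s $ 1))\<^sup>2 + (norm (s $ 2))\<^sup>2"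
  by (simp add: norm_vec_def L2_set_def sum_2)

lemma norm_spinor_bounds:
  "norm (s::spinor) \<le> norm (s $ 2) + norm (s $ 1)" "norm (s $ 2) + norm (s $ 1) \<le> 2 * norm s"
proof -
  show "norm s \<le> norm (s $ 2) + norm (s $ 1)"
    unfolding norm_vec_def by (rule order_trans[OF L2_set_le_sum]) (simp_all add: sum_2)
  show "norm (s $ 2) + norm (s $ 1) \<le> 2 * norm s"
    using Finite_Cartesian_Product.norm_nth_le[of s 1] Finite_Cartesian_Product.norm_nth_le[of s 2] by linarith
qed

lemma dirac_components:
  "dirac \<psi> z $ 1 = deriv_x \<psi> z $ 2 + \<i> * deriv_y \<psi> z $ 2"
  "dirac \<psi> z $ 2 = - deriv_x \<psi> z $ 1 + \<i> * deriv_y \<psi> z $ 1"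
  by (simp_all add: dirac_def \<sigma>1_def \<sigma>2_def matrix_vector_mult_def sum_2)

text \<open>In this representation \<open>\<Gamma>\<close> is diagonal with entries -1 and 1, so
  \<open>\<Gamma>_plus\<close> projects onto the second component. Hence \<open>U\<close> acts on
  the second component and \<open>V\<close> on the first.\<close>

lemma chirality_components:
  "\<Gamma>_plus $ 1 $ 1 = 0" "\<Gamma>_plus $ 1 $ 2 = 0" "\<Gamma>_plus $ 2 $ 1 = 0" "\<Gamma>_plus $ 2 $ 2 = 1"
  "\<Gamma>_minus $ 1 $ 1 = 1" "\<Gamma>_minus $ 1 $ 2 = 0" "\<Gamma>_minus $ 2 $ 1 = 0" "\<Gamma>_minus $ 2 $ 2 = 0"
  by (simp_all add: \<Gamma>_plus_def \<Gamma>_minus_def \<Gamma>_def \<sigma>1_def \<sigma>2_def matrix_matrix_mult_def sum_2 mat_def)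

lemma potential_components:
  "((mat u ** \<Gamma>_plus + mat v ** \<Gamma>_minus) *v s) $ 1 = v * s $ 1"
  "((mat u ** \<Gamma>_plus + mat v ** \<Gamma>_minus) *v s) $ 2 = u * s $ 2"
  by (simp_all add: matrix_vector_mult_def matrix_matrix_mult_def sum_2 mat_def chirality_components)

text \<open>In all three groups both potentials have real part \<open>- h\<close> times the squared
  norm of the spinor; they differ in the imaginary quadratic forms only, whose coefficients are at
  most 3/2 in modulus.\<close>

lemma potential_normal_form:
  obtains a1 a2 b1 b2 :: real where "\<bar>a1\<bar> \<le> 2" "\<bar>a2\<bar> \<le> 2" "\<bar>b1\<bar> \<le> 2" "\<bar>b2\<bar> \<le> 2"
    "\<And>h s. potential_U G h s = of_real (- h * ((norm (s $ 2))\<^sup>2 + (norm (s $ 1))\<^sup>2)) + \<i> * of_real (a1 * (norm (s $ 2))\<^sup>2 + a2 * (norm (s $ 1))\<^sup>2)"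
    "\<And>h s. potential_V G h s = of_real (- h * ((norm (s $ 2))\<^sup>2 + (norm (s $ 1))\<^sup>2)) + \<i> * of_real (b1 * (norm (s $ 2))\<^sup>2 + b2 * (norm (s $ 1))\<^sup>2)"
proof (cases G)
  case SU2
  show ?thesis by (rule that[of 1 1 "-1" "-1"]) (simp_all add: SU2 norm_spinor complex_eq_iff algebra_simps)
next
  case Nil3
  show ?thesis by (rule that[of "1/2" "-1/2" "1/2" "-1/2"]) (simp_all add: Nil3 norm_spinor complex_eq_iff algebra_simps)
next
  case SL2_tilde
  show ?thesis by (rule that[of "-3/2" 1 "-1" "3/2"]) (simp_all add: SL2_tilde norm_spinor complex_eq_iff algebra_simps)
qed

text \<open>The first component of the Dirac operator is \<open>dbar\<close> of
  \<open>\<psi>\<^sub>2\<close>; the second is minus the conjugate of \<open>dbar\<close> of the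
  conjugate of \<open>\<psi>\<^sub>1\<close>. This conjugation explains the signs in
  \<open>spin_system\<close>.\<close>

lemma spin_system_of_dirac:
  assumes s: "smooth_on unit_disk \<psi>" and eq: "solves_dirac_eq G H unit_disk \<psi>"
  shows "spin_system (\<lambda>z. of_real (H z)) (\<lambda>z. \<psi> z $ 2) (\<lambda>z. cnj (\<psi> z $ 1))"
proof -
  have D: "open unit_disk" by simp
  have sm: "smooth_on unit_disk (\<lambda>z. \<psi> z $ i)" for i
    by (rule smooth_on_bounded_linear[OF bounded_linear_vec_nth D s])
  obtain a1 a2 b1 b2 where c: "\<bar>a1\<bar> \<le> 2" "\<bar>a2\<bar> \<le> 2" "\<bar>b1\<bar> \<le> 2" "\<bar>b2\<bar> \<le> 2"
    and U: "\<And>h s. potential_U G h s = of_real (- h * ((norm (s $ 2))\<^sup>2 + (norm (s $ 1))\<^sup>2)) + \<i> * of_real (a1 * (norm (s $ 2))\<^sup>2 + a2 * (norm (s $ 1))\<^sup>2)"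
    and V: "\<And>h s. potential_V G h s = of_real (- h * ((norm (s $ 2))\<^sup>2 + (norm (s $ 1))\<^sup>2)) + \<i> * of_real (b1 * (norm (s $ 2))\<^sup>2 + b2 * (norm (s $ 1))\<^sup>2)"
    by (rule potential_normal_form[of G]) blast
  have main: "dbar (\<lambda>z. \<psi> z $ 2) z = - (of_real (H z) * (dens (\<lambda>z. \<psi> z $ 2) (\<lambda>z. cnj (\<psi> z $ 1)) z * cnj (cnj (\<psi> z $ 1)))) + quadr b1 b2 (\<lambda>z. \<psi> z $ 2) (\<lambda>z. cnj (\<psi> z $ 1)) z * cnj (cnj (\<psi> z $ 1)) \<and>
    dbar (\<lambda>z. cnj (\<psi> z $ 1)) z = of_real (H z) * (dens (\<lambda>z. \<psi> z $ 2) (\<lambda>z. cnj (\<psi> z $ 1)) z * cnj (\<psi> z $ 2)) + quadr a1 a2 (\<lambda>z. \<psi> z $ 2) (\<lambda>z. cnj (\<psi> z $ 1)) z * cnj (\<psi> z $ 2)"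
    if z: "z \<in> unit_disk" for z
  proof -
    have d: "\<psi> differentiable (at z)" and dn: "(\<lambda>z. \<psi> z $ i) differentiable (at z)" for i
      using smooth_on_differentiable[OF s z] smooth_on_differentiable[OF sm z] by auto
    have pn: "partial_deriv e (\<lambda>z. \<psi> z $ i) z = partial_deriv e \<psi> z $ i" for e i
      by (rule partial_deriv_bounded_linear[OF bounded_linear_vec_nth d])
    have pc: "partial_deriv e (\<lambda>z. cnj (\<psi> z $ i)) z = cnj (partial_deriv e \<psi> z $ i)" for e i
      using partial_deriv_bounded_linear[OF bounded_linear_cnj dn, of e i] pn by simp
    have e: "dirac \<psi> z = (mat (potential_U G (H z) (\<psi> z)) ** \<Gamma>_plus + mat (potential_V G (H z) (\<psi> z)) ** \<Gamma>_minus) *v \<psi> z"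
      using eq z by (simp add: solves_dirac_eq_def)
    have e1: "deriv_x \<psi> z $ 2 + \<i> * deriv_y \<psi> z $ 2 = potential_V G (H z) (\<psi> z) * \<psi> z $ 1"
      and e2: "- deriv_x \<psi> z $ 1 + \<i> * deriv_y \<psi> z $ 1 = potential_U G (H z) (\<psi> z) * \<psi> z $ 2"
      unfolding dirac_components[symmetric] e potential_components by simp_all
    have dn1: "dens (\<lambda>z. \<psi> z $ 2) (\<lambda>z. cnj (\<psi> z $ 1)) z = of_real ((norm (\<psi> z $ 2))\<^sup>2 + (norm (\<psi> z $ 1))\<^sup>2)"
      by (simp only: dens_eq complex_mod_cnj)
    have q: "quadr a b (\<lambda>z. \<psi> z $ 2) (\<lambda>z. cnj (\<psi> z $ 1)) z = \<i> * of_real (a * (norm (\<psi> z $ 2))\<^sup>2 + b * (norm (\<psi> z $ 1))\<^sup>2)" for a b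
    proof -
      have "\<psi> z $ 2 * cnj (\<psi> z $ 2) = of_real ((norm (\<psi> z $ 2))\<^sup>2)" "cnj (\<psi> z $ 1) * \<psi> z $ 1 = of_real ((norm (\<psi> z $ 1))\<^sup>2)"
        by (simp_all only: complex_norm_square mult.commute)
      then show ?thesis by (simp add: quadr_def)
    qed
    have "dbar (\<lambda>z. \<psi> z $ 2) z = potential_V G (H z) (\<psi> z) * \<psi> z $ 1"
      unfolding dbar_def pn e1 ..
    moreover have "dbar (\<lambda>z. cnj (\<psi> z $ 1)) z = - cnj (potential_U G (H z) (\<psi> z) * \<psi> z $ 2)"
      unfolding dbar_def pc e2[symmetric] by simp
    ultimately show ?thesis unfolding U V dn1 q by (simp add: algebra_simps)
  qed
  show ?thesis unfolding spin_system_def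
    by (intro conjI, rule sm, rule smooth_on_cnj[OF D sm], rule exI[of _ a1], rule exI[of _ a2], rule exI[of _ b1],
      rule exI[of _ b2], intro conjI ballI, (rule c)+, erule main[THEN conjunct1], erule main[THEN conjunct2])
qed

text \<open>16 is \<open>2 ^ 4\<close>: the sum of the moduli of the components is at most twice the
  norm of the spinor.\<close>

lemma energy_bound_of_dirac:
  assumes e: "energy \<psi> unit_disk \<le> ennreal e" and s: "smooth_on unit_disk \<psi>" and E: "16 * e \<le> E" "E > 0"
  shows "energy_bound (\<lambda>z. \<psi> z $ 2) (\<lambda>z. cnj (\<psi> z $ 1)) E"
proof -
  have m: "(\<lambda>z. indicator unit_disk z *\<^sub>R \<psi> z) \<in> borel_measurable borel"
    using borel_measurable_continuous_on_indicator[OF _ smooth_on_continuous[OF s]] by auto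
  have "(\<lambda>z. ennreal (norm (indicator unit_disk z *\<^sub>R \<psi> z) ^ 4)) \<in> borel_measurable borel" using m by measurable
  moreover have "(\<lambda>z. ennreal (norm (indicator unit_disk z *\<^sub>R \<psi> z) ^ 4)) = (\<lambda>z. ennreal (norm (\<psi> z) ^ 4) * indicator unit_disk z)"
    by (auto simp: fun_eq_iff indicator_def)
  ultimately have m4: "(\<lambda>z. ennreal (norm (\<psi> z) ^ 4) * indicator unit_disk z) \<in> borel_measurable lborel" by (simp only: measurable_lborel2)
  have "(\<integral>\<^sup>+z\<in>unit_disk. ennreal ((norm (\<psi> z $ 2) + norm (cnj (\<psi> z $ 1))) ^ 4) \<partial>lborel)
    \<le> (\<integral>\<^sup>+z. ennreal 16 * (ennreal (norm (\<psi> z) ^ 4) * indicator unit_disk z) \<partial>lborel)"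
  proof (rule nn_integral_mono)
    fix z
    have "(norm (\<psi> z $ 2) + norm (cnj (\<psi> z $ 1))) ^ 4 \<le> (2 * norm (\<psi> z)) ^ 4"
      using norm_spinor_bounds(2)[of "\<psi> z"] by (intro power_mono) auto
    then have "ennreal ((norm (\<psi> z $ 2) + norm (cnj (\<psi> z $ 1))) ^ 4) \<le> ennreal (16 * norm (\<psi> z) ^ 4)"
      by (intro ennreal_leI) (simp add: power_mult_distrib)
    also have "\<dots> = ennreal 16 * ennreal (norm (\<psi> z) ^ 4)" by (rule ennreal_mult') simp
    finally show "ennreal ((norm (\<psi> z $ 2) + norm (cnj (\<psi> z $ 1))) ^ 4) * indicator unit_disk z
      \<le> ennreal 16 * (ennreal (norm (\<psi> z) ^ 4) * indicator unit_disk z)"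
      by (auto simp: indicator_def)
  qed
  also have "\<dots> = ennreal 16 * energy \<psi> unit_disk"
    unfolding energy_def by (rule nn_integral_cmult[OF m4])
  also have "\<dots> \<le> ennreal 16 * ennreal e" by (intro mult_left_mono e) simp
  also have "\<dots> = ennreal (16 * e)" by (rule ennreal_mult'[symmetric]) simp
  also have "\<dots> \<le> ennreal E" by (rule ennreal_leI[OF E(1)])
  finally show ?thesis using E(2) by (simp add: energy_bound_def)
qed

lemma norm_mi_deriv_spinor:
  fixes \<psi> :: "plane \<Rightarrow> spinor"
  assumes s: "smooth_on unit_disk \<psi>" and z: "z \<in> unit_disk"
  shows "norm (mi_deriv \<alpha> \<psi> z) \<le> Dnorm (mi_order \<alpha>) (\<lambda>z. \<psi> z $ 2) z + Dnorm (mi_order \<alpha>) (\<lambda>z. cnj (\<psi> z $ 1)) z"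
proof -
  have D: "open unit_disk" by simp
  have c: "mi_deriv \<alpha> \<psi> z $ i = mi_deriv \<alpha> (\<lambda>z. \<psi> z $ i) z" for i
    using wderiv_bounded_linear[OF bounded_linear_vec_nth D s z, of "replicate (snd \<alpha>) False @ replicate (fst \<alpha>) True" i]
    by (cases \<alpha>) (simp add: mi_deriv_eq_wderiv)
  have sm: "smooth_on unit_disk (\<lambda>z. \<psi> z $ 1)" by (rule smooth_on_bounded_linear[OF bounded_linear_vec_nth D s])
  have "norm (mi_deriv \<alpha> \<psi> z) \<le> norm (mi_deriv \<alpha> \<psi> z $ 2) + norm (mi_deriv \<alpha> \<psi> z $ 1)" by (rule norm_spinor_bounds(1))
  also have "\<dots> \<le> Dnorm (mi_order \<alpha>) (\<lambda>z. \<psi> z $ 2) z + Dnorm (mi_order \<alpha>) (\<lambda>z. \<psi> z $ 1) z"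
    unfolding c by (intro add_mono norm_mi_deriv_le)
  finally show ?thesis by (simp add: Dnorm_cnj[OF D sm z])
qed

theorem corollary5p1:
  fixes H :: "plane \<Rightarrow> real"
  assumes "Ck_on 1 unit_disk H"
    and "bdd_above ((\<lambda>z. \<bar>H z\<bar>) ` unit_disk)"
    and "bdd_above ((\<lambda>z. norm (gradient H z)) ` unit_disk)"
  shows "\<exists>\<epsilon>::real. \<epsilon> > 0 \<and>
    (\<forall>(B'::plane set) (p::real) (k::nat).
       open B' \<and> compact (closure B') \<and> closure B' \<subseteq> unit_disk \<and> p > 1 \<and> k \<ge> 1 \<longrightarrow>
       (\<exists>C::real. C > 0 \<and>
          (\<forall>(G::ambient_group) (\<psi>::plane \<Rightarrow> spinor).
             smooth_on unit_disk \<psi> \<and> solves_dirac_eq G H unit_disk \<psi> \<and>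
             energy \<psi> unit_disk < ennreal \<epsilon> \<longrightarrow>
             \<psi> \<in> sobolev_space B' k p \<and>
             sobolev_norm B' k p \<psi> \<le> C * sobolev_norm unit_disk 0 4 \<psi>)))"
proof -
  obtain B0 where B0: "\<And>z. z \<in> unit_disk \<Longrightarrow> \<bar>H z\<bar> \<le> B0" using assms(2) unfolding bdd_above_def by (meson imageI)
  define B where "B = max B0 0"
  have B: "B \<ge> 0" by (simp add: B_def)
  define h where "h z = complex_of_real (H z)" for z
  have hB: "norm (h z) \<le> B" if "z \<in> unit_disk" for z using B0[OF that] by (simp add: h_def B_def)
  \<comment> \<open>Makes the left-hand side of \<open>small\<close> half of its right-hand
    side.\<close>
  define \<delta> where "\<delta> = kern_mass / (128 * (B + 2)) * kern_mass\<^sup>2 / 200"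
  have \<delta>: "\<delta> > 0" unfolding \<delta>_def using kern_mass_pos B by (intro divide_pos_pos mult_pos_pos) auto
  define \<epsilon>' where "\<epsilon>' = \<delta>\<^sup>2"
  have \<epsilon>': "\<epsilon>' > 0" using \<delta> by (simp add: \<epsilon>'_def)
  have small: "100 / kern_mass\<^sup>2 * sqrt \<epsilon>' < kern_mass / (128 * (B + 2))"
  proof -
    have "100 / kern_mass\<^sup>2 * sqrt \<epsilon>' = (kern_mass / (128 * (B + 2))) / 2"
      using \<delta> kern_mass_pos B by (simp add: \<epsilon>'_def) (simp add: \<delta>_def divide_simps)
    also have "\<dots> < kern_mass / (128 * (B + 2))"
    proof -
      have half: "x / 2 < x" if "x > 0" for x :: real using that by simp
      show ?thesis by (rule half) (use kern_mass_pos B in \<open>intro divide_pos_pos mult_pos_pos, auto\<close>)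
    qed
    finally show ?thesis .
  qed
  have local: "\<exists>r>0. \<exists>C>0. \<forall>f g E. spin_system h f g \<longrightarrow> energy_bound f g E \<longrightarrow> E \<le> \<epsilon>' \<longrightarrow>
    (\<forall>x\<in>ball p r. \<forall>i\<le>k. Dnorm i f x \<le> C * root 4 E \<and> Dnorm i g x \<le> C * root 4 E)" if "p \<in> unit_disk" for p k
    using spin_system_local_estimate[of h B p \<epsilon>' k] hB B that small \<epsilon>' by blast
  \<comment> \<open>Passing to the two components multiplies the energy by at most 16, which leaves
    \<open>\<epsilon>' / 2\<close>; the other half of \<open>\<epsilon>'\<close> is room for the
    parameter \<open>t\<close> below.\<close>
  have main: "\<exists>C>0. \<forall>G \<psi>. smooth_on unit_disk \<psi> \<and> solves_dirac_eq G H unit_disk \<psi> \<and> energy \<psi> unit_disk < ennreal (\<epsilon>' / 32) \<longrightarrow>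
      \<psi> \<in> sobolev_space B' k p \<and> sobolev_norm B' k p \<psi> \<le> C * sobolev_norm unit_disk 0 4 \<psi>"
    if B': "open B'" "compact (closure B')" "closure B' \<subseteq> unit_disk" and p: "p > 1" for B' p k
  proof -
    \<comment> \<open>Radii and constants are chosen for all points before any solution is given.
      Compactness leaves finitely many of them, and the sum of their constants works on all of
      \<open>B'\<close>.\<close>
    obtain r c where rc: "\<And>q. q \<in> unit_disk \<Longrightarrow> r q > 0" "\<And>q. q \<in> unit_disk \<Longrightarrow> c q > 0"
      "\<And>q f g E x i. q \<in> unit_disk \<Longrightarrow> spin_system h f g \<Longrightarrow> energy_bound f g E \<Longrightarrow> E \<le> \<epsilon>' \<Longrightarrow> x \<in> ball q (r q) \<Longrightarrow> i \<le> k \<Longrightarrow>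
        Dnorm i f x \<le> c q * root 4 E \<and> Dnorm i g x \<le> c q * root 4 E"
      using local[of _ k] by metis
    have "closure B' \<subseteq> (\<Union>q\<in>closure B'. ball q (r q))" using rc(1) B'(3) by fastforce
    then obtain Q where Q: "Q \<subseteq> closure B'" "finite Q" "closure B' \<subseteq> (\<Union>q\<in>Q. ball q (r q))"
      using compactE_image[OF B'(2), of "closure B'" "\<lambda>q. ball q (r q)"] by auto
    define K where "K = (\<Sum>q\<in>Q. c q)"
    have c0: "c q \<ge> 0" if "q \<in> Q" for q
      using rc(2)[of q] that Q(1) B'(3) by (meson less_imp_le subsetD)
    have cK: "c q \<le> K" if "q \<in> Q" for q
      unfolding K_def using that Q(2) c0 by (intro member_le_sum) auto
    have K0: "K \<ge> 0" unfolding K_def using c0 by (rule sum_nonneg)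
    define M where "M = (real (card {\<alpha>. mi_order \<alpha> \<le> k}) * measure lborel B') powr (1 / p)"
    have M0: "M \<ge> 0" by (simp add: M_def)
    \<comment> \<open>The summand 1 secures \<open>C > 0\<close>.\<close>
    define C where "C = M * (4 * K) + 1"
    have "\<psi> \<in> sobolev_space B' k p \<and> sobolev_norm B' k p \<psi> \<le> C * sobolev_norm unit_disk 0 4 \<psi>"
      if s: "smooth_on unit_disk \<psi>" and eq: "solves_dirac_eq G H unit_disk \<psi>" and en: "energy \<psi> unit_disk < ennreal (\<epsilon>' / 32)" for G \<psi>
    proof -
      let ?n = "sobolev_norm unit_disk 0 4 \<psi>"
      define e where "e = ?n ^ 4"
      have fin: "energy \<psi> unit_disk < \<infinity>" using en by (rule less_trans) simp
      note n = sobolev_norm_0_4[OF s fin]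
      have e0: "e \<ge> 0" by (simp add: e_def)
      have "ennreal e < ennreal (\<epsilon>' / 32)" using en n(1) by (simp add: e_def)
      then have e_small: "e < \<epsilon>' / 32" using e0 by (simp add: ennreal_less_iff)
      have sys: "spin_system h (\<lambda>z. \<psi> z $ 2) (\<lambda>z. cnj (\<psi> z $ 1))"
        using spin_system_of_dirac[OF s eq] by (simp add: h_def[abs_def])
      have bound: "norm (mi_deriv \<alpha> \<psi> z) \<le> 4 * K * ?n" if z: "z \<in> B'" and \<alpha>: "mi_order \<alpha> \<le> k" for z \<alpha>
      proof -
        have zc: "z \<in> closure B'" using z closure_subset by blast
        then obtain q where q: "q \<in> Q" "z \<in> ball q (r q)" using Q(3) by blast
        have qD: "q \<in> unit_disk" using q(1) Q(1) B'(3) by blast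
        have zD: "z \<in> unit_disk" using zc B'(3) by blast
        \<comment> \<open>\<open>energy_bound\<close> demands a positive number, so
          \<open>t > 0\<close> is added to \<open>16 * e\<close> and removed by a limit; this
          includes the case \<open>e = 0\<close>.\<close>
        have est: "norm (mi_deriv \<alpha> \<psi> z) \<le> 2 * K * root 4 (16 * e + t)" if t: "0 < t" "t < \<epsilon>' / 2" for t
        proof -
          have "energy_bound (\<lambda>z. \<psi> z $ 2) (\<lambda>z. cnj (\<psi> z $ 1)) (16 * e + t)"
            using n(1) t e0 by (intro energy_bound_of_dirac[where e = e, OF _ s]) (simp_all add: e_def[symmetric])
          moreover have "16 * e + t \<le> \<epsilon>'" using e_small t by simp
          ultimately have d: "Dnorm (mi_order \<alpha>) (\<lambda>z. \<psi> z $ 2) z \<le> c q * root 4 (16 * e + t) \<and> Dnorm (mi_order \<alpha>) (\<lambda>z. cnj (\<psi> z $ 1)) z \<le> c q * root 4 (16 * e + t)"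
            by (rule rc(3)[OF qD sys _ _ q(2) \<alpha>])
          have "c q * root 4 (16 * e + t) \<le> K * root 4 (16 * e + t)"
            using cK[OF q(1)] e0 t by (intro mult_right_mono) auto
          then show ?thesis using norm_mi_deriv_spinor[OF s zD, of \<alpha>] d by linarith
        qed
        have lim: "((\<lambda>t. 2 * K * root 4 (16 * e + t)) \<longlongrightarrow> 2 * K * root 4 (16 * e + 0)) (at_right 0)"
          by (intro tendsto_intros)
        have "\<forall>\<^sub>F t in at_right 0. t \<in> {0<..<\<epsilon>' / 2}" using \<epsilon>' by (intro eventually_at_right_real) simp
        then have "\<forall>\<^sub>F t in at_right 0. norm (mi_deriv \<alpha> \<psi> z) \<le> 2 * K * root 4 (16 * e + t)"
          by eventually_elim (use est in auto)
        from tendsto_lowerbound[OF lim this] have "norm (mi_deriv \<alpha> \<psi> z) \<le> 2 * K * root 4 (16 * e)" by simp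
        also have "root 4 (16 * e) = 2 * ?n"
        proof -
          have "16 * e = (2 * ?n) ^ 4" by (simp add: e_def power_mult_distrib)
          then show ?thesis using n(2) by (simp only: real_root_power_cancel[of 4 "2 * ?n"])
        qed
        finally show ?thesis by simp
      qed
      have bd: "bounded B'" by (rule bounded_subset[OF compact_imp_bounded[OF B'(2)] closure_subset])
      have sB: "smooth_on B' \<psi>" by (rule smooth_on_subset[OF s subset_trans[OF closure_subset B'(3)]])
      have nn: "4 * K * ?n \<ge> 0" using K0 n(2) by simp
      note S = sobolev_norm_le[OF B'(1) bd sB p nn bound]
      have "sobolev_norm B' k p \<psi> \<le> M * (4 * K * ?n)" using S(2) by (simp add: M_def)
      also have "\<dots> \<le> C * ?n" using n(2) by (simp add: C_def distrib_right mult.assoc)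
      finally show ?thesis using S(1) by blast
    qed
    moreover have "C > 0" using M0 K0 by (simp add: C_def add_nonneg_pos)
    ultimately show ?thesis by blast
  qed
  show ?thesis
    by (intro exI[of _ "\<epsilon>' / 32"] conjI allI impI main; (elim conjE)?) (use \<epsilon>' in simp)
qed

end
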